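(* Let $0\to M'\to M\to M''\to 0$ be a short exact sequence of finitely generated $\mathbb{N}^d$-graded $S$-modules (with degree-preserving maps), and let $\mathbf{k}\in\mathbb{N}^d$. Then: (i) $e(M;\mathbf{k})$ is defined if and only if both $e(M';\mathbf{k})$ and $e(M'';\mathbf{k})$ are defined. (ii) If $e(M;\mathbf{k})$ is defined, then $e(M;\mathbf{k})=e(M';\mathbf{k})+e(M'';\mathbf{k})$.
   Context: $\mathbb{N}$ denotes the nonnegative integers and $d\ge 1$ is an integer. $(A,\mathfrak{m})$ is an Artinian local ring with infinite residue field; $S=\bigoplus_{\mathbf{n}\in\mathbb{N}^d}S_{\mathbf{n}}$ is a finitely generated standard $\mathbb{N}^d$-graded (commutative) algebra over $A$, i.e. $S$ is generated over $A$ by elements of total degree $1$. On $\mathbb{N}^d$, $\mathbf{h}>\mathbf{k}$ means $\mathbf{h}\ge\mathbf{k}$ componentwise and $\mathbf{h}\ne\mathbf{k}$. "For all large $\mathbf{n}$" means for all $\mathbf{n}$ with every component sufficiently large. Mixed multiplicities: $\ell_A$ denotes length. For every finitely generated $\mathbb{N}^d$-graded $S$-module $M=\bigoplus_{\mathbf{n}\in\mathbb{N}^d}M_{\mathbf{n}}$ and all large $\mathbf{n}$, $\ell_A[M_{\mathbf{n}}]$ equals a polynomial $P_M(\mathbf{n})$ (the Hilbert polynomial), written uniquely as $P_M(\mathbf{n})=\sum_{\mathbf{k}\in\mathbb{N}^d}e(M;\mathbf{k})\binom{\mathbf{n}+\mathbf{k}}{\mathbf{k}}$ with $e(M;\mathbf{k})\in\mathbb{Z}$,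 where $\binom{\mathbf{n}+\mathbf{k}}{\mathbf{k}}=\prod_{i=1}^d\binom{n_i+k_i}{k_i}$. The mixed multiplicity (of maximal degree) of $M$ of the type $\mathbf{k}$ is said to be defined (one says "$e(M;\mathbf{k})$ is defined") if $e(M;\mathbf{h})=0$ for all $\mathbf{h}>\mathbf{k}$, and is then the number $e(M;\mathbf{k})$. *)

theory Defs
  imports
    "HOL-Algebra.QuotRing"
    "HOL-Algebra.Generated_Rings"
    "HOL-Algebra.Module"
    "HOL-Library.Extended_Nat"
    "HOL-Library.Function_Algebras"
begin

text \<open>
  Multi-indices in \<open>\<nat>\<^sup>d\<close> are functions \<open>'d \<Rightarrow> nat\<close> on a finite index type \<open>'d\<close>,
  with \<open>d = CARD('d) \<ge> 1\<close>. The pointwise addition comes from \<^theory>\<open>HOL-Library.Function_Algebras\<close>,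
  and \<open>k < h\<close> on functions means \<open>k i \<le> h i\<close> for all \<open>i\<close> and \<open>k \<noteq> h\<close>.
\<close>

section \<open>Rings and modules\<close>

locale artinian_ring = ring +
  assumes descending_chain_condition:
    "(\<And>n::nat. ideal (I n) R \<and> I (Suc n) \<subseteq> I n) \<Longrightarrow> \<exists>N. \<forall>n\<ge>N. I n = I N"

locale local_ring = cring R + maximalideal \<mm> R for R (structure) and \<mm> +
  assumes unique_maximalideal: "maximalideal J R \<Longrightarrow> J = \<mm>"

definition finitely_generated_module :: "('r, 'x) ring_scheme \<Rightarrow> ('r, 'm) module \<Rightarrow> bool" where
  "finitely_generated_module R M \<longleftrightarrow>
     (\<exists>X. finite X \<and> X \<subseteq> carrier M \<and> \<Inter>{N. submodule N R M \<and> X \<subseteq> N} = carrier M)"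

definition linear_maps ::
  "('r, 'x) ring_scheme \<Rightarrow> ('r, 'm) module \<Rightarrow> ('r, 'n) module \<Rightarrow> ('m \<Rightarrow> 'n) set" where
  "linear_maps R M N =
     {f \<in> hom (add_monoid M) (add_monoid N).
        \<forall>r\<in>carrier R. \<forall>x\<in>carrier M. f (r \<odot>\<^bsub>M\<^esub> x) = r \<odot>\<^bsub>N\<^esub> f x}"

text \<open>The length of a module: the supremum of the lengths \<open>n\<close> of strict chains
  \<open>C 0 \<subset> C 1 \<subset> \<dots> \<subset> C n\<close> of submodules (possibly infinite).\<close>

definition module_length :: "('r, 'x) ring_scheme \<Rightarrow> ('r, 'm) module \<Rightarrow> enat" where
  "module_length R M =
     Sup {enat n |n. \<exists>C. (\<forall>i\<le>n. submodule (C i) R M) \<and> (\<forall>i<n. C i \<subset> C (Suc i))}"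

section \<open>Graded algebras and graded modules\<close>

text \<open>The additive group \<open>G\<close> (underlying a ring or a module) is the internal direct sum
  of the subgroups \<open>X n\<close>.\<close>

definition internal_direct_sum :: "('g, 'x) ring_scheme \<Rightarrow> ('i \<Rightarrow> 'g set) \<Rightarrow> bool" where
  "internal_direct_sum G X \<longleftrightarrow>
     (\<forall>n. additive_subgroup (X n) G) \<and>
     (\<forall>x\<in>carrier G. \<exists>!f. (\<forall>n. f n \<in> X n) \<and> finite {n. f n \<noteq> \<zero>\<^bsub>G\<^esub>} \<and>
        x = (\<Oplus>\<^bsub>G\<^esub>n\<in>{n. f n \<noteq> \<zero>\<^bsub>G\<^esub>}. f n))"

text \<open>The structure homomorphism of an \<open>A\<close>-algebra \<open>S\<close>.\<close>

definition structure_map :: "('a, 's) module \<Rightarrow> 'a \<Rightarrow> 's" where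
  "structure_map S a = a \<odot>\<^bsub>S\<^esub> \<one>\<^bsub>S\<^esub>"

definition generates_algebra :: "'a ring \<Rightarrow> ('a, 's) module \<Rightarrow> 's set \<Rightarrow> bool" where
  "generates_algebra A S X \<longleftrightarrow>
     X \<subseteq> carrier S \<and> generate_ring S (structure_map S ` carrier A \<union> X) = carrier S"

locale standard_graded_algebra = algebra A S
  for A :: "'a ring" and S :: "('a, 's) module"
  and SG :: "('d::finite \<Rightarrow> nat) \<Rightarrow> 's set" +
  assumes direct_sum: "internal_direct_sum S SG"
    and mult_graded: "x \<in> SG m \<Longrightarrow> y \<in> SG n \<Longrightarrow> x \<otimes>\<^bsub>S\<^esub> y \<in> SG (m + n)"
    and scalars_degree_zero: "a \<in> carrier A \<Longrightarrow> structure_map S a \<in> SG 0"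
    and finitely_generated: "\<exists>X. finite X \<and> generates_algebra A S X"
    and standard: "generates_algebra A S (\<Union>n\<in>{n. (\<Sum>i\<in>UNIV. n i) = 1}. SG n)"

locale graded_module = module S M
  for S :: "('a, 's) module" and SG :: "('d::finite \<Rightarrow> nat) \<Rightarrow> 's set"
  and M :: "('s, 'm) module" and MG :: "('d \<Rightarrow> nat) \<Rightarrow> 'm set" +
  assumes direct_sum: "internal_direct_sum M MG"
    and smult_graded: "s \<in> SG m \<Longrightarrow> x \<in> MG n \<Longrightarrow> s \<odot>\<^bsub>M\<^esub> x \<in> MG (m + n)"

text \<open>A homogeneous component \<open>M\<^sub>n\<close> of a graded \<open>S\<close>-module, with its \<open>A\<close>-module structure
  obtained by restriction of scalars. The multiplicative fields are irrelevant for modules.\<close>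

definition component_module :: "('a, 's) module \<Rightarrow> ('s, 'm) module \<Rightarrow> 'm set \<Rightarrow> ('a, 'm) module" where
  "component_module S M Mn =
     \<lparr>carrier = Mn, mult = mult M, one = one M, zero = zero M, add = add M,
      smult = (\<lambda>a x. structure_map S a \<odot>\<^bsub>M\<^esub> x)\<rparr>"

definition graded_short_exact ::
  "('r, 'x) ring_scheme \<Rightarrow> ('r, 'm1) module \<Rightarrow> ('i \<Rightarrow> 'm1 set) \<Rightarrow> ('r, 'm) module \<Rightarrow> ('i \<Rightarrow> 'm set)
   \<Rightarrow> ('r, 'm2) module \<Rightarrow> ('i \<Rightarrow> 'm2 set) \<Rightarrow> ('m1 \<Rightarrow> 'm) \<Rightarrow> ('m \<Rightarrow> 'm2) \<Rightarrow> bool" where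
  "graded_short_exact R M' MG' M MG M'' MG'' f g \<longleftrightarrow>
     f \<in> linear_maps R M' M \<and> (\<forall>n. f ` MG' n \<subseteq> MG n) \<and>
     g \<in> linear_maps R M M'' \<and> (\<forall>n. g ` MG n \<subseteq> MG'' n) \<and>
     inj_on f (carrier M') \<and>
     f ` carrier M' = a_kernel M M'' g \<and>
     g ` carrier M = carrier M''"

section \<open>Hilbert polynomials and mixed multiplicities\<close>

definition binomial_polynomial :: "(('d::finite \<Rightarrow> nat) \<Rightarrow> int) \<Rightarrow> ('d \<Rightarrow> nat) \<Rightarrow> int" where
  "binomial_polynomial c n = (\<Sum>k | c k \<noteq> 0. c k * (\<Prod>i\<in>UNIV. int ((n i + k i) choose k i)))"

text \<open>\<open>c\<close> is the (finitely supported) family of coefficients of the Hilbert polynomial of \<open>M\<close>.\<close>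

definition hilbert_coefficients ::
  "'a ring \<Rightarrow> ('a, 's) module \<Rightarrow> ('s, 'm) module \<Rightarrow> (('d::finite \<Rightarrow> nat) \<Rightarrow> 'm set)
   \<Rightarrow> (('d \<Rightarrow> nat) \<Rightarrow> int) \<Rightarrow> bool" where
  "hilbert_coefficients A S M MG c \<longleftrightarrow>
     finite {k. c k \<noteq> 0} \<and>
     (\<exists>N. \<forall>n. (\<forall>i. N \<le> n i) \<longrightarrow>
        (\<exists>l. module_length A (component_module S M (MG n)) = enat l \<and>
             int l = binomial_polynomial c n))"

text \<open>The description below is proper for finitely generated graded modules over a standard
  graded algebra over an Artinian local ring: such \<open>c\<close> exists (Hilbert), and it is unique since the
  products of binomials are linearly independent as functions of all large \<open>n\<close>.\<close>

definition mixed_coefficient ::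
  "'a ring \<Rightarrow> ('a, 's) module \<Rightarrow> ('s, 'm) module \<Rightarrow> (('d::finite \<Rightarrow> nat) \<Rightarrow> 'm set)
   \<Rightarrow> ('d \<Rightarrow> nat) \<Rightarrow> int" where
  "mixed_coefficient A S M MG = (THE c. hilbert_coefficients A S M MG c)"

definition mixed_multiplicity_defined ::
  "'a ring \<Rightarrow> ('a, 's) module \<Rightarrow> ('s, 'm) module \<Rightarrow> (('d::finite \<Rightarrow> nat) \<Rightarrow> 'm set)
   \<Rightarrow> ('d \<Rightarrow> nat) \<Rightarrow> bool" where
  "mixed_multiplicity_defined A S M MG k \<longleftrightarrow> (\<forall>h. h > k \<longrightarrow> mixed_coefficient A S M MG h = 0)"

end

theory Submission
  imports Defs
begin

text \<open>
  The Hilbert function is additive in a short exact sequence, because length is. As a Hilbert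
  polynomial determines its coefficients (\<open>binomial_polynomial_unique\<close>), the coefficients add as well:
  \<open>e(M;h) = e(M';h) + e(M'';h)\<close> for every \<open>h\<close>. This gives the second claim and one direction of the
  first. The other direction must exclude that \<open>e(M';h)\<close> and \<open>e(M'';h)\<close> cancel for some \<open>h > k\<close>.
  Choose \<open>h\<close> maximal among the indices above \<open>k\<close> where one of the two is nonzero: at such an \<open>h\<close> both
  multiplicities are defined, so it suffices that a defined mixed multiplicity is nonnegative
  (\<open>nonneg_top\<close>, \<open>nonneg_top_summands_vanish\<close>).

  Nonnegativity does not follow from \<open>P\<^sub>M(n) \<ge> 0\<close> alone: with two variables,
  \<open>x\<^sup>2 - x * y + y\<^sup>2\<close> takes nonnegative values only, yet the coefficient at \<open>(1, 1)\<close>, above which all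
  coefficients vanish, is negative. One has to know that suitable differences of \<open>P\<^sub>M\<close> are again Hilbert
  polynomials. The existence of the Hilbert polynomial and its nonnegativity are therefore proved
  together, by a devissage of the subquotients \<open>N / L\<close> of a fixed \<open>M\<close>.

  Let \<open>X\<close> be a finite set of algebra generators of degree one, and let \<open>z\<close> be one of them. The chain
  \<open>L \<subseteq> (L : z) \<subseteq> (L : z\<^sup>2) \<subseteq> \<dots>\<close> inside \<open>N\<close> becomes stationary. Its successive quotients are killed by \<open>z\<close>,
  and on the quotient of \<open>N\<close> by its last member \<open>z\<close> acts injectively. Every other generator that kills
  \<open>N / L\<close>, or acts injectively on it, keeps this property on the pieces concerned. Both the existence
  of a polynomial and nonnegativity pass to extensions, so one may assume that each generator either
  kills \<open>N / L\<close> or acts injectively on it. If for some \<open>i\<close> all generators of degree \<open>i\<close> (the \<open>i\<close>-th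
  unit vector) kill \<open>N / L\<close>, then its components vanish in all large degrees
  (\<open>has_nonneg_polynomial_missing_direction\<close>). Otherwise there is for each \<open>i\<close> an injective generator
  \<open>s\<close> of degree \<open>i\<close>, and the \<open>i\<close>-th difference of the Hilbert function is the Hilbert function of
  \<open>N / (L + s N)\<close>, on which one more generator acts as zero. So by induction all differences are
  polynomials with the nonnegativity property; hence so is the function itself
  (\<open>polynomial_of_polynomial_differences\<close>, \<open>nonneg_top_of_differences\<close>).

  The chain conditions come from a form of Hilbert's basis theorem for abelian groups with commuting
  operators (\<open>basis_theorem\<close>) and from the fact that a commutative Artinian ring has finite length
  (\<open>artinian_finite_length\<close>). Subquotients are represented by pairs \<open>L \<subseteq> N\<close> and their lengths by
  chains of submodules between \<open>L\<close> and \<open>N\<close>; so all inductions stay inside the type of the elements of \<open>M\<close>,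
  which iterated quotients would leave.
\<close>

section \<open>Lengths of intervals in families of sets\<close>

fun strict_chain :: "('g set \<Rightarrow> bool) \<Rightarrow> nat \<Rightarrow> 'g set \<Rightarrow> 'g set \<Rightarrow> bool" where
  "strict_chain P 0 U V \<longleftrightarrow> P V \<and> U = V"
| "strict_chain P (Suc n) U V \<longleftrightarrow> (\<exists>W. strict_chain P n U W \<and> W \<subset> V \<and> P V)"

text \<open>
  The length of a quotient \<open>N / L\<close>, read off from the members of the family between \<open>L\<close> and \<open>N\<close>.
\<close>

definition interval_length :: "('g set \<Rightarrow> bool) \<Rightarrow> 'g set \<Rightarrow> 'g set \<Rightarrow> enat" where
  "interval_length P L N = Sup {enat n |n. \<exists>U V. strict_chain P n U V \<and> L \<subseteq> U \<and> V \<subseteq> N}"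

lemma strict_chain_member: "strict_chain P n U V \<Longrightarrow> P U \<and> P V \<and> U \<subseteq> V"
  by (induction n arbitrary: V) auto

lemma strict_chain_trans:
  "strict_chain P m U V \<Longrightarrow> strict_chain P n V W \<Longrightarrow> strict_chain P (n + m) U W"
  by (induction n arbitrary: W) auto

text \<open>
  The link with chains given as sequences, the form in which the length of a module is defined.
\<close>

lemma strict_chain_sequence:
  "(\<exists>U V. strict_chain P n U V \<and> L \<subseteq> U \<and> V \<subseteq> N) \<longleftrightarrow>
   (\<exists>C. (\<forall>i\<le>n. P (C i) \<and> L \<subseteq> C i \<and> C i \<subseteq> N) \<and> (\<forall>i<n. C i \<subset> C (Suc i)))"
proof
  have "\<exists>C. C n = V \<and> (\<forall>i\<le>n. P (C i) \<and> U \<subseteq> C i \<and> C i \<subseteq> V) \<and> (\<forall>i<n. C i \<subset> C (Suc i))"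
    if "strict_chain P n U V" for U V
    using that
  proof (induction n arbitrary: V)
    case 0
    then show ?case by (intro exI[of _ "\<lambda>_. V"]) auto
  next
    case (Suc n)
    then obtain W where W: "strict_chain P n U W" "W \<subset> V" "P V" by auto
    from Suc.IH[OF W(1)] obtain C where
      C: "C n = W" "\<forall>i\<le>n. P (C i) \<and> U \<subseteq> C i \<and> C i \<subseteq> W" "\<forall>i<n. C i \<subset> C (Suc i)" by blast
    have "U \<subseteq> V" using strict_chain_member[OF W(1)] W(2) by auto
    have below: "C i \<subseteq> V" if "i \<le> n" for i using C(2) W(2) that by blast
    show ?case
      using C W below \<open>U \<subseteq> V\<close>
      by (intro exI[of _ "C(Suc n := V)"]) (auto simp: le_Suc_eq less_Suc_eq)
  qed
  then show "\<exists>U V. strict_chain P n U V \<and> L \<subseteq> U \<and> V \<subseteq> N \<Longrightarrow>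
    \<exists>C. (\<forall>i\<le>n. P (C i) \<and> L \<subseteq> C i \<and> C i \<subseteq> N) \<and> (\<forall>i<n. C i \<subset> C (Suc i))"
    by (meson order_trans)
next
  assume "\<exists>C. (\<forall>i\<le>n. P (C i) \<and> L \<subseteq> C i \<and> C i \<subseteq> N) \<and> (\<forall>i<n. C i \<subset> C (Suc i))"
  then obtain C where
    C: "\<forall>i\<le>n. P (C i) \<and> L \<subseteq> C i \<and> C i \<subseteq> N" "\<forall>i<n. C i \<subset> C (Suc i)" by blast
  have "strict_chain P j (C 0) (C j)" if "j \<le> n" for j
    using that
  proof (induction j)
    case 0
    then show ?case using C(1) by auto
  next
    case (Suc j)
    then have "strict_chain P j (C 0) (C j)" "C j \<subset> C (Suc j)" "P (C (Suc j))"
      using C by auto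
    then show ?case by auto
  qed
  from this[of n] C show "\<exists>U V. strict_chain P n U V \<and> L \<subseteq> U \<and> V \<subseteq> N"
    by blast
qed

lemma interval_length_upper:
  "strict_chain P n U V \<Longrightarrow> L \<subseteq> U \<Longrightarrow> V \<subseteq> N \<Longrightarrow> enat n \<le> interval_length P L N"
  unfolding interval_length_def by (rule Sup_upper) blast

lemma interval_length_least:
  "(\<And>n U V. strict_chain P n U V \<Longrightarrow> L \<subseteq> U \<Longrightarrow> V \<subseteq> N \<Longrightarrow> enat n \<le> l) \<Longrightarrow> interval_length P L N \<le> l"
  unfolding interval_length_def by (rule Sup_least) blast

lemma interval_length_mono:
  "L \<subseteq> L' \<Longrightarrow> N' \<subseteq> N \<Longrightarrow> interval_length P L' N' \<le> interval_length P L N"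
  by (rule interval_length_least) (meson interval_length_upper order_trans)

lemma interval_length_refl: "interval_length P L L = 0"
proof -
  have "interval_length P L L \<le> 0"
  proof (rule interval_length_least)
    fix n U V assume *: "strict_chain P n U V" "L \<subseteq> U" "V \<subseteq> L"
    show "enat n \<le> 0"
    proof (cases n)
      case (Suc m)
      with *(1) obtain W where W: "strict_chain P m U W" "W \<subset> V" by auto
      from strict_chain_member[OF W(1)] W(2) *(2,3) have False by blast
      then show ?thesis ..
    qed (simp add: zero_enat_def)
  qed
  then show ?thesis by simp
qed

lemma interval_length_psubset:
  assumes "P L" "P N" "L \<subset> N"
  shows "1 \<le> interval_length P L N"
proof -
  have "strict_chain P 1 L N" using assms by auto
  from interval_length_upper[OF this order_refl order_refl]
  show ?thesis by (simp add: one_enat_def)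
qed

lemma interval_length_le_1:
  assumes "\<And>V. P V \<Longrightarrow> L \<subseteq> V \<Longrightarrow> V \<subseteq> N \<Longrightarrow> V = L \<or> V = N"
  shows "interval_length P L N \<le> 1"
proof (rule interval_length_least)
  fix n U V assume *: "strict_chain P n U V" "L \<subseteq> U" "V \<subseteq> N"
  show "enat n \<le> 1"
  proof (rule ccontr)
    assume "\<not> enat n \<le> 1"
    then obtain m where "n = Suc (Suc m)"
      by (metis One_nat_def Suc_le_mono enat_ord_simps(1) le0 not0_implies_Suc one_enat_def)
    with *(1) obtain W W' where W: "strict_chain P m U W" "W \<subset> W'" "P W'" "W' \<subset> V" by auto
    have "U \<subseteq> W" using strict_chain_member[OF W(1)] by blast
    with W assms[of W'] *(2,3) show False by blast
  qed
qed

text \<open>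
  A strictly increasing map between two intervals carries chains to chains of the same length. Two such
  maps in opposite directions give equality of lengths.
\<close>

lemma interval_length_le_map:
  assumes mem: "\<And>U. P U \<Longrightarrow> L \<subseteq> U \<Longrightarrow> U \<subseteq> N \<Longrightarrow> Q (\<phi> U) \<and> L' \<subseteq> \<phi> U \<and> \<phi> U \<subseteq> N'"
    and strict: "\<And>U V. P U \<Longrightarrow> P V \<Longrightarrow> L \<subseteq> U \<Longrightarrow> U \<subset> V \<Longrightarrow> V \<subseteq> N \<Longrightarrow> \<phi> U \<subset> \<phi> V"
  shows "interval_length P L N \<le> interval_length Q L' N'"
proof (rule interval_length_least)
  fix n U V assume *: "strict_chain P n U V" "L \<subseteq> U" "V \<subseteq> N"
  have "strict_chain Q n (\<phi> U) (\<phi> V)" using *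
  proof (induction n arbitrary: V)
    case 0
    then show ?case using mem by auto
  next
    case (Suc n)
    then obtain W where W: "strict_chain P n U W" "W \<subset> V" "P V" by auto
    with Suc have "strict_chain Q n (\<phi> U) (\<phi> W)" by auto
    moreover have "\<phi> W \<subset> \<phi> V" using strict strict_chain_member[OF W(1)] W Suc.prems by blast
    moreover have "Q (\<phi> V)" using mem strict_chain_member[OF W(1)] W Suc.prems by blast
    ultimately show ?case by auto
  qed
  moreover have "L' \<subseteq> \<phi> U" "\<phi> V \<subseteq> N'" using * mem strict_chain_member[OF *(1)] by blast+
  ultimately show "enat n \<le> interval_length Q L' N'" by (rule interval_length_upper)
qed

lemma Sup_enat_attained:
  fixes X :: "enat set"
  assumes "X \<noteq> {}" "Sup X \<noteq> \<infinity>"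
  shows "Sup X \<in> X"
  using assms by (auto simp: Sup_enat_def split: if_splits intro: Max_in)

text \<open>
  A supremum of extended naturals is infinite or attained, so a bound on the sums of elements is a bound
  on the sum of the suprema.
\<close>

lemma Sup_enat_add_le:
  fixes X Y :: "enat set"
  assumes "X \<noteq> {}" "Y \<noteq> {}" and le: "\<And>x y. x \<in> X \<Longrightarrow> y \<in> Y \<Longrightarrow> x + y \<le> z"
  shows "Sup X + Sup Y \<le> z"
proof -
  have X: "x \<le> z" if "x \<in> X" for x
    proof -
    obtain y where "y \<in> Y" using assms(2) by blast
    have "x \<le> x + y" by simp
    also have "\<dots> \<le> z" using le that \<open>y \<in> Y\<close> by blast
    finally show ?thesis .
  qed
  have Y: "y \<le> z" if "y \<in> Y" for y
    proof -
    obtain x where "x \<in> X" using assms(1) by blast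
    have "y \<le> x + y" by simp
    also have "\<dots> \<le> z" using le that \<open>x \<in> X\<close> by blast
    finally show ?thesis .
  qed
  show ?thesis
  proof (cases "Sup X = \<infinity> \<or> Sup Y = \<infinity>")
    case True
    with Sup_least[of X z] Sup_least[of Y z] X Y have "z = \<infinity>" by auto
    then show ?thesis by simp
  next
    case False
    then show ?thesis using le Sup_enat_attained assms by blast
  qed
qed

text \<open>
  The lattice of submodules enters the theory of length only through these laws.
\<close>

locale modular_family =
  fixes P :: "'g set \<Rightarrow> bool" and join :: "'g set \<Rightarrow> 'g set \<Rightarrow> 'g set"
  assumes inter_mem: "P U \<Longrightarrow> P V \<Longrightarrow> P (U \<inter> V)"
    and join_mem: "P U \<Longrightarrow> P V \<Longrightarrow> P (join U V)"
    and join_upper1: "P U \<Longrightarrow> P V \<Longrightarrow> U \<subseteq> join U V"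
    and join_upper2: "P U \<Longrightarrow> P V \<Longrightarrow> V \<subseteq> join U V"
    and join_least: "P U \<Longrightarrow> P V \<Longrightarrow> P W \<Longrightarrow> U \<subseteq> W \<Longrightarrow> V \<subseteq> W \<Longrightarrow> join U V \<subseteq> W"
    and modular: "P U \<Longrightarrow> P V \<Longrightarrow> P N \<Longrightarrow> U \<subseteq> V \<Longrightarrow> U \<inter> N = V \<inter> N \<Longrightarrow> join U N = join V N \<Longrightarrow> U = V"
begin

text \<open>
  Each strict step \<open>W \<subset> V\<close> stays strict after intersecting with \<open>N\<close> or after joining with \<open>N\<close>: if
  both became equalities, the modular law would give \<open>W = V\<close>. So the chain projects to two chains with
  at least as many steps in total.
\<close>

lemma strict_chain_split:
  assumes "strict_chain P n U V" "P N"
  shows "\<exists>a b. n \<le> a + b \<and> strict_chain P a (U \<inter> N) (V \<inter> N) \<and> strict_chain P b (join U N) (join V N)"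
  using assms(1)
proof (induction n arbitrary: V)
  case 0
  then show ?case using inter_mem join_mem assms(2)
    by (intro exI[of _ 0]) auto
next
  case (Suc n)
  then obtain W where W: "strict_chain P n U W" "W \<subset> V" "P V" by auto
  from Suc.IH[OF W(1)] obtain a b where
    ab: "n \<le> a + b" "strict_chain P a (U \<inter> N) (W \<inter> N)" "strict_chain P b (join U N) (join W N)"
    by blast
  have "P W" using strict_chain_member[OF W(1)] by blast
  have mem: "P (V \<inter> N)" "P (join V N)" using inter_mem join_mem W assms(2) by auto
  have sub: "W \<inter> N \<subseteq> V \<inter> N" using W by auto
  have sub': "join W N \<subseteq> join V N"
    using W assms(2) \<open>P W\<close> mem by (meson join_least join_upper1 join_upper2 order_trans psubset_imp_subset)
  show ?case
  proof (cases "W \<inter> N = V \<inter> N")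
    case True
    then have "join W N \<noteq> join V N" using modular[OF \<open>P W\<close> W(3) assms(2)] W(2) by blast
    then have "strict_chain P (Suc b) (join U N) (join V N)" using ab mem sub' by auto
    with ab(1,2) True show ?thesis by (intro exI[of _ a] exI[of _ "Suc b"]) auto
  next
    case False
    then have A: "strict_chain P (Suc a) (U \<inter> N) (V \<inter> N)" using ab mem sub by auto
    show ?thesis
    proof (cases "join W N = join V N")
      case True
      with ab A show ?thesis by (intro exI[of _ "Suc a"] exI[of _ b]) auto
    next
      case False
      then have "strict_chain P (Suc b) (join U N) (join V N)" using ab mem sub' by auto
      with ab(1) A show ?thesis by (intro exI[of _ "Suc a"] exI[of _ "Suc b"]) auto
    qed
  qed
qed

lemma interval_length_add:
  assumes "P L" "P N" "P K" "L \<subseteq> N" "N \<subseteq> K"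
  shows "interval_length P L K = interval_length P L N + interval_length P N K"
proof (rule antisym)
  show "interval_length P L K \<le> interval_length P L N + interval_length P N K"
  proof (rule interval_length_least)
    fix n U V assume *: "strict_chain P n U V" "L \<subseteq> U" "V \<subseteq> K"
    have UV: "P U" "P V" using strict_chain_member[OF *(1)] by blast+
    from strict_chain_split[OF *(1) assms(2)] obtain a b where
      ab: "n \<le> a + b" "strict_chain P a (U \<inter> N) (V \<inter> N)" "strict_chain P b (join U N) (join V N)" by blast
    have "enat a \<le> interval_length P L N"
      by (rule interval_length_upper[OF ab(2)]) (use * assms in auto)
    moreover have "enat b \<le> interval_length P N K"
      by (rule interval_length_upper[OF ab(3)])
         (use * assms UV join_upper2 join_least[of V N K] in auto)
    ultimately have "enat a + enat b \<le> interval_length P L N + interval_length P N K"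
      by (rule add_mono)
    moreover have "enat n \<le> enat a + enat b" using ab(1) by simp
    ultimately show "enat n \<le> interval_length P L N + interval_length P N K"
      by (rule order_trans[rotated])
  qed
next
  show "interval_length P L N + interval_length P N K \<le> interval_length P L K"
    unfolding interval_length_def[of P L N] interval_length_def[of P N K]
  proof (rule Sup_enat_add_le)
    have "strict_chain P 0 L L" "strict_chain P 0 N N" using assms by auto
    then show "{enat n |n. \<exists>U V. strict_chain P n U V \<and> L \<subseteq> U \<and> V \<subseteq> N} \<noteq> {}"
      "{enat n |n. \<exists>U V. strict_chain P n U V \<and> N \<subseteq> U \<and> V \<subseteq> K} \<noteq> {}" using assms by blast+
    fix x y
    assume "x \<in> {enat n |n. \<exists>U V. strict_chain P n U V \<and> L \<subseteq> U \<and> V \<subseteq> N}"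
      and "y \<in> {enat n |n. \<exists>U V. strict_chain P n U V \<and> N \<subseteq> U \<and> V \<subseteq> K}"
    then obtain m n U V U' V' where
      m: "x = enat m" "strict_chain P m U V" "L \<subseteq> U" "V \<subseteq> N" and
      n: "y = enat n" "strict_chain P n U' V'" "N \<subseteq> U'" "V' \<subseteq> K" by blast
    have "\<exists>k\<ge>m + n. strict_chain P k U V'"
    proof (cases "V = U'")
      case True
      with m n strict_chain_trans[of P m U V n V'] show ?thesis by (auto simp: add.commute)
    next
      case False
      then have "V \<subset> U'" using m n by auto
      moreover have "P U'" using strict_chain_member[OF n(2)] by blast
      ultimately have "strict_chain P (Suc m) U U'" using m(2) by auto
      from strict_chain_trans[OF this n(2)] show ?thesis by (intro exI[of _ "n + Suc m"]) auto
    qed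
    then obtain k where "k \<ge> m + n" "strict_chain P k U V'" by blast
    moreover have "enat k \<le> interval_length P L K"
      by (rule interval_length_upper) (use calculation m n in auto)
    moreover have "x + y \<le> enat k" using m(1) n(1) calculation(1) by simp
    ultimately show "x + y \<le> interval_length P L K" by (meson order_trans)
  qed
qed

end

section \<open>Abelian groups with commuting operators\<close>

lemma additive_map_zero:
  assumes "abelian_group G" "abelian_group H"
    and closed: "\<And>x. x \<in> carrier G \<Longrightarrow> \<phi> x \<in> carrier H"
    and add: "\<And>x y. x \<in> carrier G \<Longrightarrow> y \<in> carrier G \<Longrightarrow> \<phi> (x \<oplus>\<^bsub>G\<^esub> y) = \<phi> x \<oplus>\<^bsub>H\<^esub> \<phi> y"
  shows "\<phi> \<zero>\<^bsub>G\<^esub> = \<zero>\<^bsub>H\<^esub>"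
proof -
  interpret G: abelian_group G by fact
  interpret H: abelian_group H by fact
  show ?thesis
    using add[of "\<zero>\<^bsub>G\<^esub>" "\<zero>\<^bsub>G\<^esub>"] closed[of "\<zero>\<^bsub>G\<^esub>"]
    by (metis G.l_zero G.zero_closed H.add.r_cancel_one')
qed

text \<open>
  One notion for the ring \<open>A\<close> acting on itself and for the module \<open>M\<close> under any set of scalars in \<open>S\<close>.
  Submodules are the subgroups stable under a subset \<open>T\<close> of the operators; varying \<open>T\<close> on a fixed
  group makes it possible to add one generator of the algebra at a time.
\<close>

locale operator_group = abelian_group G for G :: "('g, 'x) ring_scheme" (structure) +
  fixes act :: "'i \<Rightarrow> 'g \<Rightarrow> 'g" and J :: "'i set"
  assumes act_closed [simp, intro]: "s \<in> J \<Longrightarrow> x \<in> carrier G \<Longrightarrow> act s x \<in> carrier G"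
    and act_add: "s \<in> J \<Longrightarrow> x \<in> carrier G \<Longrightarrow> y \<in> carrier G \<Longrightarrow> act s (x \<oplus> y) = act s x \<oplus> act s y"
    and act_commute: "s \<in> J \<Longrightarrow> t \<in> J \<Longrightarrow> x \<in> carrier G \<Longrightarrow> act s (act t x) = act t (act s x)"
begin

definition stable :: "'i set \<Rightarrow> 'g set \<Rightarrow> bool" where
  "stable T U \<longleftrightarrow> additive_subgroup U G \<and> (\<forall>t\<in>T. \<forall>u\<in>U. act t u \<in> U)"

lemma stable_subset: "stable T U \<Longrightarrow> U \<subseteq> carrier G"
  by (simp add: stable_def additive_subgroup.a_subset)

lemma stable_carrier_mem: "stable T U \<Longrightarrow> u \<in> U \<Longrightarrow> u \<in> carrier G"
  using stable_subset by blast

lemma stable_zero [simp]: "stable T U \<Longrightarrow> \<zero> \<in> U"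
  by (simp add: stable_def additive_subgroup.zero_closed)

lemma stable_add: "stable T U \<Longrightarrow> u \<in> U \<Longrightarrow> v \<in> U \<Longrightarrow> u \<oplus> v \<in> U"
  by (simp add: stable_def additive_subgroup.a_closed)

lemma stable_inv: "stable T U \<Longrightarrow> u \<in> U \<Longrightarrow> \<ominus> u \<in> U"
  unfolding stable_def by (metis additive_subgroup.a_inv_closed abelian_group_axioms)

lemma stable_minus: "stable T U \<Longrightarrow> u \<in> U \<Longrightarrow> v \<in> U \<Longrightarrow> u \<ominus> v \<in> U"
  by (simp add: a_minus_def stable_add stable_inv)

lemma stable_act: "stable T U \<Longrightarrow> t \<in> T \<Longrightarrow> u \<in> U \<Longrightarrow> act t u \<in> U"
  by (simp add: stable_def)

lemma stable_antimono: "stable T U \<Longrightarrow> T' \<subseteq> T \<Longrightarrow> stable T' U"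
  by (auto simp: stable_def)

lemma stableI:
  assumes "U \<subseteq> carrier G" "\<zero> \<in> U" "\<And>u v. u \<in> U \<Longrightarrow> v \<in> U \<Longrightarrow> u \<oplus> v \<in> U"
    "\<And>u. u \<in> U \<Longrightarrow> \<ominus> u \<in> U" "\<And>t u. t \<in> T \<Longrightarrow> u \<in> U \<Longrightarrow> act t u \<in> U"
  shows "stable T U"
  unfolding stable_def
proof
  show "additive_subgroup U G"
    using assms(1-4) by (intro additive_subgroupI add.subgroupI) (auto simp flip: a_inv_def)
qed (use assms(5) in auto)

lemma cancel_right: "x \<in> carrier G \<Longrightarrow> y \<in> carrier G \<Longrightarrow> (x \<oplus> y) \<ominus> y = x"
  by (simp add: a_minus_def a_assoc r_neg)

lemma cancel_left: "x \<in> carrier G \<Longrightarrow> y \<in> carrier G \<Longrightarrow> (x \<oplus> y) \<ominus> x = y"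
  by (metis a_comm cancel_right)

lemma minus_add_cancel: "x \<in> carrier G \<Longrightarrow> y \<in> carrier G \<Longrightarrow> (x \<ominus> y) \<oplus> y = x"
  by (simp add: a_minus_def a_assoc l_neg)

lemma stable_add_cancel_left:
  assumes "stable T U" "x \<in> U" "x \<oplus> y \<in> U" "y \<in> carrier G"
  shows "y \<in> U"
  using stable_minus[OF assms(1,3,2)] cancel_left assms stable_carrier_mem by metis

lemma stable_minus_cancel:
  assumes "stable T U" "x \<ominus> y \<in> U" "y \<in> U" "x \<in> carrier G"
  shows "x \<in> U"
  using stable_add[OF assms(1,2,3)] minus_add_cancel assms stable_carrier_mem by metis

lemma act_zero [simp]: "s \<in> J \<Longrightarrow> act s \<zero> = \<zero>"
  using act_add[of s \<zero> \<zero>] by (metis act_closed add.r_cancel_one' l_zero zero_closed)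

lemma act_inv: "s \<in> J \<Longrightarrow> x \<in> carrier G \<Longrightarrow> act s (\<ominus> x) = \<ominus> act s x"
  using act_add[of s "\<ominus> x" x] by (metis act_closed act_zero a_inv_closed l_neg minus_equality)

lemma mem_sumI: "u \<in> U \<Longrightarrow> v \<in> V \<Longrightarrow> u \<oplus> v \<in> U <+>\<^bsub>G\<^esub> V"
  by (auto simp: set_add_def')

lemma mem_sumE:
  assumes "x \<in> U <+>\<^bsub>G\<^esub> V"
  obtains u v where "u \<in> U" "v \<in> V" "x = u \<oplus> v"
  using assms by (auto simp: set_add_def')

lemma stable_Int: "stable T U \<Longrightarrow> stable T V \<Longrightarrow> stable T (U \<inter> V)"
  by (rule stableI) (auto intro: stable_add stable_inv stable_act dest: stable_carrier_mem)

lemma stable_trivial: "T \<subseteq> J \<Longrightarrow> stable T {\<zero>}"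
  by (rule stableI) auto

lemma stable_carrier: "T \<subseteq> J \<Longrightarrow> stable T (carrier G)"
  by (rule stableI) auto

lemma stable_sum:
  assumes "T \<subseteq> J" "stable T U" "stable T V"
  shows "stable T (U <+>\<^bsub>G\<^esub> V)"
proof -
  have sub: "additive_subgroup (U <+>\<^bsub>G\<^esub> V) G"
    using assms add_additive_subgroups by (simp add: stable_def)
  have "act t x \<in> U <+>\<^bsub>G\<^esub> V" if "t \<in> T" "x \<in> U <+>\<^bsub>G\<^esub> V" for t x
  proof -
    from that(2) obtain u v where uv: "u \<in> U" "v \<in> V" "x = u \<oplus> v" by (rule mem_sumE)
    then have "act t x = act t u \<oplus> act t v"
      using assms that by (auto intro!: act_add dest: stable_carrier_mem)
    with uv that show ?thesis using assms by (auto intro: mem_sumI stable_act)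
  qed
  with sub show ?thesis by (auto simp: stable_def)
qed

lemma sum_upper1: "stable T U \<Longrightarrow> stable T V \<Longrightarrow> U \<subseteq> U <+>\<^bsub>G\<^esub> V"
  by (metis mem_sumI r_zero stable_carrier_mem stable_zero subsetI)

lemma sum_upper2: "stable T U \<Longrightarrow> stable T V \<Longrightarrow> V \<subseteq> U <+>\<^bsub>G\<^esub> V"
  by (metis mem_sumI l_zero stable_carrier_mem stable_zero subsetI)

lemma sum_least: "stable T W \<Longrightarrow> U \<subseteq> W \<Longrightarrow> V \<subseteq> W \<Longrightarrow> U <+>\<^bsub>G\<^esub> V \<subseteq> W"
  by (auto elim!: mem_sumE intro: stable_add)

lemma modular_family_stable:
  assumes "T \<subseteq> J"
  shows "modular_family (stable T) (set_add G)"
proof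
  fix U V N assume *: "stable T U" "stable T V" "stable T N" "U \<subseteq> V" "U \<inter> N = V \<inter> N"
    "U <+>\<^bsub>G\<^esub> N = V <+>\<^bsub>G\<^esub> N"
  have "v \<in> U" if "v \<in> V" for v
  proof -
    have "v \<in> U <+>\<^bsub>G\<^esub> N" using that * sum_upper1 by blast
    then obtain u n where un: "u \<in> U" "n \<in> N" "v = u \<oplus> n" by (rule mem_sumE)
    then have "n \<in> V" using stable_add_cancel_left[of T V u n] * that stable_carrier_mem by blast
    with un * have "n \<in> U" by blast
    with un * show ?thesis by (blast intro: stable_add)
  qed
  with * show "U = V" by blast
qed (fact stable_Int stable_sum[OF assms] sum_upper1 sum_upper2 | erule (2) sum_least)+

lemmas length_add = modular_family.interval_length_add[OF modular_family_stable]

abbreviation len :: "'i set \<Rightarrow> 'g set \<Rightarrow> 'g set \<Rightarrow> enat" where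
  "len T \<equiv> interval_length (stable T)"

lemma act_funpow_closed [simp, intro]: "s \<in> J \<Longrightarrow> x \<in> carrier G \<Longrightarrow> (act s ^^ j) x \<in> carrier G"
  by (induction j) auto

lemma act_funpow_add:
  "s \<in> J \<Longrightarrow> x \<in> carrier G \<Longrightarrow> y \<in> carrier G \<Longrightarrow>
    (act s ^^ j) (x \<oplus> y) = (act s ^^ j) x \<oplus> (act s ^^ j) y"
  by (induction j) (auto simp: act_add)

lemma act_funpow_commute:
  "s \<in> J \<Longrightarrow> t \<in> J \<Longrightarrow> x \<in> carrier G \<Longrightarrow> act t ((act s ^^ j) x) = (act s ^^ j) (act t x)"
  by (induction j) (auto simp: act_commute)

lemma act_funpow_zero: "s \<in> J \<Longrightarrow> (act s ^^ j) \<zero> = \<zero>"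
  by (induction j) auto

lemma act_funpow_inv: "s \<in> J \<Longrightarrow> x \<in> carrier G \<Longrightarrow> (act s ^^ j) (\<ominus> x) = \<ominus> (act s ^^ j) x"
  by (induction j) (auto simp: act_inv)

lemma stable_funpow_image:
  assumes "T \<subseteq> J" "s \<in> J" "stable T U"
  shows "stable T ((act s ^^ j) ` U)"
proof (rule stableI)
  fix u v assume "u \<in> (act s ^^ j) ` U" "v \<in> (act s ^^ j) ` U"
  then show "u \<oplus> v \<in> (act s ^^ j) ` U"
    using assms act_funpow_add stable_carrier_mem stable_add by (smt (verit) image_iff)
next
  fix t u assume "t \<in> T" "u \<in> (act s ^^ j) ` U"
  then show "act t u \<in> (act s ^^ j) ` U"
    using assms act_funpow_commute stable_carrier_mem stable_act by (smt (verit) image_iff subsetD)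
next
  fix u assume "u \<in> (act s ^^ j) ` U"
  then show "\<ominus> u \<in> (act s ^^ j) ` U"
    using assms act_funpow_inv stable_carrier_mem stable_inv by (smt (verit) image_iff)
next
  have "\<zero> \<in> U" using assms by simp
  then show "\<zero> \<in> (act s ^^ j) ` U" using act_funpow_zero[OF assms(2), of j] by (metis image_eqI)
qed (use assms stable_carrier_mem in auto)

lemma stable_funpow_vimage:
  assumes "T \<subseteq> J" "s \<in> J" "stable T N" "stable T L"
  shows "stable T {m \<in> N. (act s ^^ j) m \<in> L}"
proof (rule stableI)
  fix t u assume *: "t \<in> T" "u \<in> {m \<in> N. (act s ^^ j) m \<in> L}"
  then have "act t ((act s ^^ j) u) \<in> L" using assms stable_act by blast
  moreover have "act t ((act s ^^ j) u) = (act s ^^ j) (act t u)"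
    using * assms stable_carrier_mem by (intro act_funpow_commute) auto
  ultimately show "act t u \<in> {m \<in> N. (act s ^^ j) m \<in> L}" using * assms stable_act by auto
qed (use assms in \<open>auto simp: act_funpow_zero act_funpow_add act_funpow_inv stable_carrier_mem
    intro: stable_add stable_inv\<close>)

end

text \<open>
  The isomorphism theorem \<open>N / \<phi>\<inverse>(L) \<cong> (\<phi>(N) + L) / L\<close> on the level of lengths. The map \<open>\<tau>\<close> lets an operator
  \<open>t\<close> of the source act on the target as \<open>\<tau> t\<close>, as needed for \<open>a \<mapsto> a x\<close> from the coefficient ring to
  a module. The lemma is applied to this map, to multiplication by ring elements, and to the two maps
  of a short exact sequence.
\<close>

lemma length_hom_image:
  fixes G :: "('g, 'x) ring_scheme" (structure) and H :: "('h, 'y) ring_scheme" (structure)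
  assumes "operator_group G act J" "operator_group H act' J'"
    and T: "T \<subseteq> J" "\<tau> ` T \<subseteq> J'"
    and N: "operator_group.stable G act T N" and L: "operator_group.stable H act' (\<tau> ` T) L"
    and closed: "\<And>x. x \<in> carrier G \<Longrightarrow> \<phi> x \<in> carrier H"
    and hom_add: "\<And>x y. x \<in> carrier G \<Longrightarrow> y \<in> carrier G \<Longrightarrow> \<phi> (x \<oplus> y) = \<phi> x \<oplus>\<^bsub>H\<^esub> \<phi> y"
    and hom_act: "\<And>t x. t \<in> T \<Longrightarrow> x \<in> carrier G \<Longrightarrow> \<phi> (act t x) = act' (\<tau> t) (\<phi> x)"
  shows "interval_length (operator_group.stable G act T) {m \<in> N. \<phi> m \<in> L} N
    = interval_length (operator_group.stable H act' (\<tau> ` T)) L (\<phi> ` N <+>\<^bsub>H\<^esub> L)"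
    and "operator_group.stable G act T {m \<in> N. \<phi> m \<in> L}"
    and "operator_group.stable H act' (\<tau> ` T) (\<phi> ` N)"
    and "operator_group.stable H act' (\<tau> ` T) (\<phi> ` N <+>\<^bsub>H\<^esub> L)"
proof -
  interpret G: operator_group G act J by fact
  interpret H: operator_group H act' J' by fact
  have phi0: "\<phi> \<zero> = \<zero>\<^bsub>H\<^esub>"
    by (rule additive_map_zero[OF G.abelian_group_axioms H.abelian_group_axioms closed hom_add])
  have phi_inv: "\<phi> (\<ominus> x) = \<ominus>\<^bsub>H\<^esub> \<phi> x" if "x \<in> carrier G" for x
    using hom_add[of "\<ominus> x" x] that closed phi0
    by (metis G.a_inv_closed G.l_neg H.minus_equality)
  have phi_minus: "\<phi> (x \<ominus> y) = \<phi> x \<ominus>\<^bsub>H\<^esub> \<phi> y" if "x \<in> carrier G" "y \<in> carrier G" for x y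
    using that by (simp add: a_minus_def hom_add phi_inv)
  have vim: "G.stable T {m \<in> N. \<phi> m \<in> V}" if "H.stable (\<tau> ` T) V" for V
    by (rule G.stableI)
      (use that N phi0 hom_add phi_inv hom_act closed in
        \<open>auto intro: G.stable_add H.stable_add G.stable_inv H.stable_inv G.stable_act H.stable_act
          simp: G.stable_carrier_mem\<close>)
  then show "G.stable T {m \<in> N. \<phi> m \<in> L}" using L by blast
  have im: "H.stable (\<tau> ` T) (\<phi> ` U)" if U: "G.stable T U" for U
  proof (rule H.stableI)
    note G.stable_carrier_mem[OF U, simp]
    show "\<phi> ` U \<subseteq> carrier H" using closed by auto
    show "\<zero>\<^bsub>H\<^esub> \<in> \<phi> ` U" using phi0 G.stable_zero[OF U] by (metis image_eqI)
    show "u \<oplus>\<^bsub>H\<^esub> v \<in> \<phi> ` U" if uv: "u \<in> \<phi> ` U" "v \<in> \<phi> ` U" for u v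
    proof -
      from uv obtain x y where "x \<in> U" "y \<in> U" "u = \<phi> x" "v = \<phi> y" by auto
      then show ?thesis using hom_add[of x y] G.stable_add[OF U] by (metis G.stable_carrier_mem U image_eqI)
    qed
    show "\<ominus>\<^bsub>H\<^esub> u \<in> \<phi> ` U" if u: "u \<in> \<phi> ` U" for u
    proof -
      from u obtain x where "x \<in> U" "u = \<phi> x" by auto
      then show ?thesis using phi_inv[of x] G.stable_inv[OF U] by (metis G.stable_carrier_mem U image_eqI)
    qed
    show "act' t u \<in> \<phi> ` U" if tu: "t \<in> \<tau> ` T" "u \<in> \<phi> ` U" for t u
    proof -
      from tu obtain r x where "r \<in> T" "t = \<tau> r" "x \<in> U" "u = \<phi> x" by auto
      then show ?thesis using hom_act[of r x] G.stable_act[OF U] by (metis G.stable_carrier_mem U image_eqI)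
    qed
  qed
  then show "H.stable (\<tau> ` T) (\<phi> ` N)" using N by blast
  have sum: "H.stable (\<tau> ` T) (\<phi> ` U <+>\<^bsub>H\<^esub> L)" if "G.stable T U" for U
    using H.stable_sum[OF T(2) im[OF that] L] .
  then show "H.stable (\<tau> ` T) (\<phi> ` N <+>\<^bsub>H\<^esub> L)" using N by blast
  have sum_mono: "\<phi> ` U <+>\<^bsub>H\<^esub> L \<subseteq> \<phi> ` V <+>\<^bsub>H\<^esub> L" if "U \<subseteq> V" for U V
    using that by (auto simp: set_add_def')
  show "G.len T {m \<in> N. \<phi> m \<in> L} N = H.len (\<tau> ` T) L (\<phi> ` N <+>\<^bsub>H\<^esub> L)"
  proof (rule antisym)
    show "G.len T {m \<in> N. \<phi> m \<in> L} N \<le> H.len (\<tau> ` T) L (\<phi> ` N <+>\<^bsub>H\<^esub> L)"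
    proof (rule interval_length_le_map[where \<phi> = "\<lambda>U. \<phi> ` U <+>\<^bsub>H\<^esub> L"])
      fix U assume "G.stable T U" "U \<subseteq> N"
      then show "H.stable (\<tau> ` T) (\<phi> ` U <+>\<^bsub>H\<^esub> L) \<and> L \<subseteq> \<phi> ` U <+>\<^bsub>H\<^esub> L \<and>
          \<phi> ` U <+>\<^bsub>H\<^esub> L \<subseteq> \<phi> ` N <+>\<^bsub>H\<^esub> L"
        using sum sum_mono H.sum_upper2[OF im L] by blast
    next
      fix U V assume U: "G.stable T U" and V: "G.stable T V" and
        UV: "{m \<in> N. \<phi> m \<in> L} \<subseteq> U" "U \<subset> V" "V \<subseteq> N"
      then obtain v where v: "v \<in> V" "v \<notin> U" by blast
      have "\<phi> v \<in> \<phi> ` V <+>\<^bsub>H\<^esub> L" using v H.sum_upper1[OF im[OF V] L] by blast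
      moreover have "\<phi> v \<notin> \<phi> ` U <+>\<^bsub>H\<^esub> L"
      proof
        assume "\<phi> v \<in> \<phi> ` U <+>\<^bsub>H\<^esub> L"
        then obtain u l where ul: "u \<in> U" "l \<in> L" "\<phi> v = \<phi> u \<oplus>\<^bsub>H\<^esub> l" by (auto elim!: H.mem_sumE)
        have c: "u \<in> carrier G" "v \<in> carrier G" "l \<in> carrier H"
          using ul v U V L G.stable_carrier_mem H.stable_carrier_mem by blast+
        have "\<phi> (v \<ominus> u) = l" using c ul closed by (simp add: phi_minus H.cancel_left)
        moreover have "v \<ominus> u \<in> N" using G.stable_minus[OF N, of v u] ul v UV by blast
        ultimately have "v \<ominus> u \<in> U" using UV(1) ul(2) by blast
        then show False using G.stable_minus_cancel[OF U _ ul(1) c(2)] v by blast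
      qed
      ultimately show "\<phi> ` U <+>\<^bsub>H\<^esub> L \<subset> \<phi> ` V <+>\<^bsub>H\<^esub> L"
        using sum_mono[of U V] UV by blast
    qed
    show "H.len (\<tau> ` T) L (\<phi> ` N <+>\<^bsub>H\<^esub> L) \<le> G.len T {m \<in> N. \<phi> m \<in> L} N"
    proof (rule interval_length_le_map[where \<phi> = "\<lambda>V. {m \<in> N. \<phi> m \<in> V}"])
      fix V assume "H.stable (\<tau> ` T) V" "L \<subseteq> V"
      then show "G.stable T {m \<in> N. \<phi> m \<in> V} \<and> {m \<in> N. \<phi> m \<in> L} \<subseteq> {m \<in> N. \<phi> m \<in> V} \<and>
          {m \<in> N. \<phi> m \<in> V} \<subseteq> N" using vim by blast
    next
      fix U V assume U: "H.stable (\<tau> ` T) U" and V: "H.stable (\<tau> ` T) V" and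
        UV: "L \<subseteq> U" "U \<subset> V" "V \<subseteq> \<phi> ` N <+>\<^bsub>H\<^esub> L"
      then obtain v where v: "v \<in> V" "v \<notin> U" by blast
      then have "v \<in> \<phi> ` N <+>\<^bsub>H\<^esub> L" using UV by blast
      then obtain m l where ml: "m \<in> N" "l \<in> L" "v = \<phi> m \<oplus>\<^bsub>H\<^esub> l" by (auto elim!: H.mem_sumE)
      have c: "\<phi> m \<in> carrier H" "l \<in> carrier H"
        using ml N L closed G.stable_carrier_mem H.stable_carrier_mem by blast+
      have "\<phi> m \<in> V"
        using H.stable_minus[OF V, of v l] v ml UV c by (auto simp: H.cancel_right)
      moreover have "\<phi> m \<notin> U" using H.stable_add[OF U, of "\<phi> m" l] v ml UV by blast
      ultimately show "{m \<in> N. \<phi> m \<in> U} \<subset> {m \<in> N. \<phi> m \<in> V}" using UV ml by blast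
    qed
  qed
qed

section \<open>Ascending chains and the basis theorem\<close>

lemma enat_add_finite: "a \<noteq> \<infinity> \<Longrightarrow> b \<noteq> \<infinity> \<Longrightarrow> a + b \<noteq> (\<infinity>::enat)"
  by (simp add: plus_eq_infty_iff_enat)

lemma enat_le_finite: "a \<le> b \<Longrightarrow> b \<noteq> \<infinity> \<Longrightarrow> a \<noteq> (\<infinity>::enat)"
  by (cases b; cases a) auto

context operator_group
begin

text \<open>
  The ascending chain condition, as well-foundedness of the reversed strict inclusion.
\<close>

definition acc :: "'i set \<Rightarrow> 'g set \<Rightarrow> bool" where
  "acc T N \<longleftrightarrow> wf {(V, U). stable T U \<and> stable T V \<and> U \<subset> V \<and> V \<subseteq> N}"

lemma acc_maximal:
  assumes "acc T N" "U \<in> \<U>" "\<And>U. U \<in> \<U> \<Longrightarrow> stable T U \<and> U \<subseteq> N"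
  obtains V where "V \<in> \<U>" "\<And>W. W \<in> \<U> \<Longrightarrow> V \<subseteq> W \<Longrightarrow> W = V"
proof -
  obtain V where V: "V \<in> \<U>"
    "\<And>W. (W, V) \<in> {(V, U). stable T U \<and> stable T V \<and> U \<subset> V \<and> V \<subseteq> N} \<Longrightarrow> W \<notin> \<U>"
    by (rule wfE_min[OF assms(1)[unfolded acc_def] assms(2)]) blast
  have "W = V" if W: "W \<in> \<U>" "V \<subseteq> W" for W
    using V(2)[of W] W assms(3)[OF V(1)] assms(3)[OF W(1)] by auto
  with V(1) show ?thesis by (rule that)
qed

lemma acc_stabilises:
  assumes "acc T N" "\<And>k::nat. stable T (C k) \<and> C k \<subseteq> N" "\<And>k. C k \<subseteq> C (Suc k)"
  obtains K where "\<And>k. k \<ge> K \<Longrightarrow> C k = C K"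
proof -
  obtain V where V: "V \<in> range C" "\<And>W. W \<in> range C \<Longrightarrow> V \<subseteq> W \<Longrightarrow> W = V"
    by (rule acc_maximal[OF assms(1), of "C 0" "range C"]) (use assms(2) in auto)
  then obtain K where K: "V = C K" by blast
  have "C k = C K" if "k \<ge> K" for k
    using V(2)[of "C k"] K lift_Suc_mono_le[of C, OF assms(3) that] by blast
  then show ?thesis by (rule that)
qed

text \<open>
  Enlarging \<open>U\<close> strictly decreases the length of the interval from \<open>U\<close> to \<open>N\<close>.
\<close>

lemma acc_finite_length:
  assumes "T \<subseteq> J" "stable T N" "len T {\<zero>} N \<noteq> \<infinity>"
  shows "acc T N"
proof -
  have "len T V N < len T U N"
    if "stable T U" "stable T V" "U \<subset> V" "V \<subseteq> N" for U V
  proof -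
    have zero: "{\<zero>} \<subseteq> U" using that by auto
    have "len T U N = len T U V + len T V N"
      by (rule length_add) (use that assms in auto)
    moreover have "1 \<le> len T U V" using that by (intro interval_length_psubset)
    moreover have "len T U N \<noteq> \<infinity>"
      by (rule enat_le_finite[OF interval_length_mono[OF zero order_refl] assms(3)])
    ultimately show ?thesis
      by (cases "len T U V"; cases "len T V N"; cases "len T U N") (auto simp: one_enat_def)
  qed
  then have "{(V, U). stable T U \<and> stable T V \<and> U \<subset> V \<and> V \<subseteq> N} \<subseteq> inv_image {(a, b). a < b} (\<lambda>U. len T U N)"
    by (simp add: inv_image_def subset_iff)
  then show ?thesis unfolding acc_def by (rule wf_subset[OF wf_inv_image[OF wf]])
qed

text \<open>
  The analogue of the polynomials of degree below \<open>j\<close>: the subgroup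
  \<open>N + s N + \<dots> + s\<^sup>j\<^sup>-\<^sup>1 N\<close>, which is trivial for \<open>j = 0\<close>.
\<close>

fun poly_below :: "'i \<Rightarrow> 'g set \<Rightarrow> nat \<Rightarrow> 'g set" where
  "poly_below s N 0 = {\<zero>}"
| "poly_below s N (Suc j) = poly_below s N j <+>\<^bsub>G\<^esub> (act s ^^ j) ` N"

text \<open>
  The leading coefficients of the elements of degree at most \<open>j\<close> in \<open>U\<close>. The representation
  \<open>l + s\<^sup>j n\<close> of an element need not be unique, so an element may have several leading coefficients.
\<close>

definition leading :: "'i \<Rightarrow> 'g set \<Rightarrow> nat \<Rightarrow> 'g set \<Rightarrow> 'g set" where
  "leading s N j U = {n \<in> N. \<exists>l\<in>poly_below s N j. l \<oplus> (act s ^^ j) n \<in> U}"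

lemma stable_poly_below:
  assumes "T \<subseteq> J" "s \<in> J" "stable T N"
  shows "stable T (poly_below s N j)"
  by (induction j) (use assms in \<open>auto intro: stable_trivial stable_sum stable_funpow_image\<close>)

lemma poly_below_Suc_subset:
  assumes "T \<subseteq> J" "s \<in> J" "stable T N"
  shows "poly_below s N j \<subseteq> poly_below s N (Suc j)"
  using sum_upper1[OF stable_poly_below[OF assms] stable_funpow_image[OF assms]] by simp

lemma poly_below_mono:
  assumes "T \<subseteq> J" "s \<in> J" "stable T N" "i \<le> j"
  shows "poly_below s N i \<subseteq> poly_below s N j"
  by (rule lift_Suc_mono_le[of "poly_below s N", OF poly_below_Suc_subset[OF assms(1-3)] assms(4)])

lemma act_poly_below:
  assumes "T \<subseteq> J" "s \<in> J" "stable T N" "l \<in> poly_below s N j"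
  shows "act s l \<in> poly_below s N (Suc j)"
  using assms(4)
proof (induction j arbitrary: l)
  case 0
  then have "act s l = \<zero>" using assms(2) by simp
  then show ?case using stable_zero[OF stable_poly_below[OF assms(1-3), of "Suc 0"]] by simp
next
  case (Suc j)
  then obtain l' n where l': "l' \<in> poly_below s N j" "n \<in> N" "l = l' \<oplus> (act s ^^ j) n"
    by (auto elim!: mem_sumE)
  have c: "l' \<in> carrier G" "n \<in> carrier G"
    using l' stable_carrier_mem[OF stable_poly_below[OF assms(1-3)]] stable_carrier_mem[OF assms(3)] by auto
  have "act s l = act s l' \<oplus> (act s ^^ Suc j) n"
    using l'(3) c assms(2) by (simp add: act_add)
  then show ?case using Suc.IH[OF l'(1)] l'(2)
    by (metis imageI mem_sumI poly_below.simps(2))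
qed

lemma stable_Union_poly_below:
  assumes "T \<subseteq> J" "s \<in> J" "stable T N"
  shows "stable (insert s T) (\<Union>j. poly_below s N j)"
proof (rule stableI)
  note F = stable_poly_below[OF assms]
  show "(\<Union>j. poly_below s N j) \<subseteq> carrier G" using stable_subset[OF F] by blast
  show "\<zero> \<in> (\<Union>j. poly_below s N j)" using stable_zero[OF F] by blast
  show "\<ominus> u \<in> (\<Union>j. poly_below s N j)" if "u \<in> (\<Union>j. poly_below s N j)" for u
    using that stable_inv[OF F] by blast
  show "u \<oplus> v \<in> (\<Union>j. poly_below s N j)"
    if "u \<in> (\<Union>j. poly_below s N j)" "v \<in> (\<Union>j. poly_below s N j)" for u v
  proof -
    from that obtain i j where ij: "u \<in> poly_below s N i" "v \<in> poly_below s N j" by blast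
    have "poly_below s N i \<subseteq> poly_below s N (max i j)" "poly_below s N j \<subseteq> poly_below s N (max i j)"
      by (rule poly_below_mono[OF assms]; simp)+
    with ij have "u \<oplus> v \<in> poly_below s N (max i j)" using stable_add[OF F] by blast
    then show ?thesis by blast
  qed
  show "act t u \<in> (\<Union>j. poly_below s N j)"
    if "t \<in> insert s T" "u \<in> (\<Union>j. poly_below s N j)" for t u
  proof -
    from that(2) obtain j where u: "u \<in> poly_below s N j" by blast
    show ?thesis
    proof (cases "t = s")
      case True
      with act_poly_below[OF assms u] show ?thesis by blast
    next
      case False
      with that(1) have "act t u \<in> poly_below s N j" using stable_act[OF F _ u] by blast
      then show ?thesis by blast
    qed
  qed
qed

lemma stable_leading:
  assumes "T \<subseteq> J" "s \<in> J" "stable T N" "stable T U"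
  shows "stable T (leading s N j U)"
proof -
  note F = stable_poly_below[OF assms(1-3)]
  note c = stable_carrier_mem[OF assms(3)] stable_carrier_mem[OF F]
  show ?thesis
  proof (rule stableI)
    show "leading s N j U \<subseteq> carrier G" using c by (auto simp: leading_def)
    show "\<zero> \<in> leading s N j U"
      using assms stable_zero[OF F, of j] by (auto simp: leading_def act_funpow_zero intro!: bexI[of _ \<zero>])
    fix u assume "u \<in> leading s N j U"
    then obtain l where u: "u \<in> N" "l \<in> poly_below s N j" "l \<oplus> (act s ^^ j) u \<in> U"
      by (auto simp: leading_def)
    note cu = c(1)[OF u(1)] c(2)[OF u(2)]
    have "\<ominus> l \<oplus> (act s ^^ j) (\<ominus> u) = \<ominus> (l \<oplus> (act s ^^ j) u)"
      using cu assms(2) by (simp add: act_funpow_inv minus_add)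
    then have "\<ominus> l \<oplus> (act s ^^ j) (\<ominus> u) \<in> U" using stable_inv[OF assms(4) u(3)] by simp
    then show "\<ominus> u \<in> leading s N j U"
      using u stable_inv[OF F] stable_inv[OF assms(3)] by (auto simp: leading_def)
    show "act t u \<in> leading s N j U" if "t \<in> T" for t
    proof -
      have tJ: "t \<in> J" using that assms by blast
      have "act t l \<oplus> (act s ^^ j) (act t u) = act t (l \<oplus> (act s ^^ j) u)"
        using cu assms(2) tJ by (simp add: act_add act_funpow_commute)
      then have "act t l \<oplus> (act s ^^ j) (act t u) \<in> U" using stable_act[OF assms(4) that u(3)] by simp
      then show ?thesis
        using u stable_act[OF F that] stable_act[OF assms(3) that] by (auto simp: leading_def)
    qed
    fix v assume "v \<in> leading s N j U"
    then obtain m where v: "v \<in> N" "m \<in> poly_below s N j" "m \<oplus> (act s ^^ j) v \<in> U"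
      by (auto simp: leading_def)
    note cv = c(1)[OF v(1)] c(2)[OF v(2)]
    have "(l \<oplus> m) \<oplus> (act s ^^ j) (u \<oplus> v) = (l \<oplus> (act s ^^ j) u) \<oplus> (m \<oplus> (act s ^^ j) v)"
      using cu cv assms(2) by (simp add: act_funpow_add a_ac)
    then have "(l \<oplus> m) \<oplus> (act s ^^ j) (u \<oplus> v) \<in> U" using stable_add[OF assms(4) u(3) v(3)] by simp
    then show "u \<oplus> v \<in> leading s N j U"
      using u v stable_add[OF F] stable_add[OF assms(3)] by (auto simp: leading_def)
  qed
qed

lemma leading_mono: "U \<subseteq> V \<Longrightarrow> leading s N j U \<subseteq> leading s N j V"
  by (auto simp: leading_def)

lemma leading_Suc:
  assumes "T \<subseteq> J" "s \<in> J" "stable T N" "stable (insert s T) U"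
  shows "leading s N j U \<subseteq> leading s N (Suc j) U"
proof
  fix n assume "n \<in> leading s N j U"
  then obtain l where n: "n \<in> N" "l \<in> poly_below s N j" "l \<oplus> (act s ^^ j) n \<in> U"
    by (auto simp: leading_def)
  have "act s (l \<oplus> (act s ^^ j) n) = act s l \<oplus> (act s ^^ Suc j) n"
    using n assms(2) stable_carrier_mem[OF assms(3)] stable_carrier_mem[OF stable_poly_below[OF assms(1-3)]]
    by (simp add: act_add)
  with stable_act[OF assms(4) _ n(3), of s] have "act s l \<oplus> (act s ^^ Suc j) n \<in> U" by simp
  then show "n \<in> leading s N (Suc j) U"
    using n(1) act_poly_below[OF assms(1-3) n(2)] unfolding leading_def by blast
qed

text \<open>
  Two elements with a common leading coefficient in degree \<open>j\<close> differ by one of lower degree, so by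
  induction on the degree every element of \<open>V\<close> lies in \<open>U\<close>.
\<close>

lemma leading_determines:
  assumes "T \<subseteq> J" "s \<in> J" "stable T N" "stable T U" "stable T V" "U \<subseteq> V"
    and "V \<subseteq> (\<Union>j. poly_below s N j)" and eq: "\<And>j. leading s N j V \<subseteq> leading s N j U"
  shows "U = V"
proof -
  note F = stable_poly_below[OF assms(1-3)]
  note c = stable_carrier_mem[OF assms(3)] stable_carrier_mem[OF F]
  have "V \<inter> poly_below s N j \<subseteq> U" for j
  proof (induction j)
    case 0
    then show ?case using assms(4) by auto
  next
    case (Suc j)
    show ?case
    proof
      fix v assume v: "v \<in> V \<inter> poly_below s N (Suc j)"
      then obtain l n where ln: "l \<in> poly_below s N j" "n \<in> N" "v = l \<oplus> (act s ^^ j) n"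
        by (auto elim!: mem_sumE)
      with v have "n \<in> leading s N j V" by (auto simp: leading_def)
      with eq obtain l' where l': "l' \<in> poly_below s N j" "l' \<oplus> (act s ^^ j) n \<in> U"
        by (auto simp: leading_def)
      let ?u = "l' \<oplus> (act s ^^ j) n"
      have cc: "l \<in> carrier G" "l' \<in> carrier G" "(act s ^^ j) n \<in> carrier G"
        using c ln l' assms(2) by auto
      have v_eq: "v = (l \<ominus> l') \<oplus> ?u"
        using minus_add_cancel[OF cc(1,2)] cc ln(3) by (simp flip: a_assoc)
      have "l \<ominus> l' \<in> V"
      proof -
        have "?u \<in> V" using l'(2) assms(6) by blast
        moreover have "?u \<oplus> (l \<ominus> l') \<in> V" using v v_eq cc by (simp add: a_comm)
        ultimately show ?thesis using stable_add_cancel_left[OF assms(5)] cc by blast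
      qed
      moreover have "l \<ominus> l' \<in> poly_below s N j" using stable_minus[OF F ln(1) l'(1)] .
      ultimately show "v \<in> U" using Suc.IH l'(2) stable_add[OF assms(4)] v_eq by blast
    qed
  qed
  with assms(6,7) show ?thesis by blast
qed

text \<open>
  Hilbert's argument. For an ascending chain \<open>C\<close>, the leading coefficient groups \<open>leading s N j (C k)\<close> grow in
  both \<open>j\<close> and \<open>k\<close>. The diagonal stabilises at some \<open>K\<close>, which settles all \<open>j \<ge> K\<close> at once; each of the
  finitely many rows \<open>j < K\<close> stabilises separately. From then on the chain is constant.
\<close>

lemma basis_theorem:
  assumes "T \<subseteq> J" "s \<in> J" "stable T N" "acc T N"
  shows "acc (insert s T) (\<Union>j. poly_below s N j)"
  unfolding acc_def wf_iff_no_infinite_down_chain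
proof
  assume "\<exists>C. \<forall>i. (C (Suc i), C i) \<in> {(V, U). stable (insert s T) U \<and> stable (insert s T) V \<and> U \<subset> V \<and>
    V \<subseteq> (\<Union>j. poly_below s N j)}"
  then obtain C where "\<forall>i. (C (Suc i), C i) \<in> {(V, U). stable (insert s T) U \<and>
    stable (insert s T) V \<and> U \<subset> V \<and> V \<subseteq> (\<Union>j. poly_below s N j)}" ..
  then have C: "\<And>i. stable (insert s T) (C i)" "\<And>i. C i \<subset> C (Suc i)"
    "\<And>i. C (Suc i) \<subseteq> (\<Union>j. poly_below s N j)" by simp_all
  have CT: "stable T (C i)" for i using stable_antimono[OF C(1)] by blast
  have lead: "stable T (leading s N j (C k)) \<and> leading s N j (C k) \<subseteq> N" for j k
    using stable_leading[OF assms(1-3) CT] by (auto simp: leading_def)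
  have mono_k: "leading s N j (C k) \<subseteq> leading s N j (C (Suc k))" for j k
    using leading_mono C(2) by blast
  have mono_j: "leading s N j (C k) \<subseteq> leading s N (Suc j) (C k)" for j k
    using leading_Suc[OF assms(1-3) C(1)] .
  have mono: "leading s N j (C k) \<subseteq> leading s N j' (C k')" if "j \<le> j'" "k \<le> k'" for j j' k k'
  proof -
    have "leading s N j (C k) \<subseteq> leading s N j' (C k)"
      using lift_Suc_mono_le[of "\<lambda>j. leading s N j (C k)"] mono_j that by blast
    also have "\<dots> \<subseteq> leading s N j' (C k')"
      using lift_Suc_mono_le[of "\<lambda>k. leading s N j' (C k)"] mono_k that by blast
    finally show ?thesis .
  qed
  have mono_diag: "leading s N k (C k) \<subseteq> leading s N (Suc k) (C (Suc k))" for k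
    by (rule mono) auto
  obtain K where K: "\<And>k. k \<ge> K \<Longrightarrow> leading s N k (C k) = leading s N K (C K)"
    using acc_stabilises[OF assms(4), of "\<lambda>k. leading s N k (C k)", OF lead mono_diag] by metis
  have "\<exists>L. \<forall>k\<ge>L. leading s N j (C k) = leading s N j (C L)" for j
    using acc_stabilises[OF assms(4), of "\<lambda>k. leading s N j (C k)", OF lead mono_k] by metis
  then obtain L where L: "\<And>j k. k \<ge> L j \<Longrightarrow> leading s N j (C k) = leading s N j (C (L j))" by metis
  \<comment> \<open>From index \<open>m\<close> on, the diagonal and all rows below \<open>K\<close> are constant.\<close>
  define m where "m = Max (insert K (L ` {..<K}))"
  have m: "K \<le> m" "\<And>j. j < K \<Longrightarrow> L j \<le> m" by (auto simp: m_def)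
  have "leading s N j (C (Suc m)) \<subseteq> leading s N j (C m)" for j
  proof (cases "j < K")
    case True
    then show ?thesis using L[of j m] L[of j "Suc m"] m by (metis le_SucI order_refl)
  next
    case False
    have "leading s N j (C (Suc m)) \<subseteq> leading s N (j + Suc m) (C (j + Suc m))" by (rule mono) auto
    also have "\<dots> = leading s N K (C K)" by (rule K) (use m(1) in simp)
    also have "\<dots> \<subseteq> leading s N j (C m)" by (rule mono) (use m(1) False in simp_all)
    finally show ?thesis .
  qed
  then have "C m = C (Suc m)"
    by (rule leading_determines[OF assms(1-3) CT CT psubset_imp_subset[OF C(2)] C(3)])
  with C(2)[of m] show False by blast
qed

lemma acc_finitely_many_operators:
  assumes "T \<subseteq> J" "finite X" "X \<subseteq> J" "stable T N" "acc T N"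
  shows "\<exists>N'. N \<subseteq> N' \<and> stable (T \<union> X) N' \<and> acc (T \<union> X) N'"
  using assms(2,3)
proof (induction X rule: finite_induct)
  case empty
  then show ?case using assms by (intro exI[of _ N]) auto
next
  case (insert s X)
  then obtain N' where N': "N \<subseteq> N'" "stable (T \<union> X) N'" "acc (T \<union> X) N'" by blast
  let ?N = "\<Union>j. poly_below s N' j"
  have sub: "T \<union> X \<subseteq> J" "s \<in> J" using insert assms by auto
  have "N' \<subseteq> poly_below s N' (Suc 0)"
    using sum_upper2[OF stable_trivial[OF sub(1)] N'(2)] by simp
  then have "N \<subseteq> ?N" using N'(1) by blast
  with stable_Union_poly_below[OF sub N'(2)] basis_theorem[OF sub N'(2,3)]
  show ?case by (intro exI[of _ ?N]) simp
qed

end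

section \<open>Commutative Artinian rings have finite length\<close>

lemma (in cring) operator_group_regular: "operator_group R (\<otimes>) (carrier R)"
  by unfold_locales (auto simp: r_distr m_lcomm)

text \<open>
  Take an ideal \<open>I\<close> that is minimal among those of infinite length. For \<open>a\<close> in the ring, \<open>a I\<close> is the
  quotient of \<open>I\<close> by the annihilator of \<open>a\<close> in \<open>I\<close>; if both were proper subideals of \<open>I\<close> they would
  have finite length, and so would \<open>I\<close>. Hence \<open>a I = I\<close> or \<open>a I = 0\<close>. In the first case the stationary chain of the ideals
  \<open>(a\<^sup>n)\<close> yields \<open>b\<close> with \<open>a\<^sup>n = a\<^sup>n\<^sup>+\<^sup>1 b\<close>, so \<open>a b\<close> acts as the identity on \<open>a\<^sup>n I = I\<close>. Thus the
  ring modulo the annihilator of \<open>I\<close> is a field, and \<open>I\<close> a vector space over it. A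
  subspace \<open>K\<close> maximal without a fixed nonzero vector
  \<open>x\<close> is a hyperplane, so \<open>I / K\<close> has length at most one, while \<open>K\<close> has finite length by minimality of
  \<open>I\<close>; a contradiction.
\<close>

lemma artinian_finite_length:
  assumes "cring R" "artinian_ring R"
  shows "interval_length (operator_group.stable R (mult R) (carrier R)) {\<zero>\<^bsub>R\<^esub>} (carrier R) \<noteq> \<infinity>"
proof
  interpret cring R by fact
  interpret operator_group R "mult R" "carrier R" by (rule operator_group_regular)
  let ?st = "stable (carrier R)"
  let ?len = "len (carrier R)"
  have ideal: "ideal I R \<longleftrightarrow> ?st I" for I
    by (auto simp: stable_def ideal_def ideal_axioms_def ring_axioms) (metis additive_subgroup.a_Hcarr m_comm)
  have "wf {(I, J). ?st I \<and> ?st J \<and> I \<subset> J}"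
    unfolding wf_iff_no_infinite_down_chain
  proof
    assume "\<exists>C. \<forall>i. (C (Suc i), C i) \<in> {(I, J). ?st I \<and> ?st J \<and> I \<subset> J}"
    then obtain C :: "nat \<Rightarrow> _" where "\<forall>i. (C (Suc i), C i) \<in> {(I, J). ?st I \<and> ?st J \<and> I \<subset> J}" ..
    then have C: "\<And>i. ?st (C i)" "\<And>i. C (Suc i) \<subset> C i" by simp_all
    then have "\<exists>N. \<forall>n\<ge>N. C n = C N"
      by (intro artinian_ring.descending_chain_condition[OF assms(2)]) (auto simp: ideal)
    then show False using C(2) by (metis le_refl le_SucI less_irrefl)
  qed
  note dcc = wfE_min[OF this]
  assume "?len {\<zero>\<^bsub>R\<^esub>} (carrier R) = \<infinity>"
  then have "carrier R \<in> {I. ?st I \<and> ?len {\<zero>\<^bsub>R\<^esub>} I = \<infinity>}" using stable_carrier by auto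
  then obtain I where "I \<in> {I. ?st I \<and> ?len {\<zero>\<^bsub>R\<^esub>} I = \<infinity>}"
    and I_min: "\<And>K. (K, I) \<in> {(I, J). ?st I \<and> ?st J \<and> I \<subset> J} \<Longrightarrow> K \<notin> {I. ?st I \<and> ?len {\<zero>\<^bsub>R\<^esub>} I = \<infinity>}"
    by (rule dcc) blast
  then have I: "?st I" "?len {\<zero>\<^bsub>R\<^esub>} I = \<infinity>" by simp_all
  have min: "?len {\<zero>\<^bsub>R\<^esub>} K \<noteq> \<infinity>" if "?st K" "K \<subset> I" for K
    using I_min[of K] that I(1) by simp
  note IR = stable_carrier_mem[OF I(1)]
  have dich: "(\<lambda>x. a \<otimes>\<^bsub>R\<^esub> x) ` I = I \<or> (\<forall>x\<in>I. a \<otimes>\<^bsub>R\<^esub> x = \<zero>\<^bsub>R\<^esub>)" if a: "a \<in> carrier R" for a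
  proof (rule ccontr)
    assume neg: "\<not> ?thesis"
    let ?K = "{x \<in> I. a \<otimes>\<^bsub>R\<^esub> x \<in> {\<zero>\<^bsub>R\<^esub>}}"
    have tr: "?st {\<zero>\<^bsub>R\<^esub>}" using stable_trivial by blast
    have K: "?st ?K"
      and im: "?st ((\<lambda>x. a \<otimes>\<^bsub>R\<^esub> x) ` I)"
      and eq: "?len ?K I = ?len {\<zero>\<^bsub>R\<^esub>} ((\<lambda>x. a \<otimes>\<^bsub>R\<^esub> x) ` I <+>\<^bsub>R\<^esub> {\<zero>\<^bsub>R\<^esub>})"
      using length_hom_image[where \<phi> = "\<lambda>x. a \<otimes>\<^bsub>R\<^esub> x" and \<tau> = id, OF operator_group_axioms
        operator_group_axioms, of "carrier R" I "{\<zero>\<^bsub>R\<^esub>}"] I(1) tr a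
      by (simp_all add: r_distr m_lcomm)
    have "(\<lambda>x. a \<otimes>\<^bsub>R\<^esub> x) ` I \<subset> I" using neg stable_act[OF I(1) a] by blast
    then have "?len {\<zero>\<^bsub>R\<^esub>} ((\<lambda>x. a \<otimes>\<^bsub>R\<^esub> x) ` I) \<noteq> \<infinity>" using min im by blast
    moreover have "(\<lambda>x. a \<otimes>\<^bsub>R\<^esub> x) ` I <+>\<^bsub>R\<^esub> {\<zero>\<^bsub>R\<^esub>} \<subseteq> (\<lambda>x. a \<otimes>\<^bsub>R\<^esub> x) ` I"
      by (rule sum_least[OF im]) (use stable_zero[OF im] in auto)
    ultimately have fin1: "?len ?K I \<noteq> \<infinity>"
      unfolding eq by (rule enat_le_finite[OF interval_length_mono[OF order_refl], rotated])
    have "?K \<subset> I" using neg by auto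
    with K have fin2: "?len {\<zero>\<^bsub>R\<^esub>} ?K \<noteq> \<infinity>" by (rule min)
    have "?len {\<zero>\<^bsub>R\<^esub>} I = ?len {\<zero>\<^bsub>R\<^esub>} ?K + ?len ?K I"
      by (rule length_add) (use tr K I(1) stable_zero[OF K] in auto)
    with I(2) enat_add_finite[OF fin2 fin1] show False by simp
  qed
  have inverse: "\<exists>b\<in>carrier R. \<forall>x\<in>I. b \<otimes>\<^bsub>R\<^esub> (a \<otimes>\<^bsub>R\<^esub> x) = x"
    if a: "a \<in> carrier R" and surj: "(\<lambda>x. a \<otimes>\<^bsub>R\<^esub> x) ` I = I" for a
  proof -
    have "?st ((\<lambda>x. (a [^]\<^bsub>R\<^esub> (n::nat)) \<otimes>\<^bsub>R\<^esub> x) ` carrier R)" for n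
      using length_hom_image(3)[where \<phi> = "\<lambda>x. (a [^]\<^bsub>R\<^esub> n) \<otimes>\<^bsub>R\<^esub> x" and \<tau> = id, OF operator_group_axioms
        operator_group_axioms, of "carrier R" "carrier R" "{\<zero>\<^bsub>R\<^esub>}"] stable_carrier stable_trivial a
      by (simp add: r_distr m_lcomm)
    then have id: "ideal ((\<lambda>x. (a [^]\<^bsub>R\<^esub> (n::nat)) \<otimes>\<^bsub>R\<^esub> x) ` carrier R) R" for n using ideal by blast
    have "(\<lambda>x. (a [^]\<^bsub>R\<^esub> Suc n) \<otimes>\<^bsub>R\<^esub> x) ` carrier R \<subseteq> (\<lambda>x. (a [^]\<^bsub>R\<^esub> n) \<otimes>\<^bsub>R\<^esub> x) ` carrier R" for n
      using a by (auto simp: m_assoc)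
    with id have "\<exists>n. \<forall>k\<ge>n. (\<lambda>x. (a [^]\<^bsub>R\<^esub> (k::nat)) \<otimes>\<^bsub>R\<^esub> x) ` carrier R
        = (\<lambda>x. (a [^]\<^bsub>R\<^esub> n) \<otimes>\<^bsub>R\<^esub> x) ` carrier R"
      by (intro artinian_ring.descending_chain_condition[OF assms(2)]) blast
    then obtain n :: nat where n: "(\<lambda>x. (a [^]\<^bsub>R\<^esub> Suc n) \<otimes>\<^bsub>R\<^esub> x) ` carrier R
        = (\<lambda>x. (a [^]\<^bsub>R\<^esub> n) \<otimes>\<^bsub>R\<^esub> x) ` carrier R" by (metis le_SucI le_refl)
    have "(a [^]\<^bsub>R\<^esub> n) \<otimes>\<^bsub>R\<^esub> \<one>\<^bsub>R\<^esub> \<in> (\<lambda>x. (a [^]\<^bsub>R\<^esub> Suc n) \<otimes>\<^bsub>R\<^esub> x) ` carrier R" unfolding n by blast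
    then obtain b where b: "b \<in> carrier R" "a [^]\<^bsub>R\<^esub> n = a [^]\<^bsub>R\<^esub> Suc n \<otimes>\<^bsub>R\<^esub> b" using a by auto
    have surj_n: "(\<lambda>x. (a [^]\<^bsub>R\<^esub> k) \<otimes>\<^bsub>R\<^esub> x) ` I = I" for k :: nat
    proof (induction k)
      case 0
      then show ?case using IR by (auto simp: image_iff)
    next
      case (Suc k)
      have "(\<lambda>x. (a [^]\<^bsub>R\<^esub> Suc k) \<otimes>\<^bsub>R\<^esub> x) ` I = (\<lambda>x. (a [^]\<^bsub>R\<^esub> k) \<otimes>\<^bsub>R\<^esub> x) ` (\<lambda>x. a \<otimes>\<^bsub>R\<^esub> x) ` I"
        unfolding image_image by (rule image_cong) (use a IR in \<open>auto simp: m_assoc\<close>)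
      with Suc surj show ?case by simp
    qed
    have "b \<otimes>\<^bsub>R\<^esub> (a \<otimes>\<^bsub>R\<^esub> x) = x" if x: "x \<in> I" for x
    proof -
      from x surj_n[of n] obtain y where y: "y \<in> I" "x = a [^]\<^bsub>R\<^esub> n \<otimes>\<^bsub>R\<^esub> y" by blast
      have yR: "y \<in> carrier R" using y IR by blast
      have "b \<otimes>\<^bsub>R\<^esub> (a \<otimes>\<^bsub>R\<^esub> x) = (a [^]\<^bsub>R\<^esub> Suc n \<otimes>\<^bsub>R\<^esub> b) \<otimes>\<^bsub>R\<^esub> y"
        using y(2) yR a b(1) by (simp add: m_ac)
      also have "\<dots> = x" using b(2) y(2) by simp
      finally show ?thesis .
    qed
    with b(1) show ?thesis by blast
  qed
  have tr: "?st {\<zero>\<^bsub>R\<^esub>}" using stable_trivial by blast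
  obtain x where x: "x \<in> I" "x \<noteq> \<zero>\<^bsub>R\<^esub>"
  proof (rule ccontr)
    assume "\<not> thesis"
    with that have "I \<subseteq> {\<zero>\<^bsub>R\<^esub>}" by blast
    then have "I = {\<zero>\<^bsub>R\<^esub>}" using stable_zero[OF I(1)] by blast
    with I(2) show False using interval_length_refl[of ?st "{\<zero>\<^bsub>R\<^esub>}"] by simp
  qed
  have "\<exists>K\<in>{K. ?st K \<and> K \<subseteq> I \<and> x \<notin> K}. \<forall>V\<in>{K. ?st K \<and> K \<subseteq> I \<and> x \<notin> K}. K \<subseteq> V \<longrightarrow> V = K"
  proof (rule subset_Zorn_nonempty)
    show "{K. ?st K \<and> K \<subseteq> I \<and> x \<notin> K} \<noteq> {}" using tr x stable_zero[OF I(1)] by blast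
    fix \<C> assume C: "\<C> \<noteq> {}" "subset.chain {K. ?st K \<and> K \<subseteq> I \<and> x \<notin> K} \<C>"
    then have CC: "\<And>K. K \<in> \<C> \<Longrightarrow> ?st K \<and> K \<subseteq> I \<and> x \<notin> K"
      "\<And>U V. U \<in> \<C> \<Longrightarrow> V \<in> \<C> \<Longrightarrow> U \<subseteq> V \<or> V \<subseteq> U" unfolding subset_chain_def by blast+
    have "?st (\<Union>\<C>)"
    proof (rule stableI)
      fix u v assume "u \<in> \<Union>\<C>" "v \<in> \<Union>\<C>"
      then obtain U V where "U \<in> \<C>" "V \<in> \<C>" "u \<in> U" "v \<in> V" by blast
      then show "u \<oplus>\<^bsub>R\<^esub> v \<in> \<Union>\<C>" using CC stable_add by (meson UnionI subsetD)
    next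
      obtain U where "U \<in> \<C>" using C(1) by blast
      then show "\<zero>\<^bsub>R\<^esub> \<in> \<Union>\<C>" using CC(1) stable_zero by blast
    next
      show "\<Union>\<C> \<subseteq> carrier R" using CC(1) stable_subset by (meson Sup_least)
    next
      fix u assume "u \<in> \<Union>\<C>"
      then obtain U where U: "U \<in> \<C>" "u \<in> U" by blast
      then show "\<ominus>\<^bsub>R\<^esub> u \<in> \<Union>\<C>" using stable_inv[of _ U u] CC(1) by (meson UnionI)
      fix t assume "t \<in> carrier R"
      then show "t \<otimes>\<^bsub>R\<^esub> u \<in> \<Union>\<C>" using stable_act[of _ U t u] U CC(1) by (meson UnionI)
    qed
    then show "\<Union>\<C> \<in> {K. ?st K \<and> K \<subseteq> I \<and> x \<notin> K}" using CC by blast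
  qed
  then obtain K where "K \<in> {K. ?st K \<and> K \<subseteq> I \<and> x \<notin> K}"
    and "\<forall>V\<in>{K. ?st K \<and> K \<subseteq> I \<and> x \<notin> K}. K \<subseteq> V \<longrightarrow> V = K" ..
  then have K: "?st K" "K \<subseteq> I" "x \<notin> K"
    and Kmax: "\<And>V. ?st V \<Longrightarrow> V \<subseteq> I \<Longrightarrow> x \<notin> V \<Longrightarrow> K \<subseteq> V \<Longrightarrow> V = K" by simp_all
  \<comment> \<open>Any larger \<open>V\<close> contains \<open>x\<close>; for \<open>y\<close> outside \<open>K\<close>, maximality gives \<open>x = k + a y\<close> with \<open>a\<close> invertible
    on \<open>I\<close>, so \<open>y\<close> lies in \<open>V\<close>.\<close>
  have len_1: "?len K I \<le> 1"
  proof (rule interval_length_le_1)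
    fix V assume V: "?st V" "K \<subseteq> V" "V \<subseteq> I"
    have "V = I" if ne: "V \<noteq> K"
    proof -
      have "x \<in> V" using Kmax V ne by blast
      have "y \<in> V" if y: "y \<in> I" for y
      proof (cases "y \<in> K")
        case False
        have yR: "y \<in> carrier R" using y IR by blast
        let ?Y = "(\<lambda>a. a \<otimes>\<^bsub>R\<^esub> y) ` carrier R"
        have Y: "?st ?Y" "?st (K <+>\<^bsub>R\<^esub> ?Y)"
        proof -
          show "?st ?Y"
            using length_hom_image(3)[where \<phi> = "\<lambda>x. x \<otimes>\<^bsub>R\<^esub> y" and \<tau> = id, OF operator_group_axioms
              operator_group_axioms, of "carrier R" "carrier R" "{\<zero>\<^bsub>R\<^esub>}"] stable_carrier tr yR
            by (simp add: l_distr m_assoc)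
          then show "?st (K <+>\<^bsub>R\<^esub> ?Y)" using stable_sum[OF order_refl K(1)] by blast
        qed
        have "y \<in> ?Y" using yR by (auto intro!: image_eqI[of _ _ "\<one>\<^bsub>R\<^esub>"])
        then have "K <+>\<^bsub>R\<^esub> ?Y \<noteq> K" using False sum_upper2[OF K(1) Y(1)] by blast
        moreover have "?Y \<subseteq> I" using stable_act[OF I(1) _ y] by blast
        then have "K <+>\<^bsub>R\<^esub> ?Y \<subseteq> I" using sum_least[OF I(1) K(2)] by blast
        ultimately have "x \<in> K <+>\<^bsub>R\<^esub> ?Y"
          using Kmax[OF Y(2)] sum_upper1[OF K(1) Y(1)] by blast
        then obtain k z where kz: "k \<in> K" "z \<in> ?Y" "x = k \<oplus>\<^bsub>R\<^esub> z" by (rule mem_sumE)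
        then obtain a where a: "a \<in> carrier R" "z = a \<otimes>\<^bsub>R\<^esub> y" by blast
        have kR: "k \<in> carrier R" using kz K IR by blast
        have "a \<otimes>\<^bsub>R\<^esub> y \<noteq> \<zero>\<^bsub>R\<^esub>" using kz a K(3) kR by auto
        then have "(\<lambda>x. a \<otimes>\<^bsub>R\<^esub> x) ` I = I" using dich[OF a(1)] y by blast
        from inverse[OF a(1) this] obtain b where
          b: "b \<in> carrier R" "\<And>u. u \<in> I \<Longrightarrow> b \<otimes>\<^bsub>R\<^esub> (a \<otimes>\<^bsub>R\<^esub> u) = u" by blast
        have "a \<otimes>\<^bsub>R\<^esub> y \<in> V"
          using stable_add_cancel_left[OF V(1), of k "a \<otimes>\<^bsub>R\<^esub> y"] kz a V \<open>x \<in> V\<close> yR by auto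
        then show ?thesis using stable_act[OF V(1) b(1)] b(2)[OF y] by metis
      qed (use V in blast)
      with V show ?thesis by blast
    qed
    then show "V = K \<or> V = I" by blast
  qed
  have "K \<subset> I" using K x by blast
  with K(1) have len_K: "?len {\<zero>\<^bsub>R\<^esub>} K \<noteq> \<infinity>" by (rule min)
  have "?len {\<zero>\<^bsub>R\<^esub>} I = ?len {\<zero>\<^bsub>R\<^esub>} K + ?len K I"
    by (rule length_add) (use tr K I(1) stable_zero[OF K(1)] in auto)
  moreover have "?len K I \<noteq> \<infinity>" using len_1 by (rule enat_le_finite) simp
  note enat_add_finite[OF len_K this]
  ultimately show False using I(2) by simp
qed

section \<open>Numerical polynomials in several variables\<close>

definition unit_index :: "'d \<Rightarrow> 'd \<Rightarrow> nat" where
  "unit_index i = (\<lambda>j. if j = i then 1 else 0)"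

definition for_large :: "(('d \<Rightarrow> nat) \<Rightarrow> bool) \<Rightarrow> bool" where
  "for_large Q \<longleftrightarrow> (\<exists>N. \<forall>n. (\<forall>i. N \<le> n i) \<longrightarrow> Q n)"

lemma for_large_conj: "for_large P \<Longrightarrow> for_large Q \<Longrightarrow> for_large (\<lambda>n. P n \<and> Q n)"
  unfolding for_large_def
proof (elim exE)
  fix N N' assume "\<forall>n. (\<forall>i. N \<le> n i) \<longrightarrow> P n" "\<forall>n. (\<forall>i. N' \<le> n i) \<longrightarrow> Q n"
  then show "\<exists>N. \<forall>n. (\<forall>i. N \<le> n i) \<longrightarrow> P n \<and> Q n" by (intro exI[of _ "max N N'"]) auto
qed

lemma for_large_mono: "for_large P \<Longrightarrow> (\<And>n. P n \<Longrightarrow> Q n) \<Longrightarrow> for_large Q"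
  unfolding for_large_def by blast

lemma for_large_shift: "for_large P \<Longrightarrow> for_large (\<lambda>n. P (n + unit_index i))"
  unfolding for_large_def by (metis le_add1 le_trans plus_fun_apply)

lemma for_large_all:
  fixes P :: "'i::finite \<Rightarrow> ('d \<Rightarrow> nat) \<Rightarrow> bool"
  assumes "\<And>i. for_large (P i)"
  shows "for_large (\<lambda>n. \<forall>i. P i n)"
proof -
  obtain N where N: "\<And>i n. (\<forall>j. N i \<le> n j) \<Longrightarrow> P i n"
    using assms unfolding for_large_def by metis
  have "N i \<le> Max (range N)" for i by simp
  then show ?thesis unfolding for_large_def
    by (intro exI[of _ "Max (range N)"]) (meson N le_trans)
qed

lemma for_large_ex: "for_large P \<Longrightarrow> \<exists>n. P n"
  unfolding for_large_def by auto

text \<open>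
  The coefficients of the difference in direction \<open>i\<close>, by \<open>binomial_polynomial_step\<close>.
\<close>

definition shift :: "'d \<Rightarrow> (('d \<Rightarrow> nat) \<Rightarrow> int) \<Rightarrow> ('d \<Rightarrow> nat) \<Rightarrow> int" where
  "shift i c k = c (k + unit_index i)"

lemma add_unit_inj: "inj (\<lambda>k. k + unit_index i)"
  by (auto simp: inj_def fun_eq_iff)

lemma sub_unit:
  assumes "k i \<noteq> 0"
  obtains l where "k = l + unit_index i"
proof
  show "k = (k(i := k i - 1)) + unit_index i"
    using assms by (auto simp: fun_eq_iff unit_index_def)
qed

lemma finite_shift: "finite {k. c k \<noteq> 0} \<Longrightarrow> finite {k. shift i c k \<noteq> 0}"
  unfolding shift_def using finite_vimageI[OF _ add_unit_inj[of i], of "{k. c k \<noteq> 0}"]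
  by (simp add: vimage_def)

abbreviation binom_prod :: "('d::finite \<Rightarrow> nat) \<Rightarrow> ('d \<Rightarrow> nat) \<Rightarrow> int" where
  "binom_prod k n \<equiv> \<Prod>i\<in>UNIV. int ((n i + k i) choose k i)"

lemma binomial_polynomial_superset:
  assumes "finite F" "{k. c k \<noteq> 0} \<subseteq> F"
  shows "binomial_polynomial c n = (\<Sum>k\<in>F. c k * binom_prod k n)"
  unfolding binomial_polynomial_def by (rule sum.mono_neutral_left) (use assms in auto)

lemma binomial_polynomial_add:
  assumes "finite {k. c k \<noteq> 0}" "finite {k. c' k \<noteq> 0}"
  shows "binomial_polynomial (\<lambda>k. c k + c' k) n = binomial_polynomial c n + binomial_polynomial c' n"
proof -
  let ?F = "{k. c k \<noteq> 0} \<union> {k. c' k \<noteq> 0}"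
  have "binomial_polynomial d n = (\<Sum>k\<in>?F. d k * binom_prod k n)"
    if "\<And>k. d k \<noteq> 0 \<Longrightarrow> c k \<noteq> 0 \<or> c' k \<noteq> 0" for d
    using assms that by (intro binomial_polynomial_superset) auto
  from this[of c] this[of c'] this[of "\<lambda>k. c k + c' k"] show ?thesis
    by (simp add: sum.distrib distrib_right)
qed

lemma binomial_polynomial_diff:
  assumes "finite {k. c k \<noteq> 0}" "finite {k. c' k \<noteq> 0}"
  shows "binomial_polynomial (\<lambda>k. c k - c' k) n = binomial_polynomial c n - binomial_polynomial c' n"
proof -
  have "finite {k. c k - c' k \<noteq> 0}"
    by (rule finite_subset[of _ "{k. c k \<noteq> 0} \<union> {k. c' k \<noteq> 0}"]) (use assms in auto)
  from binomial_polynomial_add[OF this assms(2), of n] show ?thesis by simp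
qed

text \<open>
  Pascal's rule in the \<open>i\<close>-th factor: for \<open>a = n\<^sub>i\<close> and \<open>b = k\<^sub>i\<close> it reads
  \<open>(a+b+2 choose b+1) = (a+b+1 choose b+1) + (a+1+b choose b)\<close>.
\<close>

lemma binom_prod_step:
  "binom_prod (k + unit_index i) (n + unit_index i)
    = binom_prod (k + unit_index i) n + binom_prod k (n + unit_index i)"
proof -
  have rest: "(\<Prod>j\<in>UNIV - {i}. int ((m j + l j) choose l j)) = (\<Prod>j\<in>UNIV - {i}. int ((n j + k j) choose k j))"
    if "\<And>j. j \<noteq> i \<Longrightarrow> m j = n j \<and> l j = k j" for m l
    by (rule prod.cong) (use that in auto)
  show ?thesis
    by (simp add: prod.remove[of UNIV i] rest unit_index_def algebra_simps)
qed

lemma binom_prod_zero_index: "k i = 0 \<Longrightarrow> binom_prod k (n + unit_index i) = binom_prod k n"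
  by (rule prod.cong) (auto simp: unit_index_def)

text \<open>
  The products of binomials are adapted to backward differences: a term with \<open>k i = 0\<close> is constant in
  direction \<open>i\<close>, every other term has its index lowered by the unit vector.
\<close>

lemma binomial_polynomial_step:
  assumes fin: "finite {k. c k \<noteq> 0}"
  shows "binomial_polynomial c (n + unit_index i)
    = binomial_polynomial c n + binomial_polynomial (shift i c) (n + unit_index i)"
proof -
  let ?F = "{k. c k \<noteq> 0}"
  let ?e = "unit_index i"
  let ?S = "{k \<in> ?F. k i = 0}" and ?S' = "{k. shift i c k \<noteq> 0}"
  have F: "?F = ?S \<union> (\<lambda>k. k + ?e) ` ?S'"
  proof (rule subset_antisym; rule subsetI)
    fix k assume k: "k \<in> ?F"
    show "k \<in> ?S \<union> (\<lambda>k. k + ?e) ` ?S'"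
    proof (cases "k i = 0")
      case False
      then obtain l where "k = l + ?e" by (rule sub_unit)
      with k show ?thesis by (auto simp: shift_def)
    qed (use k in auto)
  qed (auto simp: shift_def)
  have split: "binomial_polynomial c m
      = (\<Sum>k\<in>?S. c k * binom_prod k m) + (\<Sum>k\<in>?S'. shift i c k * binom_prod (k + ?e) m)" for m
  proof -
    have "binomial_polynomial c m = (\<Sum>k\<in>?S \<union> (\<lambda>k. k + ?e) ` ?S'. c k * binom_prod k m)"
      unfolding binomial_polynomial_def by (subst F) rule
    also have "\<dots> = (\<Sum>k\<in>?S. c k * binom_prod k m) + (\<Sum>k\<in>(\<lambda>k. k + ?e) ` ?S'. c k * binom_prod k m)"
      by (rule sum.union_disjoint) (use fin finite_shift[OF fin] in \<open>auto simp: unit_index_def\<close>)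
    also have "(\<Sum>k\<in>(\<lambda>k. k + ?e) ` ?S'. c k * binom_prod k m) = (\<Sum>k\<in>?S'. shift i c k * binom_prod (k + ?e) m)"
      by (subst sum.reindex[OF inj_on_subset[OF add_unit_inj subset_UNIV]]) (simp add: shift_def)
    finally show ?thesis .
  qed
  have S: "(\<Sum>k\<in>?S. c k * binom_prod k (n + ?e)) = (\<Sum>k\<in>?S. c k * binom_prod k n)"
    by (rule sum.cong) (use binom_prod_zero_index in auto)
  show ?thesis
    unfolding split S binomial_polynomial_def[of "shift i c"]
    by (simp only: binom_prod_step distrib_left sum.distrib add.assoc)
qed

lemma binomial_polynomial_constant:
  assumes "\<And>k. k \<noteq> 0 \<Longrightarrow> c k = 0"
  shows "binomial_polynomial c n = c 0"
proof -
  have "binomial_polynomial c n = (\<Sum>k\<in>{0}. c k * binom_prod k n)"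
    by (rule binomial_polynomial_superset) (use assms in auto)
  then show ?thesis by simp
qed

definition total_degree :: "('d::finite \<Rightarrow> nat) \<Rightarrow> nat" where
  "total_degree k = (\<Sum>i\<in>UNIV. k i)"

lemma total_degree_add_unit [simp]: "total_degree (k + unit_index i) = Suc (total_degree k)"
  by (simp add: total_degree_def sum.distrib unit_index_def)

lemma total_degree_eq_1:
  assumes "total_degree k = 1"
  obtains i where "k = unit_index i"
proof -
  from assms have "k \<noteq> 0" by (auto simp: total_degree_def)
  then obtain i where "k i \<noteq> 0" by (auto simp: fun_eq_iff)
  then obtain l where l: "k = l + unit_index i" by (rule sub_unit)
  with assms have "total_degree l = 0" by simp
  then have "l = 0" by (auto simp: total_degree_def fun_eq_iff)
  with l show ?thesis using that by simp
qed

lemma nonzero_index: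
  fixes k :: "'d \<Rightarrow> nat"
  assumes "k \<noteq> 0"
  obtains i l where "k = l + unit_index i"
proof -
  from assms obtain i where "k i \<noteq> 0" by (auto simp: fun_eq_iff)
  with sub_unit that show ?thesis by metis
qed

text \<open>
  Induction on a bound of the degrees: the differences in all directions vanish, hence all coefficients
  except the constant one, and then the polynomial is its constant coefficient.
\<close>

lemma binomial_polynomial_eq_0:
  fixes c :: "('d::finite \<Rightarrow> nat) \<Rightarrow> int"
  assumes "finite {k. c k \<noteq> 0}" "for_large (\<lambda>n. binomial_polynomial c n = 0)"
  shows "c = (\<lambda>k. 0)"
proof -
  have "\<exists>D. \<forall>k. c k \<noteq> 0 \<longrightarrow> total_degree k < D"
  proof (intro exI allI impI)
    fix k assume "c k \<noteq> 0"
    then have "total_degree k \<le> Max (total_degree ` {k. c k \<noteq> 0})" using assms(1) by (intro Max_ge) auto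
    then show "total_degree k < Suc (Max (total_degree ` {k. c k \<noteq> 0}))" by simp
  qed
  then obtain D where "\<forall>k. c k \<noteq> 0 \<longrightarrow> total_degree k < D" by blast
  with assms show ?thesis
  proof (induction D arbitrary: c)
    case 0
    then show ?case by (simp add: fun_eq_iff)
  next
    case (Suc D)
    have "shift i c = (\<lambda>k. 0)" for i
    proof (rule Suc.IH)
      show "finite {k. shift i c k \<noteq> 0}" by (rule finite_shift[OF Suc.prems(1)])
      show "\<forall>k. shift i c k \<noteq> 0 \<longrightarrow> total_degree k < D"
      proof (intro allI impI)
        fix k assume "shift i c k \<noteq> 0"
        then have "total_degree (k + unit_index i) < Suc D" using Suc.prems(3)[rule_format, of "k + unit_index i"] by (simp add: shift_def)
        then show "total_degree k < D" by simp
      qed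
      have "for_large (\<lambda>n. binomial_polynomial c n = 0 \<and> binomial_polynomial c (n + unit_index i) = 0)"
        by (rule for_large_conj[OF Suc.prems(2) for_large_shift[OF Suc.prems(2)]])
      then have "for_large (\<lambda>n. binomial_polynomial (shift i c) (n + unit_index i) = 0)"
        by (rule for_large_mono) (simp add: binomial_polynomial_step[OF Suc.prems(1)])
      then obtain N where N: "\<And>n. (\<forall>j. N \<le> n j) \<Longrightarrow> binomial_polynomial (shift i c) (n + unit_index i) = 0"
        unfolding for_large_def by blast
      show "for_large (\<lambda>n. binomial_polynomial (shift i c) n = 0)"
        unfolding for_large_def
      proof (intro exI allI impI)
        fix n :: "'d \<Rightarrow> nat" assume n: "\<forall>j. Suc N \<le> n j"
        then have "n i \<noteq> 0" by (metis Suc_le_D nat.distinct(1))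
        then obtain m where m: "n = m + unit_index i" by (rule sub_unit)
        have "N \<le> m j" for j using n[rule_format, of j] m by (auto simp: unit_index_def split: if_splits)
        with N m show "binomial_polynomial (shift i c) n = 0" by blast
      qed
    qed
    then have "c k = 0" if "k \<noteq> 0" for k
    proof -
      from that obtain i l where "k = l + unit_index i" by (rule nonzero_index)
      then have "c k = shift i c l" by (simp add: shift_def)
      then show ?thesis by (simp add: \<open>\<And>i. shift i c = (\<lambda>k. 0)\<close>)
    qed
    note nz = this
    obtain n where "binomial_polynomial c n = 0" using for_large_ex[OF Suc.prems(2)] by blast
    with binomial_polynomial_constant[of c n, OF nz] have "c 0 = 0" by simp
    show ?case
    proof
      fix k show "c k = 0" using nz[of k] \<open>c 0 = 0\<close> by (cases "k = 0") auto
    qed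
  qed
qed

lemma binomial_polynomial_unique:
  assumes "finite {k. c k \<noteq> 0}" "finite {k. c' k \<noteq> 0}"
    "for_large (\<lambda>n. binomial_polynomial c n = binomial_polynomial c' n)"
  shows "c = c'"
proof -
  have "finite {k. c k - c' k \<noteq> 0}"
    by (rule finite_subset[of _ "{k. c k \<noteq> 0} \<union> {k. c' k \<noteq> 0}"]) (use assms in auto)
  then have "(\<lambda>k. c k - c' k) = (\<lambda>k. 0)"
    by (rule binomial_polynomial_eq_0)
      (use assms(3) in \<open>auto elim!: for_large_mono simp: binomial_polynomial_diff[OF assms(1,2)]\<close>)
  then show ?thesis by (simp add: fun_eq_iff)
qed

section \<open>Recovering a function from its differences\<close>

lemma constant_of_differences_zero:
  fixes F :: "('d::finite \<Rightarrow> nat) \<Rightarrow> int"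
  assumes "\<And>i. for_large (\<lambda>n. F (n + unit_index i) = F n)"
  shows "\<exists>v. for_large (\<lambda>n. F n = v)"
proof -
  from for_large_all[of "\<lambda>i n. F (n + unit_index i) = F n", OF assms] obtain N where
    N: "\<And>n i. (\<forall>j. N \<le> n j) \<Longrightarrow> F (n + unit_index i) = F n" unfolding for_large_def by blast
  have "F ((\<lambda>_. N) + k) = F (\<lambda>_. N)" for k
  proof (induction "total_degree k" arbitrary: k)
    case 0
    then have "k = 0" by (auto simp: total_degree_def fun_eq_iff)
    then show ?case by simp
  next
    case (Suc t)
    then have "k \<noteq> 0" by (auto simp: total_degree_def)
    then obtain i l where l: "k = l + unit_index i" by (rule nonzero_index)
    with Suc have "F ((\<lambda>_. N) + l) = F (\<lambda>_. N)" by simp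
    with l N[of "(\<lambda>_. N) + l" i] show ?case by (simp add: add.assoc)
  qed
  note const = this
  have "for_large (\<lambda>n. F n = F (\<lambda>_. N))"
    unfolding for_large_def
  proof (intro exI allI impI)
    fix n :: "'d \<Rightarrow> nat" assume "\<forall>i. N \<le> n i"
    then have "n = (\<lambda>_. N) + (\<lambda>i. n i - N)" by (auto simp: fun_eq_iff)
    with const show "F n = F (\<lambda>_. N)" by metis
  qed
  then show ?thesis ..
qed

lemma add_unit_eq_add_unit:
  assumes "k + unit_index i = l + unit_index j" "i \<noteq> j"
  obtains m where "k = m + unit_index j" "l = m + unit_index i"
proof -
  have "k j = l j + 1" using fun_cong[OF assms(1), of j] assms(2) by (simp add: unit_index_def)
  then obtain m where m: "k = m + unit_index j" using sub_unit[of k j] by auto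
  with assms(1) have "l + unit_index j = (m + unit_index i) + unit_index j" by (simp add: add_ac)
  then have "l = m + unit_index i" by simp
  with m show ?thesis by (rule that)
qed

text \<open>
  The coefficient at a nonzero index \<open>l + unit_index i\<close> is prescribed to be \<open>b i l\<close>. Different choices of \<open>i\<close>
  agree because mixed differences of \<open>F\<close> commute. The polynomial so obtained differs from \<open>F\<close> by a
  function that is eventually constant, which determines the coefficient at \<open>0\<close>.
\<close>

lemma polynomial_of_polynomial_differences:
  fixes F :: "('d::finite \<Rightarrow> nat) \<Rightarrow> int"
  assumes fin: "\<And>i. finite {k. b i k \<noteq> 0}"
    and diff: "\<And>i. for_large (\<lambda>n. F (n + unit_index i) = F n + binomial_polynomial (b i) (n + unit_index i))"
  shows "\<exists>c. finite {k. c k \<noteq> 0} \<and> (\<forall>i. shift i c = b i) \<and> for_large (\<lambda>n. F n = binomial_polynomial c n)"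
proof -
  have compat: "shift j (b i) = shift i (b j)" for i j
  proof (rule binomial_polynomial_unique)
    show "finite {k. shift j (b i) k \<noteq> 0}" "finite {k. shift i (b j) k \<noteq> 0}"
      by (rule finite_shift[OF fin])+
    have "for_large (\<lambda>n. binomial_polynomial (shift j (b i)) (n + unit_index i + unit_index j)
        = binomial_polynomial (shift i (b j)) (n + unit_index i + unit_index j))" (is "for_large ?Q")
    proof (rule for_large_mono[OF for_large_conj[OF for_large_conj[OF diff[of i] diff[of j]]
            for_large_conj[OF for_large_shift[OF diff[of i], of j] for_large_shift[OF diff[of j], of i]]]])
      fix n
      let ?ei = "unit_index i" and ?ej = "unit_index j"
      assume *: "(F (n + ?ei) = F n + binomial_polynomial (b i) (n + ?ei) \<and>
          F (n + ?ej) = F n + binomial_polynomial (b j) (n + ?ej)) \<and>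
          F (n + ?ej + ?ei) = F (n + ?ej) + binomial_polynomial (b i) (n + ?ej + ?ei) \<and>
          F (n + ?ei + ?ej) = F (n + ?ei) + binomial_polynomial (b j) (n + ?ei + ?ej)"
      have sw: "n + ?ej + ?ei = n + ?ei + ?ej" by (simp add: add_ac)
      show "?Q n"
        using * binomial_polynomial_step[OF fin[of i], of "n + ?ei" j]
          binomial_polynomial_step[OF fin[of j], of "n + ?ej" i] unfolding sw by linarith
    qed
    then obtain N where N: "\<And>n. (\<forall>j. N \<le> n j) \<Longrightarrow> ?Q n" unfolding for_large_def by blast
    show "for_large (\<lambda>n. binomial_polynomial (shift j (b i)) n = binomial_polynomial (shift i (b j)) n)"
      unfolding for_large_def
    proof (intro exI allI impI)
      fix n :: "'d \<Rightarrow> nat" assume n: "\<forall>l. N + 2 \<le> n l"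
      \<comment> \<open>The bound \<open>N + 2\<close> leaves room for two steps back, possibly in the same direction.\<close>
      let ?m = "\<lambda>l. n l - (unit_index i + unit_index j) l"
      have le: "(unit_index i + unit_index j) l \<le> 2" for l by (simp add: unit_index_def)
      have "N \<le> ?m l" for l using n[rule_format, of l] le[of l] by linarith
      moreover have "?m + unit_index i + unit_index j = n"
      proof
        fix l show "(?m + unit_index i + unit_index j) l = n l"
          using n[rule_format, of l] le[of l] by simp
      qed
      ultimately show "binomial_polynomial (shift j (b i)) n = binomial_polynomial (shift i (b j)) n"
        using N[of ?m] by simp
    qed
  qed
  define c0 where "c0 k = (if k = 0 then 0 else (let (i, l) = (SOME (i, l). k = l + unit_index i) in b i l))"
    for k :: "'d \<Rightarrow> nat"
  have c0: "c0 (l + unit_index i) = b i l" for l i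
  proof -
    let ?k = "l + unit_index i"
    have "?k i \<noteq> 0" by (simp add: unit_index_def)
    then have nz: "?k \<noteq> 0" by (metis zero_fun_apply)
    obtain j m where jm: "(SOME (i, l). ?k = l + unit_index i) = (j, m)" by (rule prod.exhaust)
    have "case (SOME (i, l). ?k = l + unit_index i) of (i, l) \<Rightarrow> ?k = l + unit_index i"
      by (rule someI[of _ "(i, l)"]) simp
    with jm have eq: "l + unit_index i = m + unit_index j" by simp
    have "b j m = b i l"
    proof (cases "i = j")
      case True
      with eq show ?thesis by simp
    next
      case False
      with eq obtain q where "l = q + unit_index j" "m = q + unit_index i" by (rule add_unit_eq_add_unit)
      with fun_cong[OF compat[of j i], of q] show ?thesis by (simp add: shift_def)
    qed
    moreover have "c0 ?k = b j m"
      unfolding c0_def jm if_not_P[OF nz] by (simp only: Let_def prod.case)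
    ultimately show ?thesis by simp
  qed
  have fin0: "finite {k. c0 k \<noteq> 0}"
  proof (rule finite_subset)
    show "{k. c0 k \<noteq> 0} \<subseteq> (\<Union>i. (\<lambda>l. l + unit_index i) ` {l. b i l \<noteq> 0})"
    proof
      fix k assume k: "k \<in> {k. c0 k \<noteq> 0}"
      then have "k \<noteq> 0" by (auto simp: c0_def)
      then obtain i l where "k = l + unit_index i" by (rule nonzero_index)
      with k c0 show "k \<in> (\<Union>i. (\<lambda>l. l + unit_index i) ` {l. b i l \<noteq> 0})" by auto
    qed
    show "finite (\<Union>i. (\<lambda>l. l + unit_index i) ` {l. b i l \<noteq> 0})" using fin by auto
  qed
  have shift0: "shift i c0 = b i" for i by (simp add: shift_def c0 fun_eq_iff)
  have "\<exists>v. for_large (\<lambda>n. F n - binomial_polynomial c0 n = v)"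
  proof (rule constant_of_differences_zero)
    fix i
    show "for_large (\<lambda>n. F (n + unit_index i) - binomial_polynomial c0 (n + unit_index i)
        = F n - binomial_polynomial c0 n)"
      by (rule for_large_mono[OF diff[of i]]) (simp add: binomial_polynomial_step[OF fin0] shift0)
  qed
  then obtain v where v: "for_large (\<lambda>n. F n - binomial_polynomial c0 n = v)" by blast
  \<comment> \<open>The missing constant coefficient; \<open>c0\<close> vanishes at \<open>0\<close>.\<close>
  define c1 where "c1 k = (if k = 0 then v else 0)" for k :: "'d \<Rightarrow> nat"
  have fin1: "finite {k. c1 k \<noteq> 0}" by (rule finite_subset[of _ "{0}"]) (auto simp: c1_def)
  have c1: "binomial_polynomial c1 n = v" for n
    using binomial_polynomial_constant[of c1] by (simp add: c1_def)
  have "shift i (\<lambda>k. c0 k + c1 k) = b i" for i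
  proof
    fix l
    have "(l + unit_index i) i \<noteq> 0" by (simp add: unit_index_def)
    then have "l + unit_index i \<noteq> 0" by (metis zero_fun_apply)
    then have "c1 (l + unit_index i) = 0" unfolding c1_def by (rule if_not_P)
    then show "shift i (\<lambda>k. c0 k + c1 k) l = b i l" by (simp add: shift_def c0)
  qed
  moreover have "finite {k. c0 k + c1 k \<noteq> 0}"
    by (rule finite_subset[of _ "{k. c0 k \<noteq> 0} \<union> {k. c1 k \<noteq> 0}"]) (use fin0 fin1 in auto)
  moreover have "for_large (\<lambda>n. F n = binomial_polynomial (\<lambda>k. c0 k + c1 k) n)"
    by (rule for_large_mono[OF v]) (simp add: binomial_polynomial_add[OF fin0 fin1] c1)
  ultimately show ?thesis by (intro exI[of _ "\<lambda>k. c0 k + c1 k"]) simp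
qed

section \<open>Nonnegativity of the coefficients of maximal degree\<close>

text \<open>
  Every mixed multiplicity that is defined is nonnegative.
\<close>

definition nonneg_top :: "(('d::finite \<Rightarrow> nat) \<Rightarrow> int) \<Rightarrow> bool" where
  "nonneg_top c \<longleftrightarrow> (\<forall>k. (\<forall>h>k. c h = 0) \<longrightarrow> 0 \<le> c k)"

text \<open>
  At a maximal index above \<open>k\<close> where one of the two families is nonzero, both values are nonnegative and
  their sum is zero.
\<close>

lemma nonneg_top_summands_vanish:
  assumes fin: "finite {k. c k \<noteq> 0}" "finite {k. c' k \<noteq> 0}"
    and top: "nonneg_top c" "nonneg_top c'"
    and zero: "\<forall>h>k. c h + c' h = 0"
  shows "\<forall>h>k. c h = 0 \<and> c' h = 0"
proof (rule ccontr)
  let ?B = "{h. h > k \<and> (c h \<noteq> 0 \<or> c' h \<noteq> 0)}"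
  assume "\<not> (\<forall>h>k. c h = 0 \<and> c' h = 0)"
  then have "?B \<noteq> {}" by blast
  have "finite ?B"
    by (rule finite_subset[of _ "{k. c k \<noteq> 0} \<union> {k. c' k \<noteq> 0}"]) (use fin in auto)
  from finite_has_maximal[OF this \<open>?B \<noteq> {}\<close>]
  obtain m where "m \<in> ?B" "\<forall>h\<in>?B. m \<le> h \<longrightarrow> m = h" by (rule bexE)
  then have m: "m > k" "c m \<noteq> 0 \<or> c' m \<noteq> 0"
    and m_max: "\<And>h. h > k \<Longrightarrow> c h \<noteq> 0 \<or> c' h \<noteq> 0 \<Longrightarrow> m \<le> h \<Longrightarrow> m = h" by simp_all
  have above: "c h = 0 \<and> c' h = 0" if "h > m" for h
  proof (rule ccontr)
    assume "\<not> (c h = 0 \<and> c' h = 0)"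
    moreover have "h > k" using m(1) that by (rule less_trans)
    ultimately show False using m_max[of h] that less_imp_le[OF that] by auto
  qed
  then have "0 \<le> c m" "0 \<le> c' m" using top by (auto simp: nonneg_top_def)
  moreover have "c m + c' m = 0" using zero m(1) by blast
  ultimately show False using m(2) by auto
qed

lemma nonneg_top_add:
  assumes "finite {k. c k \<noteq> 0}" "finite {k. c' k \<noteq> 0}" "nonneg_top c" "nonneg_top c'"
  shows "nonneg_top (\<lambda>k. c k + c' k)"
  unfolding nonneg_top_def
proof (intro allI impI)
  fix k assume "\<forall>h>k. c h + c' h = 0"
  from nonneg_top_summands_vanish[OF assms this] assms(3,4) show "0 \<le> c k + c' k"
    by (simp add: nonneg_top_def)
qed

lemma add_unit_strict_mono: "k < (l :: 'd \<Rightarrow> nat) \<Longrightarrow> k + unit_index i < l + unit_index i"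
  by (simp add: less_le_not_le le_fun_def)

text \<open>
  At an index \<open>k \<noteq> 0\<close> the coefficient is one of a difference in a direction \<open>i\<close> with \<open>k i > 0\<close>. At \<open>k = 0\<close>
  all other coefficients vanish, so the coefficient is the value of the polynomial at large arguments.
\<close>

lemma nonneg_top_of_differences:
  assumes "\<And>i. nonneg_top (shift i c)" "for_large (\<lambda>n. 0 \<le> binomial_polynomial c n)"
  shows "nonneg_top c"
  unfolding nonneg_top_def
proof (intro allI impI)
  fix k assume above: "\<forall>h>k. c h = 0"
  show "0 \<le> c k"
  proof (cases "k = 0")
    case True
    have "c h = 0" if "h \<noteq> 0" for h
    proof -
      have "0 \<le> h" by (simp add: le_fun_def)
      then have "h > 0" using that[symmetric] by (rule order_le_neq_trans)
      with above True show ?thesis by blast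
    qed
    then show ?thesis
      using for_large_ex[OF assms(2)] binomial_polynomial_constant[of c] True by simp
  next
    case False
    then obtain i l where l: "k = l + unit_index i" by (rule nonzero_index)
    have "\<forall>h>l. shift i c h = 0"
      using above add_unit_strict_mono[of l _ i] unfolding l shift_def by simp
    with assms(1)[of i] have "0 \<le> shift i c l" unfolding nonneg_top_def by simp
    then show ?thesis by (simp add: shift_def l)
  qed
qed

section \<open>Homogeneous components\<close>

definition decomposes :: "('g, 'x) ring_scheme \<Rightarrow> ('i \<Rightarrow> 'g set) \<Rightarrow> ('i \<Rightarrow> 'g) \<Rightarrow> 'g \<Rightarrow> bool" where
  "decomposes G X f x \<longleftrightarrow> (\<forall>n. f n \<in> X n) \<and> finite {n. f n \<noteq> \<zero>\<^bsub>G\<^esub>} \<and>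
     x = (\<Oplus>\<^bsub>G\<^esub>n\<in>{n. f n \<noteq> \<zero>\<^bsub>G\<^esub>}. f n)"

definition component :: "('g, 'x) ring_scheme \<Rightarrow> ('i \<Rightarrow> 'g set) \<Rightarrow> 'i \<Rightarrow> 'g \<Rightarrow> 'g" where
  "component G X n x = (THE f. decomposes G X f x) n"

locale graded_group = abelian_group G for G :: "('g, 'x) ring_scheme" (structure) +
  fixes X :: "'i \<Rightarrow> 'g set"
  assumes direct_sum: "internal_direct_sum G X"
begin

lemma part_subgroup: "additive_subgroup (X n) G"
  using direct_sum by (simp add: internal_direct_sum_def)

lemma part_subset: "X n \<subseteq> carrier G"
  by (rule additive_subgroup.a_subset[OF part_subgroup])

lemma part_zero [simp]: "\<zero> \<in> X n"
  by (rule additive_subgroup.zero_closed[OF part_subgroup])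

lemma part_add: "x \<in> X n \<Longrightarrow> y \<in> X n \<Longrightarrow> x \<oplus> y \<in> X n"
  by (rule additive_subgroup.a_closed[OF part_subgroup])

lemma part_inv: "x \<in> X n \<Longrightarrow> \<ominus> x \<in> X n"
  using additive_subgroup.a_inv_closed[OF part_subgroup] by simp

lemma ex1_decomposes: "x \<in> carrier G \<Longrightarrow> \<exists>!f. decomposes G X f x"
  using direct_sum by (simp add: internal_direct_sum_def decomposes_def)

lemma decomposes_component: "x \<in> carrier G \<Longrightarrow> decomposes G X (\<lambda>n. component G X n x) x"
  unfolding component_def by (rule theI'[OF ex1_decomposes])

lemma component_part: "x \<in> carrier G \<Longrightarrow> component G X n x \<in> X n"
  using decomposes_component by (auto simp: decomposes_def)

lemma component_closed [simp]: "x \<in> carrier G \<Longrightarrow> component G X n x \<in> carrier G"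
  using component_part part_subset by blast

text \<open>
  Uniqueness of the decomposition, for sums over a finite index set that may exceed the support.
\<close>

lemma component_eqI:
  assumes "finite F" "\<And>n. n \<notin> F \<Longrightarrow> f n = \<zero>" "\<And>n. f n \<in> X n" "x = (\<Oplus>n\<in>F. f n)"
  shows "component G X n x = f n"
proof -
  have f: "f \<in> F \<rightarrow> carrier G" using assms(3) part_subset by auto
  have sub: "{n. f n \<noteq> \<zero>} \<subseteq> F" using assms(2) by blast
  have "x = (\<Oplus>n\<in>{n. f n \<noteq> \<zero>}. f n)"
    unfolding assms(4)
    by (rule add.finprod_mono_neutral_cong_right[OF assms(1) sub]) (use f in auto)
  then have "decomposes G X f x"
    using assms(3) finite_subset[OF sub assms(1)] by (simp add: decomposes_def)
  moreover have "x \<in> carrier G" unfolding assms(4) using f by (rule finsum_closed)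
  ultimately have "(THE f. decomposes G X f x) = f" by (intro the1_equality[OF ex1_decomposes])
  then show ?thesis by (simp add: component_def)
qed

lemma component_sum:
  assumes "x \<in> carrier G"
  obtains F where "finite F" "\<And>n. n \<notin> F \<Longrightarrow> component G X n x = \<zero>" "x = (\<Oplus>n\<in>F. component G X n x)"
proof -
  have D: "finite {n. component G X n x \<noteq> \<zero>}"
    "x = (\<Oplus>n\<in>{n. component G X n x \<noteq> \<zero>}. component G X n x)"
    using decomposes_component[OF assms] unfolding decomposes_def by blast+
  show ?thesis by (rule that[OF D(1) _ D(2)]) simp
qed

lemma component_homogeneous:
  assumes "x \<in> X n"
  shows "component G X k x = (if k = n then x else \<zero>)"
proof (rule component_eqI[of "{n}"])
  show "x = (\<Oplus>k\<in>{n}. if k = n then x else \<zero>)" using assms part_subset[of n] by auto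
qed (use assms in auto)

lemma component_add:
  assumes "x \<in> carrier G" "y \<in> carrier G"
  shows "component G X n (x \<oplus> y) = component G X n x \<oplus> component G X n y"
proof -
  obtain F where F: "finite F" "\<And>n. n \<notin> F \<Longrightarrow> component G X n x = \<zero>" "x = (\<Oplus>n\<in>F. component G X n x)"
    by (rule component_sum[OF assms(1)]) blast
  obtain F' where F': "finite F'" "\<And>n. n \<notin> F' \<Longrightarrow> component G X n y = \<zero>" "y = (\<Oplus>n\<in>F'. component G X n y)"
    by (rule component_sum[OF assms(2)]) blast
  have cl: "(\<lambda>n. component G X n x) \<in> D \<rightarrow> carrier G" "(\<lambda>n. component G X n y) \<in> D \<rightarrow> carrier G" for D
    using assms by auto
  have x: "x = (\<Oplus>n\<in>F \<union> F'. component G X n x)"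
    by (subst F(3), rule add.finprod_mono_neutral_cong_left) (use F(1,2) F'(1,2) assms in auto)
  have y: "y = (\<Oplus>n\<in>F \<union> F'. component G X n y)"
    by (subst F'(3), rule add.finprod_mono_neutral_cong_left) (use F(1,2) F'(1,2) assms in auto)
  show ?thesis
  proof (rule component_eqI[of "F \<union> F'"])
    have "x \<oplus> y = (\<Oplus>n\<in>F \<union> F'. component G X n x) \<oplus> (\<Oplus>n\<in>F \<union> F'. component G X n y)"
      using x y by simp
    then show "x \<oplus> y = (\<Oplus>n\<in>F \<union> F'. component G X n x \<oplus> component G X n y)"
      by (simp only: finsum_addf[OF cl])
  qed (use F(1,2) F'(1,2) assms in \<open>auto intro: part_add component_part\<close>)
qed

end

text \<open>
  Used with \<open>\<sigma> = id\<close> for degree-preserving maps and with a translation \<open>\<sigma>\<close> for multiplication by a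
  homogeneous element; the second claim says that the image has no component outside the shifted
  degrees.
\<close>

lemma component_hom:
  assumes "graded_group G X" "graded_group H Y"
    and closed: "\<And>x. x \<in> carrier G \<Longrightarrow> \<phi> x \<in> carrier H"
    and add: "\<And>x y. x \<in> carrier G \<Longrightarrow> y \<in> carrier G \<Longrightarrow> \<phi> (x \<oplus>\<^bsub>G\<^esub> y) = \<phi> x \<oplus>\<^bsub>H\<^esub> \<phi> y"
    and part: "\<And>n x. x \<in> X n \<Longrightarrow> \<phi> x \<in> Y (\<sigma> n)" and "inj \<sigma>" and x: "x \<in> carrier G"
  shows "component H Y (\<sigma> n) (\<phi> x) = \<phi> (component G X n x)"
    and "k \<notin> range \<sigma> \<Longrightarrow> component H Y k (\<phi> x) = \<zero>\<^bsub>H\<^esub>"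
proof -
  interpret G: graded_group G X by fact
  interpret H: graded_group H Y by fact
  have phi0: "\<phi> \<zero>\<^bsub>G\<^esub> = \<zero>\<^bsub>H\<^esub>"
    by (rule additive_map_zero[OF G.abelian_group_axioms H.abelian_group_axioms closed add])
  have phi_sum: "\<phi> (\<Oplus>\<^bsub>G\<^esub>n\<in>F. f n) = (\<Oplus>\<^bsub>H\<^esub>n\<in>F. \<phi> (f n))"
    if "finite F" "\<And>n. f n \<in> carrier G" for f :: "'c \<Rightarrow> 'a" and F
    using that(1)
  proof (induction F rule: finite_induct)
    case empty
    then show ?case by (simp add: phi0)
  next
    case (insert n F)
    have fG: "f \<in> F \<rightarrow> carrier G" and fH: "(\<lambda>n. \<phi> (f n)) \<in> F \<rightarrow> carrier H" using that closed by auto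
    show ?case using insert that(2) closed G.finsum_closed[OF fG]
      by (simp add: G.finsum_insert[OF insert(1,2) fG] H.finsum_insert[OF insert(1,2) fH] add)
  qed
  obtain F where F: "finite F" "\<And>n. n \<notin> F \<Longrightarrow> component G X n x = \<zero>\<^bsub>G\<^esub>"
    "x = (\<Oplus>\<^bsub>G\<^esub>n\<in>F. component G X n x)"
    by (rule G.component_sum[OF x]) blast
  define f where "f k = (if k \<in> range \<sigma> then \<phi> (component G X (inv_into UNIV \<sigma> k) x) else \<zero>\<^bsub>H\<^esub>)" for k
  have f_sigma: "f (\<sigma> n) = \<phi> (component G X n x)" for n using \<open>inj \<sigma>\<close> by (simp add: f_def)
  have comp: "component H Y k (\<phi> x) = f k" for k
  proof (rule H.component_eqI[of "\<sigma> ` F"])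
    show part: "f n \<in> Y n" for n
    proof (cases "n \<in> range \<sigma>")
      case True
      then obtain m where "n = \<sigma> m" by blast
      then show ?thesis using f_sigma part[OF G.component_part[OF x, of m]] by simp
    qed (simp add: f_def)
    show "finite (\<sigma> ` F)" using F by simp
    show "f k = \<zero>\<^bsub>H\<^esub>" if "k \<notin> \<sigma> ` F" for k
    proof (cases "k \<in> range \<sigma>")
      case True
      then obtain m where m: "k = \<sigma> m" by blast
      with that have "m \<notin> F" by blast
      then show ?thesis using m f_sigma F(2) phi0 by simp
    qed (simp add: f_def)
    have "\<phi> x = \<phi> (\<Oplus>\<^bsub>G\<^esub>n\<in>F. component G X n x)" using F(3) by simp
    also have "\<dots> = (\<Oplus>\<^bsub>H\<^esub>n\<in>F. \<phi> (component G X n x))"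
      by (rule phi_sum[OF F(1)]) (use x in simp)
    also have "\<dots> = (\<Oplus>\<^bsub>H\<^esub>n\<in>F. f (\<sigma> n))" by (simp only: f_sigma)
    also have "\<dots> = (\<Oplus>\<^bsub>H\<^esub>k\<in>\<sigma> ` F. f k)"
      by (rule H.finsum_reindex[symmetric])
        (use part H.part_subset inj_on_subset[OF \<open>inj \<sigma>\<close>] in blast)+
    finally show "\<phi> x = (\<Oplus>\<^bsub>H\<^esub>k\<in>\<sigma> ` F. f k)" .
  qed
  show "component H Y (\<sigma> n) (\<phi> x) = \<phi> (component G X n x)" using comp f_sigma by simp
  show "component H Y k (\<phi> x) = \<zero>\<^bsub>H\<^esub>" if "k \<notin> range \<sigma>" using comp that by (simp add: f_def)
qed

lemma (in graded_group) component_inv: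
  assumes "x \<in> carrier G"
  shows "component G X n (\<ominus> x) = \<ominus> component G X n x"
  using component_hom(1)[OF graded_group_axioms graded_group_axioms, where \<phi> = "\<lambda>x. \<ominus> x" and \<sigma> = "\<lambda>n. n"]
    assms by (simp add: minus_add part_inv)

section \<open>Hilbert functions of graded subquotients\<close>

text \<open>
  What the devissage needs about a graded module: scalars \<open>T\<close> preserving degrees, finitely many operators
  \<open>X\<close> of degree one, the chain condition for subgroups stable under both, and finite length of
  cyclic extensions over the scalars.
\<close>

locale graded_operator_group = operator_group G act J + graded_group G GG
  for G :: "('g, 'x) ring_scheme" (structure) and act :: "'i \<Rightarrow> 'g \<Rightarrow> 'g" and J
    and GG :: "('d::finite \<Rightarrow> nat) \<Rightarrow> 'g set" +
  fixes T X :: "'i set" and dir :: "'i \<Rightarrow> 'd"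
  assumes T: "T \<subseteq> J" and X: "finite X" "X \<subseteq> J"
    and T_graded: "t \<in> T \<Longrightarrow> x \<in> GG n \<Longrightarrow> act t x \<in> GG n"
    and X_graded: "s \<in> X \<Longrightarrow> x \<in> GG n \<Longrightarrow> act s x \<in> GG (n + unit_index (dir s))"
    and acc: "acc (T \<union> X) (carrier G)"
    and finite_extension:
      "stable T U \<Longrightarrow> x \<in> carrier G \<Longrightarrow> \<exists>V. stable T V \<and> U \<subseteq> V \<and> x \<in> V \<and> len T U V \<noteq> \<infinity>"
begin

lemma TX: "T \<union> X \<subseteq> J" using T X by blast

abbreviation part :: "('d \<Rightarrow> nat) \<Rightarrow> 'g \<Rightarrow> 'g" where
  "part \<equiv> component G GG"

lemma part_scalar:
  assumes "t \<in> T" "x \<in> carrier G"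
  shows "part n (act t x) = act t (part n x)"
  using component_hom(1)[OF graded_group_axioms graded_group_axioms, where \<phi> = "act t" and \<sigma> = "\<lambda>n. n"]
    assms T T_graded by (auto simp: act_add)

lemma part_shift:
  assumes "s \<in> X" "x \<in> carrier G"
  shows "part (n + unit_index (dir s)) (act s x) = act s (part n x)"
    and "k (dir s) = 0 \<Longrightarrow> part k (act s x) = \<zero>"
proof -
  have s: "s \<in> J" using assms X by blast
  note hom = component_hom[OF graded_group_axioms graded_group_axioms, where \<phi> = "act s"
      and \<sigma> = "\<lambda>n. n + unit_index (dir s)", OF _ _ _ add_unit_inj assms(2)]
  show "part (n + unit_index (dir s)) (act s x) = act s (part n x)"
    by (rule hom(1)) (use s act_add X_graded[OF assms(1)] in auto)
  show "part k (act s x) = \<zero>" if "k (dir s) = 0"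
    by (rule hom(2)) (use s act_add X_graded[OF assms(1)] that in \<open>auto simp: unit_index_def\<close>)
qed

definition homogeneous :: "'g set \<Rightarrow> bool" where
  "homogeneous U \<longleftrightarrow> stable (T \<union> X) U \<and> (\<forall>u\<in>U. \<forall>n. part n u \<in> U)"

lemma homogeneous_stable: "homogeneous U \<Longrightarrow> stable (T \<union> X) U"
  by (simp add: homogeneous_def)

lemma homogeneous_part: "homogeneous U \<Longrightarrow> u \<in> U \<Longrightarrow> part n u \<in> U"
  by (simp add: homogeneous_def)

lemma homogeneous_carrier_mem: "homogeneous U \<Longrightarrow> u \<in> U \<Longrightarrow> u \<in> carrier G"
  by (rule stable_carrier_mem[OF homogeneous_stable])

lemma homogeneous_act: "homogeneous U \<Longrightarrow> s \<in> X \<Longrightarrow> u \<in> U \<Longrightarrow> act s u \<in> U"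
  using stable_act[OF homogeneous_stable] by blast

lemma stable_GG: "stable T (GG n)"
  by (simp add: stable_def part_subgroup T_graded)

lemma stable_slice: "homogeneous U \<Longrightarrow> stable T (U \<inter> GG n)"
  by (intro stable_Int stable_GG stable_antimono[OF homogeneous_stable]) auto

lemma part_slice: "homogeneous U \<Longrightarrow> u \<in> U \<Longrightarrow> part n u \<in> U \<inter> GG n"
  using homogeneous_part homogeneous_carrier_mem component_part by blast

lemma homogeneous_trivial: "homogeneous {\<zero>}"
  using stable_trivial[OF TX] component_homogeneous[OF part_zero] by (simp add: homogeneous_def)

lemma homogeneous_carrier: "homogeneous (carrier G)"
  using stable_carrier[OF TX] by (simp add: homogeneous_def)

lemma homogeneous_colon:
  assumes "s \<in> X" "homogeneous N" "homogeneous L"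
  shows "homogeneous {m \<in> N. act s m \<in> L}"
  unfolding homogeneous_def
proof (intro conjI ballI allI)
  have s: "s \<in> J" using assms X by blast
  show "stable (T \<union> X) {m \<in> N. act s m \<in> L}"
    using stable_funpow_vimage[OF TX s homogeneous_stable[OF assms(2)] homogeneous_stable[OF assms(3)], of 1]
    by simp
  fix u n assume u: "u \<in> {m \<in> N. act s m \<in> L}"
  then have "u \<in> carrier G" using homogeneous_carrier_mem[OF assms(2)] by blast
  then have "act s (part n u) = part (n + unit_index (dir s)) (act s u)"
    by (rule part_shift(1)[OF assms(1), symmetric])
  then have "act s (part n u) \<in> L" using u homogeneous_part[OF assms(3)] by simp
  then show "part n u \<in> {m \<in> N. act s m \<in> L}" using u homogeneous_part[OF assms(2)] by blast
qed

text \<open>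
  The last claim computes the components of \<open>L + s N\<close>, so that multiplication by \<open>s\<close> can be compared with
  it degree by degree.
\<close>

lemma homogeneous_add_image:
  assumes "s \<in> X" "homogeneous N" "homogeneous L"
  shows "homogeneous (L <+>\<^bsub>G\<^esub> act s ` N)"
    and "L \<subseteq> L <+>\<^bsub>G\<^esub> act s ` N" and "act s ` N \<subseteq> L <+>\<^bsub>G\<^esub> act s ` N"
    and "(L <+>\<^bsub>G\<^esub> act s ` N) \<inter> GG (n + unit_index (dir s))
      = act s ` (N \<inter> GG n) <+>\<^bsub>G\<^esub> (L \<inter> GG (n + unit_index (dir s)))"
proof -
  have s: "s \<in> J" using assms X by blast
  let ?e = "unit_index (dir s)"
  note c = homogeneous_carrier_mem[OF assms(2)] homogeneous_carrier_mem[OF assms(3)]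
  have im: "stable (T \<union> X) (act s ` N)"
    using stable_funpow_image[OF TX s homogeneous_stable[OF assms(2)], of 1] by simp
  note L = homogeneous_stable[OF assms(3)]
  show "L \<subseteq> L <+>\<^bsub>G\<^esub> act s ` N" "act s ` N \<subseteq> L <+>\<^bsub>G\<^esub> act s ` N"
    using sum_upper1[OF L im] sum_upper2[OF L im] .
  have dec: "part k (l \<oplus> act s m) = part k l \<oplus> part k (act s m)" if "l \<in> L" "m \<in> N" for k l m
    by (rule component_add) (use c that s in auto)
  show "homogeneous (L <+>\<^bsub>G\<^esub> act s ` N)"
    unfolding homogeneous_def
  proof (intro conjI ballI allI)
    show "stable (T \<union> X) (L <+>\<^bsub>G\<^esub> act s ` N)" by (rule stable_sum[OF TX L im])
    fix u k assume "u \<in> L <+>\<^bsub>G\<^esub> act s ` N"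
    then obtain l m where lm: "l \<in> L" "m \<in> N" "u = l \<oplus> act s m" by (auto elim!: mem_sumE)
    have "part k (act s m) \<in> act s ` N"
    proof (cases "k (dir s) = 0")
      case True
      then show ?thesis using part_shift(2)[OF assms(1) c(1)[OF lm(2)]] stable_zero[OF im] by simp
    next
      case False
      then obtain n where "k = n + ?e" by (rule sub_unit)
      then show ?thesis
        using part_shift(1)[OF assms(1) c(1)[OF lm(2)]] homogeneous_part[OF assms(2) lm(2)] by simp
    qed
    then show "part k u \<in> L <+>\<^bsub>G\<^esub> act s ` N"
      using dec[OF lm(1,2)] lm(3) homogeneous_part[OF assms(3) lm(1)] by (auto intro: mem_sumI)
  qed
  show "(L <+>\<^bsub>G\<^esub> act s ` N) \<inter> GG (n + ?e) = act s ` (N \<inter> GG n) <+>\<^bsub>G\<^esub> (L \<inter> GG (n + ?e))"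
  proof (rule subset_antisym; rule subsetI)
    fix u assume u: "u \<in> (L <+>\<^bsub>G\<^esub> act s ` N) \<inter> GG (n + ?e)"
    then obtain l m where lm: "l \<in> L" "m \<in> N" "u = l \<oplus> act s m" by (auto elim!: mem_sumE)
    have "u = part (n + ?e) u" using u component_homogeneous[of u "n + ?e" "n + ?e"] by simp
    also have "\<dots> = part (n + ?e) l \<oplus> act s (part n m)"
      using dec[OF lm(1,2)] lm(3) part_shift(1)[OF assms(1) c(1)[OF lm(2)]] by simp
    also have "\<dots> = act s (part n m) \<oplus> part (n + ?e) l"
      by (rule a_comm) (use c lm s in auto)
    finally show "u \<in> act s ` (N \<inter> GG n) <+>\<^bsub>G\<^esub> (L \<inter> GG (n + ?e))"
      using part_slice[OF assms(2) lm(2), of n] part_slice[OF assms(3) lm(1), of "n + ?e"]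
      by (metis imageI mem_sumI)
  next
    fix u assume "u \<in> act s ` (N \<inter> GG n) <+>\<^bsub>G\<^esub> (L \<inter> GG (n + ?e))"
    then obtain m l where lm: "m \<in> N" "m \<in> GG n" "l \<in> L" "l \<in> GG (n + ?e)" "u = act s m \<oplus> l"
      by (auto elim!: mem_sumE)
    have "u = l \<oplus> act s m" unfolding lm(5) by (rule a_comm) (use c lm s in auto)
    then have "u \<in> L <+>\<^bsub>G\<^esub> act s ` N" using lm(1,3) by (simp add: mem_sumI)
    moreover have "u \<in> GG (n + ?e)" unfolding lm(5) using lm(2,4) part_add X_graded[OF assms(1)] by blast
    ultimately show "u \<in> (L <+>\<^bsub>G\<^esub> act s ` N) \<inter> GG (n + ?e)" by blast
  qed
qed

text \<open>
  Sending \<open>U \<subseteq> M\<^sub>n\<close> to \<open>E U\<close>, the elements whose component in degree \<open>n\<close> lies in \<open>U\<close> and whose other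
  components sit in degrees above \<open>n\<close>, embeds the scalar-stable subgroups of \<open>M\<^sub>n\<close> in the stable subgroups
  of \<open>M\<close>. So among those of finite length there is a maximal one, and it must be all of \<open>M\<^sub>n\<close>: otherwise a
  cyclic extension would enlarge it.
\<close>

lemma slice_finite_length: "len T {\<zero>} (GG n) \<noteq> \<infinity>"
proof -
  define E where "E U = {m \<in> carrier G. part n m \<in> U \<and> (\<forall>k. \<not> n \<le> k \<longrightarrow> part k m = \<zero>)}" for U
  have E_stable: "stable (T \<union> X) (E U)" if U: "stable T U" for U
  proof (rule stableI)
    show "E U \<subseteq> carrier G" by (auto simp: E_def)
    show "\<zero> \<in> E U" using stable_zero[OF U] component_homogeneous[OF part_zero] by (simp add: E_def)
    show "u \<oplus> v \<in> E U" if "u \<in> E U" "v \<in> E U" for u v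
      using that stable_add[OF U] by (auto simp: E_def component_add)
    show "\<ominus> u \<in> E U" if "u \<in> E U" for u
      using that stable_inv[OF U] by (auto simp: E_def component_inv)
    show "act t u \<in> E U" if tu: "t \<in> T \<union> X" "u \<in> E U" for t u
    proof (cases "t \<in> T")
      case True
      then show ?thesis using tu T stable_act[OF U True]
        by (auto simp: E_def part_scalar)
    next
      case False
      with tu have t: "t \<in> X" "t \<in> J" "u \<in> carrier G" using X by (auto simp: E_def)
      have "part k (act t u) = \<zero>" if "\<not> n + unit_index (dir t) \<le> k" for k
      proof (cases "k (dir t) = 0")
        case True
        then show ?thesis by (rule part_shift(2)[OF t(1,3)])
      next
        case False
        then obtain l where l: "k = l + unit_index (dir t)" by (rule sub_unit)
        with that have "\<not> n \<le> l" by (auto simp: le_fun_def)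
        then have "part l u = \<zero>" using tu(2) by (auto simp: E_def)
        then show ?thesis unfolding l part_shift(1)[OF t(1,3)] using t by simp
      qed
      note vanish = this
      have "\<not> n + unit_index (dir t) \<le> n" by (auto simp: le_fun_def unit_index_def)
      then have "part n (act t u) \<in> U" using vanish stable_zero[OF U] by simp
      moreover have "part k (act t u) = \<zero>" if "\<not> n \<le> k" for k
      proof (rule vanish)
        show "\<not> n + unit_index (dir t) \<le> k" using that
          by (auto simp: le_fun_def) (metis add_leD1)
      qed
      ultimately show ?thesis using t by (simp add: E_def)
    qed
  qed
  let ?U = "{U. stable T U \<and> U \<subseteq> GG n \<and> len T {\<zero>} U \<noteq> \<infinity>}"
  have E_inj: "U = V" if UV: "U \<subseteq> GG n" "V \<subseteq> GG n" "E U = E V" for U V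
  proof -
    have "u \<in> E W \<longleftrightarrow> u \<in> W" if "u \<in> GG n" for u W
      using that part_subset component_homogeneous[OF that] by (auto simp: E_def)
    with UV show ?thesis by blast
  qed
  have "{\<zero>} \<in> ?U" using stable_trivial[OF T] interval_length_refl[of "stable T" "{\<zero>}"]
    by (simp add: zero_enat_def)
  then have "E {\<zero>} \<in> E ` ?U" by (rule imageI)
  moreover have "stable (T \<union> X) V \<and> V \<subseteq> carrier G" if "V \<in> E ` ?U" for V
    using that E_stable stable_subset[OF E_stable] by blast
  ultimately have "\<exists>W\<in>E ` ?U. \<forall>V\<in>E ` ?U. W \<subseteq> V \<longrightarrow> V = W" (is ?ex)
  proof (rule acc_maximal[OF acc])
    fix V assume V: "V \<in> E ` ?U" "\<And>W. W \<in> E ` ?U \<Longrightarrow> V \<subseteq> W \<Longrightarrow> W = V"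
    show ?ex by (rule bexI[OF _ V(1)]) (intro ballI impI V(2))
  qed
  then obtain W where W: "W \<in> E ` ?U" and W_max: "\<forall>V\<in>E ` ?U. W \<subseteq> V \<longrightarrow> V = W" ..
  from W obtain U where U: "stable T U" "U \<subseteq> GG n" "len T {\<zero>} U \<noteq> \<infinity>" "W = E U" by blast
  have "GG n \<subseteq> U"
  proof
    fix x assume x: "x \<in> GG n"
    then have "x \<in> carrier G" using part_subset by blast
    from finite_extension[OF U(1) this] obtain V where
      V: "stable T V" "U \<subseteq> V" "x \<in> V" "len T U V \<noteq> \<infinity>" by blast
    let ?V = "V \<inter> GG n"
    have st: "stable T ?V" by (rule stable_Int[OF V(1) stable_GG])
    have UV: "U \<subseteq> ?V" using U V by blast
    have "len T U ?V \<noteq> \<infinity>"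
      by (rule enat_le_finite[OF interval_length_mono V(4)]) auto
    moreover have "len T {\<zero>} ?V = len T {\<zero>} U + len T U ?V"
      by (rule length_add[OF T stable_trivial[OF T] U(1) st _ UV]) (use stable_zero[OF U(1)] in simp)
    ultimately have "len T {\<zero>} ?V \<noteq> \<infinity>" using enat_add_finite[OF U(3)] by simp
    with st have mem: "E ?V \<in> E ` ?U" by blast
    have sub: "W \<subseteq> E ?V" using UV U(4) by (auto simp: E_def)
    have "E ?V = E U" using W_max[rule_format, OF mem sub] U(4) by simp
    then have "?V = U" using E_inj U(2) by blast
    then show "x \<in> U" using V(3) x by blast
  qed
  then have "U = GG n" using U(2) by blast
  with U(3) show ?thesis by simp
qed

text \<open>
  The Hilbert function of the subquotient \<open>N / L\<close>.
\<close>

definition hilbert :: "'g set \<Rightarrow> 'g set \<Rightarrow> ('d \<Rightarrow> nat) \<Rightarrow> enat" where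
  "hilbert L N n = len T (L \<inter> GG n) (N \<inter> GG n)"

lemma hilbert_finite:
  assumes "homogeneous L"
  shows "hilbert L N n \<noteq> \<infinity>"
  unfolding hilbert_def
proof (rule enat_le_finite[OF interval_length_mono slice_finite_length])
  show "{\<zero>} \<subseteq> L \<inter> GG n" using stable_zero[OF stable_slice[OF assms]] by simp
  show "N \<inter> GG n \<subseteq> GG n" by blast
qed

lemma hilbert_add:
  assumes "homogeneous L" "homogeneous N" "homogeneous K" "L \<subseteq> N" "N \<subseteq> K"
  shows "hilbert L K n = hilbert L N n + hilbert N K n"
  unfolding hilbert_def
  by (rule length_add[OF T]) (use assms stable_slice in auto)

text \<open>
  The operator \<open>s\<close> acts injectively on the quotient \<open>N / L\<close>.
\<close>

definition regular :: "'i \<Rightarrow> 'g set \<Rightarrow> 'g set \<Rightarrow> bool" where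
  "regular s L N \<longleftrightarrow> (\<forall>m\<in>N. act s m \<in> L \<longrightarrow> m \<in> L)"

text \<open>
  Multiplication by \<open>s\<close> identifies the component of \<open>N / L\<close> in degree \<open>n\<close> with that of \<open>(L + s N) / L\<close> in the
  next degree.
\<close>

lemma hilbert_regular:
  assumes "s \<in> X" "homogeneous L" "homogeneous N" "L \<subseteq> N" "regular s L N"
  shows "hilbert L N (n + unit_index (dir s))
    = hilbert L N n + hilbert (L <+>\<^bsub>G\<^esub> act s ` N) N (n + unit_index (dir s))"
proof -
  let ?e = "unit_index (dir s)"
  have s: "s \<in> J" using assms X by blast
  note im = homogeneous_add_image[OF assms(1,3,2)]
  have "len T {m \<in> N \<inter> GG n. act s m \<in> L \<inter> GG (n + ?e)} (N \<inter> GG n)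
      = len (id ` T) (L \<inter> GG (n + ?e)) (act s ` (N \<inter> GG n) <+>\<^bsub>G\<^esub> (L \<inter> GG (n + ?e)))"
    by (rule length_hom_image(1)[OF operator_group_axioms operator_group_axioms T])
      (use T s stable_slice[OF assms(3)] stable_slice[OF assms(2)] in \<open>auto simp: act_add intro!: act_commute\<close>)
  moreover have "{m \<in> N \<inter> GG n. act s m \<in> L \<inter> GG (n + ?e)} = L \<inter> GG n"
    using assms(4,5) homogeneous_act[OF assms(2,1)] X_graded[OF assms(1)] by (auto simp: regular_def)
  ultimately have "hilbert L N n = hilbert L (L <+>\<^bsub>G\<^esub> act s ` N) (n + ?e)"
    by (simp add: hilbert_def im(4))
  moreover have "L <+>\<^bsub>G\<^esub> act s ` N \<subseteq> N"
    by (rule sum_least[OF homogeneous_stable[OF assms(3)] assms(4)])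
      (use homogeneous_act[OF assms(3,1)] in auto)
  ultimately show ?thesis
    using hilbert_add[OF assms(2) im(1) assms(3) im(2)] by simp
qed

definition has_nonneg_polynomial :: "'g set \<Rightarrow> 'g set \<Rightarrow> bool" where
  "has_nonneg_polynomial L N \<longleftrightarrow> (\<exists>c. finite {k. c k \<noteq> 0} \<and> nonneg_top c \<and>
     for_large (\<lambda>n. \<exists>l. hilbert L N n = enat l \<and> int l = binomial_polynomial c n))"

lemma has_nonneg_polynomial_zero:
  assumes "for_large (\<lambda>n. hilbert L N n = 0)"
  shows "has_nonneg_polynomial L N"
proof -
  have "for_large (\<lambda>n. \<exists>l. hilbert L N n = enat l \<and> int l = binomial_polynomial (\<lambda>_. 0) n)"
    by (rule for_large_mono[OF assms]) (auto simp: binomial_polynomial_def zero_enat_def)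
  then show ?thesis unfolding has_nonneg_polynomial_def
    by (intro exI[of _ "\<lambda>_. 0"]) (auto simp: nonneg_top_def)
qed

lemma has_nonneg_polynomial_trans:
  assumes "homogeneous L" "homogeneous N" "homogeneous K" "L \<subseteq> N" "N \<subseteq> K"
    and "has_nonneg_polynomial L N" "has_nonneg_polynomial N K"
  shows "has_nonneg_polynomial L K"
proof -
  obtain c where c: "finite {k. c k \<noteq> 0}" "nonneg_top c"
    "for_large (\<lambda>n. \<exists>l. hilbert L N n = enat l \<and> int l = binomial_polynomial c n)"
    using assms(6) unfolding has_nonneg_polynomial_def by blast
  obtain c' where c': "finite {k. c' k \<noteq> 0}" "nonneg_top c'"
    "for_large (\<lambda>n. \<exists>l. hilbert N K n = enat l \<and> int l = binomial_polynomial c' n)"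
    using assms(7) unfolding has_nonneg_polynomial_def by blast
  have "for_large (\<lambda>n. \<exists>l. hilbert L K n = enat l \<and> int l = binomial_polynomial (\<lambda>k. c k + c' k) n)"
    by (rule for_large_mono[OF for_large_conj[OF c(3) c'(3)]])
      (auto simp: hilbert_add[OF assms(1-5)] binomial_polynomial_add[OF c(1) c'(1)])
  moreover have "finite {k. c k + c' k \<noteq> 0}"
    by (rule finite_subset[of _ "{k. c k \<noteq> 0} \<union> {k. c' k \<noteq> 0}"]) (use c c' in auto)
  ultimately show ?thesis using nonneg_top_add[OF c(1) c'(1) c(2) c'(2)]
    unfolding has_nonneg_polynomial_def by (intro exI[of _ "\<lambda>k. c k + c' k"]) simp
qed

lemma has_nonneg_polynomial_integrate:
  assumes LN: "homogeneous L" "homogeneous N" "L \<subseteq> N"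
    and s: "\<And>i. s i \<in> X" "\<And>i. dir (s i) = i" "\<And>i. regular (s i) L N"
    and step: "\<And>i. has_nonneg_polynomial (L <+>\<^bsub>G\<^esub> act (s i) ` N) N"
  shows "has_nonneg_polynomial L N"
proof -
  have "\<forall>i. \<exists>b. finite {k. b k \<noteq> 0} \<and> nonneg_top b \<and> for_large (\<lambda>n. \<exists>l.
      hilbert (L <+>\<^bsub>G\<^esub> act (s i) ` N) N n = enat l \<and> int l = binomial_polynomial b n)"
    using step unfolding has_nonneg_polynomial_def by simp
  from choice[OF this] obtain b where b: "\<And>i. finite {k. b i k \<noteq> 0}" "\<And>i. nonneg_top (b i)"
    "\<And>i. for_large (\<lambda>n. \<exists>l. hilbert (L <+>\<^bsub>G\<^esub> act (s i) ` N) N n = enat l \<and> int l = binomial_polynomial (b i) n)"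
    by auto
  define F where "F n = int (the_enat (hilbert L N n))" for n
  have F: "\<exists>l. hilbert L N n = enat l \<and> int l = F n" for n
    using hilbert_finite[OF LN(1), of N n] by (cases "hilbert L N n") (auto simp: F_def)
  have "for_large (\<lambda>n. F (n + unit_index i) = F n + binomial_polynomial (b i) (n + unit_index i))" for i
  proof (rule for_large_mono[OF for_large_shift[OF b(3)[of i], of i]])
    fix n
    assume "\<exists>l. hilbert (L <+>\<^bsub>G\<^esub> act (s i) ` N) N (n + unit_index i) = enat l \<and>
      int l = binomial_polynomial (b i) (n + unit_index i)"
    then show "F (n + unit_index i) = F n + binomial_polynomial (b i) (n + unit_index i)"
      using hilbert_regular[OF s(1)[of i] LN s(3)[of i], of n] F[of n] F[of "n + unit_index i"] s(2)[of i] by auto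
  qed
  from polynomial_of_polynomial_differences[OF b(1) this] obtain c where
    c: "finite {k. c k \<noteq> 0}" "\<And>i. shift i c = b i" "for_large (\<lambda>n. F n = binomial_polynomial c n)" by blast
  have "nonneg_top c"
  proof (rule nonneg_top_of_differences)
    show "nonneg_top (shift i c)" for i using b(2) c(2) by simp
    show "for_large (\<lambda>n. 0 \<le> binomial_polynomial c n)"
      by (rule for_large_mono[OF c(3)]) (metis F_def of_nat_0_le_iff)
  qed
  moreover have "for_large (\<lambda>n. \<exists>l. hilbert L N n = enat l \<and> int l = binomial_polynomial c n)"
    by (rule for_large_mono[OF c(3)]) (metis F)
  ultimately show ?thesis using c(1) unfolding has_nonneg_polynomial_def by blast
qed

text \<open>
  The elements of \<open>N\<close> whose components with \<open>i\<close>-th degree above \<open>j\<close> lie in \<open>L\<close> form a stable subgroup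
  \<open>C j\<close>, since operators raising the \<open>i\<close>-th degree map \<open>N\<close> into \<open>L\<close>. The chain \<open>C\<close> stabilises, and beyond
  that point all components of \<open>N\<close> lie in \<open>L\<close>.
\<close>

lemma has_nonneg_polynomial_missing_direction:
  assumes "homogeneous L" "homogeneous N" "L \<subseteq> N"
    and kill: "\<And>s. s \<in> X \<Longrightarrow> dir s = i \<Longrightarrow> act s ` N \<subseteq> L"
  shows "has_nonneg_polynomial L N"
proof -
  define C where "C j = {m \<in> N. \<forall>n. j < n i \<longrightarrow> part n m \<in> L}" for j
  note L = homogeneous_stable[OF assms(1)] and N = homogeneous_stable[OF assms(2)]
  note c = homogeneous_carrier_mem[OF assms(2)]
  have C: "stable (T \<union> X) (C j)" for j
  proof (rule stableI)
    show "C j \<subseteq> carrier G" using c by (auto simp: C_def)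
    show "\<zero> \<in> C j"
      using stable_zero[OF N] stable_zero[OF L] component_homogeneous[OF part_zero] by (simp add: C_def)
    show "u \<oplus> v \<in> C j" if "u \<in> C j" "v \<in> C j" for u v
      using that c stable_add[OF N] stable_add[OF L] by (auto simp: C_def component_add)
    show "\<ominus> u \<in> C j" if "u \<in> C j" for u
      using that c stable_inv[OF N] stable_inv[OF L] by (auto simp: C_def component_inv)
    show "act t u \<in> C j" if t: "t \<in> T \<union> X" and u: "u \<in> C j" for t u
    proof -
      have uN: "u \<in> N" and uG: "u \<in> carrier G" using u c by (auto simp: C_def)
      have "part n (act t u) \<in> L" if n: "j < n i" for n
      proof (cases "t \<in> T")
        case True
        then show ?thesis
          using u n stable_act[OF L, of t "part n u"] by (auto simp: C_def part_scalar[OF True uG])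
      next
        case False
        with t have t: "t \<in> X" by blast
        show ?thesis
        proof (cases "dir t = i")
          case True
          then have "act t u \<in> L" using kill[OF t] uN by blast
          then show ?thesis by (rule homogeneous_part[OF assms(1)])
        next
          case False
          show ?thesis
          proof (cases "n (dir t) = 0")
            case True
            then show ?thesis using part_shift(2)[OF t uG] stable_zero[OF L] by simp
          next
            case nz: False
            then obtain l where l: "n = l + unit_index (dir t)" by (rule sub_unit)
            with n False have "j < l i" by (auto simp: unit_index_def)
            then have "part l u \<in> L" using u by (auto simp: C_def)
            then show ?thesis unfolding l part_shift(1)[OF t uG]
              by (rule homogeneous_act[OF assms(1) t])
          qed
        qed
      qed
      moreover have "act t u \<in> N" using stable_act[OF N t uN] .
      ultimately show ?thesis by (simp add: C_def)
    qed
  qed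
  have "stable (T \<union> X) (C j) \<and> C j \<subseteq> carrier G" for j using C stable_subset by blast
  moreover have "C j \<subseteq> C (Suc j)" for j by (auto simp: C_def)
  ultimately obtain K where K: "\<And>j. j \<ge> K \<Longrightarrow> C j = C K"
    using acc_stabilises[OF acc, of C] by metis
  have "N \<inter> GG n = L \<inter> GG n" if n: "K < n i" for n
  proof -
    have "x \<in> L" if x: "x \<in> N" "x \<in> GG n" for x
    proof -
      have "x \<in> C (n i)"
        using x stable_zero[OF L] by (auto simp: C_def component_homogeneous[OF x(2)])
      also have "C (n i) = C K" by (rule K) (use n in simp)
      finally have "part n x \<in> L" using n by (simp add: C_def)
      then show ?thesis by (simp add: component_homogeneous[OF x(2)])
    qed
    with assms(3) show ?thesis by blast
  qed
  then have "hilbert L N n = 0" if "\<forall>j. Suc K \<le> n j" for n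
    using that by (simp add: hilbert_def interval_length_refl Suc_le_eq)
  then have "for_large (\<lambda>n. hilbert L N n = 0)" unfolding for_large_def by blast
  then show ?thesis by (rule has_nonneg_polynomial_zero)
qed

text \<open>
  Inside \<open>N\<close>, the quotient \<open>(L : s\<^sup>j)\<close>.
\<close>

fun colon :: "'i \<Rightarrow> 'g set \<Rightarrow> 'g set \<Rightarrow> nat \<Rightarrow> 'g set" where
  "colon s N L 0 = L"
| "colon s N L (Suc j) = {m \<in> N. act s m \<in> colon s N L j}"

lemma colon_chain:
  assumes "s \<in> X" "homogeneous L" "homogeneous N" "L \<subseteq> N"
  shows "homogeneous (colon s N L j)" "colon s N L j \<subseteq> N" "colon s N L j \<subseteq> colon s N L (Suc j)"
    "L \<subseteq> colon s N L j"
proof -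
  show "homogeneous (colon s N L j)" by (induction j) (use assms homogeneous_colon in auto)
  show "colon s N L j \<subseteq> N" by (cases j) (use assms in auto)
  have step: "colon s N L j \<subseteq> colon s N L (Suc j)" for j
  proof (induction j)
    case 0
    then show ?case using assms homogeneous_act[OF assms(2,1)] by auto
  qed auto
  then show "colon s N L j \<subseteq> colon s N L (Suc j)" .
  show "L \<subseteq> colon s N L j" using lift_Suc_mono_le[of "colon s N L", OF step, of 0 j] by simp
qed

lemma colon_regular:
  assumes "s \<in> X" "z \<in> X" "homogeneous N" "regular s L N"
  shows "regular s (colon z N L j) N"
proof (induction j)
  case 0
  then show ?case using assms by simp
next
  case (Suc j)
  show ?case unfolding regular_def
  proof (intro ballI impI)
    fix m assume m: "m \<in> N" "act s m \<in> colon z N L (Suc j)"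
    have "act z (act s m) = act s (act z m)"
      using assms X m homogeneous_carrier_mem by (intro act_commute) blast+
    then have "act s (act z m) \<in> colon z N L j" using m by simp
    then have "act z m \<in> colon z N L j"
      using Suc m homogeneous_act[OF assms(3,2)] by (simp add: regular_def)
    then show "m \<in> colon z N L (Suc j)" using m by simp
  qed
qed

text \<open>
  Two nested inductions. The outer one is on the set \<open>Y\<close> of generators that may act nontrivially on
  \<open>N / L\<close>; the inner one on the set \<open>Z\<close> of those in \<open>Y\<close> not yet known to act injectively. To remove \<open>z\<close>
  from \<open>Z\<close>, one passes along the chain of colon subgroups of \<open>z\<close>: its steps are killed by \<open>z\<close> and are
  covered by the outer induction, and \<open>z\<close> acts injectively on the quotient by its last member.
\<close>

lemma has_nonneg_polynomial_of_killed:
  assumes "Y \<subseteq> X" "homogeneous L" "homogeneous N" "L \<subseteq> N" "\<And>s. s \<in> X - Y \<Longrightarrow> act s ` N \<subseteq> L"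
  shows "has_nonneg_polynomial L N"
  using finite_subset[OF assms(1) X(1)] assms
proof (induction Y arbitrary: L N rule: finite_psubset_induct)
  case (psubset Y)
  note IH = psubset.IH and Y = \<open>Y \<subseteq> X\<close> and N = \<open>homogeneous N\<close>
  have "has_nonneg_polynomial L N"
    if "finite Z" "Z \<subseteq> Y" "homogeneous L" "L \<subseteq> N" "\<And>s. s \<in> X - Y \<Longrightarrow> act s ` N \<subseteq> L"
      "\<And>s. s \<in> Y - Z \<Longrightarrow> regular s L N" for Z L
    using that
  proof (induction Z arbitrary: L rule: finite_induct)
    case empty
    note L = \<open>homogeneous L\<close> \<open>L \<subseteq> N\<close>
    show ?case
    proof (cases "\<exists>i. \<forall>s\<in>Y. dir s \<noteq> i")
      case True
      then obtain i where "\<And>s. s \<in> Y \<Longrightarrow> dir s \<noteq> i" by blast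
      then show ?thesis
        using empty.prems(4) by (intro has_nonneg_polynomial_missing_direction[OF L(1) N L(2), of i]) blast
    next
      case False
      then obtain s where s: "\<And>i. s i \<in> Y" "\<And>i. dir (s i) = i" by metis
      show ?thesis
      proof (rule has_nonneg_polynomial_integrate[OF L(1) N L(2), of s])
        fix i
        show sX: "s i \<in> X" using s Y by blast
        show "dir (s i) = i" by (rule s)
        show "regular (s i) L N" using empty.prems(5) s by simp
        note im = homogeneous_add_image[OF sX N L(1)]
        show "has_nonneg_polynomial (L <+>\<^bsub>G\<^esub> act (s i) ` N) N"
        proof (rule IH)
          show "Y - {s i} \<subset> Y" using s by blast
          show "Y - {s i} \<subseteq> X" using Y by blast
          show "L <+>\<^bsub>G\<^esub> act (s i) ` N \<subseteq> N"
            by (rule sum_least[OF homogeneous_stable[OF N] L(2)]) (use homogeneous_act[OF N sX] in auto)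
          show "act t ` N \<subseteq> L <+>\<^bsub>G\<^esub> act (s i) ` N" if "t \<in> X - (Y - {s i})" for t
          proof (cases "t = s i")
            case True
            then show ?thesis using im(3) by simp
          next
            case False
            with that have "act t ` N \<subseteq> L" using empty.prems(4) by blast
            then show ?thesis using im(2) by (rule subset_trans)
          qed
        qed (fact im(1) N)+
      qed
    qed
  next
    case (insert z Z)
    note L = \<open>homogeneous L\<close> \<open>L \<subseteq> N\<close>
    have z: "z \<in> Y" "z \<in> X" using insert.prems(1) Y by blast+
    let ?K = "colon z N L"
    note K = colon_chain[OF z(2) L(1) N L(2)]
    have "stable (T \<union> X) (?K j) \<and> ?K j \<subseteq> carrier G" for j
      using homogeneous_stable[OF K(1)] stable_subset by blast
    then obtain k where k: "\<And>j. j \<ge> k \<Longrightarrow> ?K j = ?K k"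
      using acc_stabilises[OF acc, of ?K, OF _ K(3)] by metis
    have "has_nonneg_polynomial L (?K j)" for j
    proof (induction j)
      case 0
      show ?case
        by (rule has_nonneg_polynomial_zero) (simp add: for_large_def hilbert_def interval_length_refl)
    next
      case (Suc j)
      have "has_nonneg_polynomial (?K j) (?K (Suc j))"
      proof (rule IH)
        show "Y - {z} \<subset> Y" using z by blast
        show "Y - {z} \<subseteq> X" using Y by blast
        show "act t ` ?K (Suc j) \<subseteq> ?K j" if t: "t \<in> X - (Y - {z})" for t
        proof (cases "t = z")
          case False
          with t have "act t ` N \<subseteq> L" using insert.prems(4) by blast
          with K(2)[of "Suc j"] K(4)[of j] show ?thesis by blast
        qed auto
      qed (fact K)+
      from has_nonneg_polynomial_trans[OF L(1) K(1) K(1) K(4) K(3) Suc this] show ?case .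
    qed
    moreover have "has_nonneg_polynomial (?K k) N"
    proof (rule insert.IH)
      show "Z \<subseteq> Y" using insert.prems(1) by blast
      show "act s ` N \<subseteq> ?K k" if "s \<in> X - Y" for s
        using insert.prems(4)[OF that] K(4) by (rule subset_trans)
      show "regular s (?K k) N" if s: "s \<in> Y - Z" for s
      proof (cases "s = z")
        case True
        have "?K (Suc k) = ?K k" by (rule k) simp
        then show ?thesis unfolding True regular_def by auto
      next
        case False
        with s have "regular s L N" using insert.prems(5) by blast
        moreover have "s \<in> X" using s Y by blast
        ultimately show ?thesis using colon_regular[OF _ z(2) N] by blast
      qed
    qed (fact K)+
    ultimately show ?case using has_nonneg_polynomial_trans[OF L(1) K(1) N K(4) K(2)] by blast
  qed
  from this[of Y L] psubset.prems psubset.hyps show ?case by blast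
qed

theorem nonneg_hilbert_polynomial:
  assumes "homogeneous L" "homogeneous N" "L \<subseteq> N"
  shows "has_nonneg_polynomial L N"
  by (rule has_nonneg_polynomial_of_killed[OF order_refl assms]) blast

end

section \<open>Graded modules over a standard graded algebra\<close>

lemma generate_ring_finite_subset:
  assumes "x \<in> generate_ring R (K \<union> W)"
  shows "\<exists>F. finite F \<and> F \<subseteq> W \<and> x \<in> generate_ring R (K \<union> F)"
proof -
  have mono: "y \<in> generate_ring R (K \<union> F')" if "y \<in> generate_ring R (K \<union> F)" "F \<subseteq> F'" for y F F'
    using that(1) by induction (use that(2) in \<open>auto intro: generate_ring.intros\<close>)
  show ?thesis using assms
  proof induction
    case one
    show ?case by (intro exI[of _ "{}"]) (simp add: generate_ring.one)
  next
    case (incl h)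
    then show ?case by (intro exI[of _ "{h} \<inter> W"]) (auto intro: generate_ring.incl)
  next
    case (a_inv h)
    then show ?case by (meson generate_ring.a_inv)
  next
    case (eng_add x y)
    then obtain F F' where "finite F" "F \<subseteq> W" "x \<in> generate_ring R (K \<union> F)"
      "finite F'" "F' \<subseteq> W" "y \<in> generate_ring R (K \<union> F')" by blast
    then show ?case
      by (intro exI[of _ "F \<union> F'"]) (auto intro!: generate_ring.eng_add intro: mono)
  next
    case (eng_mult x y)
    then obtain F F' where "finite F" "F \<subseteq> W" "x \<in> generate_ring R (K \<union> F)"
      "finite F'" "F' \<subseteq> W" "y \<in> generate_ring R (K \<union> F')" by blast
    then show ?case
      by (intro exI[of _ "F \<union> F'"]) (auto intro!: generate_ring.eng_mult intro: mono)
  qed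
qed

context standard_graded_algebra
begin

lemma structure_map_closed [simp]: "a \<in> carrier A \<Longrightarrow> structure_map S a \<in> carrier S"
  by (simp add: structure_map_def)

lemma structure_map_add:
  "a \<in> carrier A \<Longrightarrow> b \<in> carrier A \<Longrightarrow>
    structure_map S (a \<oplus>\<^bsub>A\<^esub> b) = structure_map S a \<oplus>\<^bsub>S\<^esub> structure_map S b"
  by (simp add: structure_map_def smult_l_distr)

lemma structure_map_mult:
  "a \<in> carrier A \<Longrightarrow> b \<in> carrier A \<Longrightarrow>
    structure_map S (a \<otimes>\<^bsub>A\<^esub> b) = structure_map S a \<otimes>\<^bsub>S\<^esub> structure_map S b"
  by (simp add: structure_map_def smult_assoc1 smult_assoc2)

lemma structure_map_one: "structure_map S \<one>\<^bsub>A\<^esub> = \<one>\<^bsub>S\<^esub>"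
  by (simp add: structure_map_def)

text \<open>
  Each of finitely many algebra generators is a polynomial expression in finitely many elements of degree
  one, and all these elements together generate.
\<close>

lemma finite_degree_one_generators:
  obtains X where "finite X" "generates_algebra A S X" "\<And>s. s \<in> X \<Longrightarrow> \<exists>i. s \<in> SG (unit_index i)"
proof -
  let ?K = "structure_map S ` carrier A"
  define W where "W = (\<Union>n\<in>{n. (\<Sum>i\<in>UNIV. n i) = 1}. SG n)"
  obtain X0 where X0: "finite X0" "generates_algebra A S X0" using finitely_generated by blast
  have W: "W \<subseteq> carrier S" "generate_ring S (?K \<union> W) = carrier S"
    using standard by (simp_all add: generates_algebra_def W_def)
  have "\<exists>F. finite F \<and> F \<subseteq> W \<and> x \<in> generate_ring S (?K \<union> F)" if "x \<in> X0" for x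
    using that X0(2) W(2) by (intro generate_ring_finite_subset) (auto simp: generates_algebra_def)
  then obtain F where F: "\<And>x. x \<in> X0 \<Longrightarrow> finite (F x) \<and> F x \<subseteq> W \<and> x \<in> generate_ring S (?K \<union> F x)"
    by metis
  let ?X = "\<Union>x\<in>X0. F x"
  have K: "?K \<subseteq> carrier S" by auto
  have X: "?X \<subseteq> W" using F by blast
  have KX: "?K \<union> ?X \<subseteq> carrier S" using X W(1) K by blast
  have sub: "subring (generate_ring S (?K \<union> ?X)) S" by (rule generate_ring_is_subring[OF KX])
  have "X0 \<subseteq> generate_ring S (?K \<union> ?X)"
  proof
    fix x assume x: "x \<in> X0"
    have KF: "?K \<union> F x \<subseteq> carrier S" using F[OF x] W(1) K by blast
    have "?K \<union> F x \<subseteq> generate_ring S (?K \<union> ?X)" using x by (auto intro: generate_ring.incl)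
    from generate_ring_min_subring1[OF KF sub this] F[OF x] show "x \<in> generate_ring S (?K \<union> ?X)" by blast
  qed
  moreover have "?K \<subseteq> generate_ring S (?K \<union> ?X)" by (auto intro: generate_ring.incl)
  ultimately have "generate_ring S (?K \<union> X0) \<subseteq> generate_ring S (?K \<union> ?X)"
    using X0(2) K by (intro generate_ring_min_subring1[OF _ sub]) (auto simp: generates_algebra_def)
  then have "generate_ring S (?K \<union> ?X) = carrier S"
    using X0(2) generate_ring_incl[OF KX] by (auto simp: generates_algebra_def)
  then have gen: "generates_algebra A S ?X" using X W(1) by (auto simp: generates_algebra_def)
  have "\<exists>i. s \<in> SG (unit_index i)" if "s \<in> ?X" for s
  proof -
    from that X obtain n where n: "total_degree n = 1" "s \<in> SG n"
      by (auto simp: W_def total_degree_def)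
    from n(1) obtain i where "n = unit_index i" by (rule total_degree_eq_1)
    with n(2) show ?thesis by blast
  qed
  moreover have "finite ?X" using X0(1) F by blast
  ultimately show ?thesis using gen that by blast
qed

end

lemma operator_group_smult:
  assumes "module S M"
  shows "operator_group M (smult M) (carrier S)"
proof -
  interpret module S M by fact
  show ?thesis
    by unfold_locales (auto simp: smult_r_distr smult_assoc1[symmetric] R.m_comm)
qed

locale finite_graded_module =
  fixes A :: "'a ring" and S :: "('a, 's) module" and SG :: "('d::finite \<Rightarrow> nat) \<Rightarrow> 's set"
    and M :: "('s, 'm) module" and MG :: "('d \<Rightarrow> nat) \<Rightarrow> 'm set"
  assumes A: "cring A" "artinian_ring A"
    and S: "standard_graded_algebra A S SG"
    and M: "graded_module S SG M MG"
    and finitely_generated: "finitely_generated_module S M"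
begin

abbreviation scalars :: "'s set" where
  "scalars \<equiv> structure_map S ` carrier A"

sublocale M: graded_module S SG M MG by (rule M)
sublocale S: standard_graded_algebra A S SG by (rule S)
sublocale operator_group M "smult M" "carrier S"
  by (rule operator_group_smult[OF M.module_axioms])
sublocale graded_group M MG
  by unfold_locales (rule M.direct_sum)

lemma abelian_group: "abelian_group M"
  by (rule module.axioms(2)[OF M.module_axioms])

lemma scalars: "scalars \<subseteq> carrier S" by auto

lemma scalar_part:
  assumes "t \<in> scalars" "x \<in> MG n"
  shows "t \<odot>\<^bsub>M\<^esub> x \<in> MG n"
proof -
  from assms(1) have "t \<in> SG 0" using S.scalars_degree_zero by blast
  from M.smult_graded[OF this assms(2)] show ?thesis by simp
qed

lemma stable_part: "stable scalars (MG n)"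
  by (simp add: stable_def part_subgroup scalar_part)

text \<open>
  The quotient \<open>(U + A x) / U\<close> is an image of the Artinian ring \<open>A\<close>, which has finite length.
\<close>

lemma cyclic_extension_finite_length:
  assumes U: "stable scalars U" and x: "x \<in> carrier M"
  shows "\<exists>V. stable scalars V \<and> U \<subseteq> V \<and> x \<in> V \<and> len scalars U V \<noteq> \<infinity>"
proof -
  interpret AA: operator_group A "mult A" "carrier A" by (rule cring.operator_group_regular[OF A(1)])
  let ?\<phi> = "\<lambda>a. structure_map S a \<odot>\<^bsub>M\<^esub> x"
  note hom = length_hom_image[where \<tau> = "structure_map S" and \<phi> = ?\<phi>, OF AA.operator_group_axioms
      operator_group_axioms order_refl scalars AA.stable_carrier[OF order_refl] U]
  have closed: "\<And>a. a \<in> carrier A \<Longrightarrow> ?\<phi> a \<in> carrier M"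
    and add: "\<And>a b. a \<in> carrier A \<Longrightarrow> b \<in> carrier A \<Longrightarrow> ?\<phi> (a \<oplus>\<^bsub>A\<^esub> b) = ?\<phi> a \<oplus>\<^bsub>M\<^esub> ?\<phi> b"
    and act: "\<And>a b. a \<in> carrier A \<Longrightarrow> b \<in> carrier A \<Longrightarrow>
      ?\<phi> (a \<otimes>\<^bsub>A\<^esub> b) = structure_map S a \<odot>\<^bsub>M\<^esub> ?\<phi> b"
    using x by (simp_all add: S.structure_map_add S.structure_map_mult M.smult_l_distr M.smult_assoc1)
  note hom = hom[OF closed add act]
  have "AA.len (carrier A) {m \<in> carrier A. ?\<phi> m \<in> U} (carrier A) \<noteq> \<infinity>"
  proof (rule enat_le_finite[OF interval_length_mono[OF _ order_refl] artinian_finite_length[OF A]])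
    show "{\<zero>\<^bsub>A\<^esub>} \<subseteq> {m \<in> carrier A. ?\<phi> m \<in> U}" using AA.stable_zero[OF hom(2)] by simp
  qed
  then have "len scalars U (?\<phi> ` carrier A <+>\<^bsub>M\<^esub> U) \<noteq> \<infinity>" using hom(1) by simp
  moreover have "x = ?\<phi> \<one>\<^bsub>A\<^esub>" using x by (simp add: S.structure_map_one)
  then have "x \<in> ?\<phi> ` carrier A" by blast
  then have "x \<in> ?\<phi> ` carrier A <+>\<^bsub>M\<^esub> U" using sum_upper1[OF hom(3) U] by blast
  ultimately show ?thesis using hom(4) sum_upper2[OF hom(3) U] by blast
qed

lemma finite_span_finite_length:
  assumes "finite B" "B \<subseteq> carrier M"
  shows "\<exists>V. stable scalars V \<and> B \<subseteq> V \<and> len scalars {\<zero>\<^bsub>M\<^esub>} V \<noteq> \<infinity>"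
  using assms
proof (induction B rule: finite_induct)
  case empty
  have "len scalars {\<zero>\<^bsub>M\<^esub>} {\<zero>\<^bsub>M\<^esub>} \<noteq> \<infinity>" by (simp add: interval_length_refl zero_enat_def)
  with stable_trivial[OF scalars] show ?case by blast
next
  case (insert x B)
  then obtain V where V: "stable scalars V" "B \<subseteq> V" "len scalars {\<zero>\<^bsub>M\<^esub>} V \<noteq> \<infinity>" by blast
  from insert.prems cyclic_extension_finite_length[OF V(1), of x] obtain W where
    W: "stable scalars W" "V \<subseteq> W" "x \<in> W" "len scalars V W \<noteq> \<infinity>" by blast
  have "len scalars {\<zero>\<^bsub>M\<^esub>} W = len scalars {\<zero>\<^bsub>M\<^esub>} V + len scalars V W"
    by (rule length_add[OF scalars stable_trivial[OF scalars] V(1) W(1) _ W(2)])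
      (use stable_zero[OF V(1)] in simp)
  with enat_add_finite[OF V(3) W(4)] have "len scalars {\<zero>\<^bsub>M\<^esub>} W \<noteq> \<infinity>" by simp
  with V W show ?case by blast
qed

text \<open>
  The elements of the algebra that map \<open>N\<close> into itself form a subring containing the generators.
\<close>

lemma stable_generators_submodule:
  assumes "generates_algebra A S X" "stable (scalars \<union> X) N"
  shows "submodule N S M"
proof -
  have X: "scalars \<union> X \<subseteq> carrier S" using assms(1) by (auto simp: generates_algebra_def)
  have closed: "s \<in> carrier S" if "s \<in> generate_ring S (scalars \<union> X)" for s
    by (rule ring.generate_ring_in_carrier[OF cring.axioms(1)[OF S.M_cring] X that])
  note N = stable_carrier_mem[OF assms(2)]
  have act: "\<forall>u\<in>N. s \<odot>\<^bsub>M\<^esub> u \<in> N" if "s \<in> generate_ring S (scalars \<union> X)" for s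
    using that
  proof induction
    case one
    then show ?case using N by simp
  next
    case (incl h)
    then show ?case using stable_act[OF assms(2)] by blast
  next
    case (a_inv h)
    then show ?case using closed[OF a_inv.hyps] N stable_inv[OF assms(2)] by (simp add: M.smult_l_minus)
  next
    case (eng_add s t)
    then show ?case using closed[OF eng_add.hyps(1)] closed[OF eng_add.hyps(2)] N stable_add[OF assms(2)]
      by (simp add: M.smult_l_distr)
  next
    case (eng_mult s t)
    then show ?case using closed[OF eng_mult.hyps(1)] closed[OF eng_mult.hyps(2)] N
      by (simp add: M.smult_assoc1)
  qed
  show ?thesis
    by (rule M.submoduleI)
      (use N act assms(1) stable_zero[OF assms(2)] stable_inv[OF assms(2)] stable_add[OF assms(2)]
        in \<open>auto simp: generates_algebra_def\<close>)
qed

text \<open>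
  The generators of the module span, over the scalars, a group of finite length. Adding the operators in
  \<open>X\<close> one by one preserves the chain condition and ends with all of \<open>M\<close>.
\<close>

lemma noetherian:
  assumes "finite X" "generates_algebra A S X"
  shows "acc (scalars \<union> X) (carrier M)"
proof -
  from finitely_generated obtain B where B: "finite B" "B \<subseteq> carrier M"
    "\<Inter>{N. submodule N S M \<and> B \<subseteq> N} = carrier M" unfolding finitely_generated_module_def by blast
  have X: "X \<subseteq> carrier S" using assms(2) by (simp add: generates_algebra_def)
  obtain V where V: "stable scalars V" "B \<subseteq> V" "len scalars {\<zero>\<^bsub>M\<^esub>} V \<noteq> \<infinity>"
    using finite_span_finite_length[OF B(1,2)] by blast
  obtain N where N: "V \<subseteq> N" "stable (scalars \<union> X) N" "acc (scalars \<union> X) N"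
    using acc_finitely_many_operators[OF scalars assms(1) X V(1) acc_finite_length[OF scalars V(1,3)]] by blast
  have "submodule N S M" by (rule stable_generators_submodule[OF assms(2) N(2)])
  moreover have "B \<subseteq> N" using V(2) N(1) by (rule subset_trans)
  ultimately have "\<Inter>{N. submodule N S M \<and> B \<subseteq> N} \<subseteq> N" by (intro Inter_lower) simp
  then have "carrier M \<subseteq> N" by (simp only: B(3))
  with stable_subset[OF N(2)] have "N = carrier M" by blast
  with N(3) show ?thesis by simp
qed

lemma module_length_part:
  "module_length A (component_module S M (MG n)) = len scalars {\<zero>\<^bsub>M\<^esub>} (MG n)"
proof -
  let ?C = "component_module S M (MG n)"
  \<comment> \<open>The two records differ in the slot that extends them, so they are compared field by field.\<close>
  have mon: "subgroup U (add_monoid ?C) \<longleftrightarrow> subgroup U ((add_monoid M)\<lparr>carrier := MG n\<rparr>)" for U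
    by (simp add: subgroup_def m_inv_def component_module_def)
  have G: "group (add_monoid M)" by (rule M.a_group)
  have P: "subgroup (MG n) (add_monoid M)" using part_subgroup[of n] by (simp add: additive_subgroup_def)
  have sub: "subgroup U (add_monoid ?C) \<longleftrightarrow> subgroup U (add_monoid M) \<and> U \<subseteq> MG n" for U
    unfolding mon using group.incl_subgroup[OF G P] group.subgroup_incl[OF G _ P] subgroup.subset
    by fastforce
  have split: "submodule U A ?C \<longleftrightarrow>
      subgroup U (add_monoid ?C) \<and> (\<forall>a\<in>carrier A. \<forall>x\<in>U. structure_map S a \<odot>\<^bsub>M\<^esub> x \<in> U)" for U
    by (auto simp: submodule_def submodule_axioms_def component_module_def)
  have "submodule U A ?C \<longleftrightarrow> stable scalars U \<and> {\<zero>\<^bsub>M\<^esub>} \<subseteq> U \<and> U \<subseteq> MG n" for U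
    using stable_zero[of scalars U] unfolding split sub stable_def additive_subgroup_def by auto
  then show ?thesis
    unfolding module_length_def interval_length_def strict_chain_sequence by simp
qed

theorem nonneg_hilbert_coefficients:
  obtains c where "hilbert_coefficients A S M MG c" "nonneg_top c"
proof -
  obtain X where X: "finite X" "generates_algebra A S X" "\<And>s. s \<in> X \<Longrightarrow> \<exists>i. s \<in> SG (unit_index i)"
    by (rule S.finite_degree_one_generators) (rule that)
  then obtain dir where dir: "\<And>s. s \<in> X \<Longrightarrow> s \<in> SG (unit_index (dir s))" by metis
  interpret graded_operator_group M "smult M" "carrier S" MG scalars X dir
  proof unfold_locales
    show "X \<subseteq> carrier S" using X(2) by (simp add: generates_algebra_def)
    show "s \<odot>\<^bsub>M\<^esub> x \<in> MG (n + unit_index (dir s))" if "s \<in> X" "x \<in> MG n" for s x n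
      using M.smult_graded[OF dir[OF that(1)] that(2)] by (simp add: add.commute)
  qed (use scalars scalar_part X(1) noetherian[OF X(1,2)] cyclic_extension_finite_length in auto)
  have "has_nonneg_polynomial {\<zero>\<^bsub>M\<^esub>} (carrier M)"
    by (rule nonneg_hilbert_polynomial[OF homogeneous_trivial homogeneous_carrier]) simp
  moreover have "hilbert {\<zero>\<^bsub>M\<^esub>} (carrier M) n = module_length A (component_module S M (MG n))" for n
  proof -
    have "{\<zero>\<^bsub>M\<^esub>} \<inter> MG n = {\<zero>\<^bsub>M\<^esub>}" "carrier M \<inter> MG n = MG n" using part_subset by auto
    then show ?thesis by (simp add: hilbert_def module_length_part)
  qed
  ultimately show ?thesis
    using that unfolding has_nonneg_polynomial_def hilbert_coefficients_def for_large_def by auto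
qed

end

section \<open>Additivity in short exact sequences\<close>

lemma hilbert_coefficients_unique:
  assumes "hilbert_coefficients A S M MG c" "hilbert_coefficients A S M MG c'"
  shows "c = c'"
proof (rule binomial_polynomial_unique)
  from assms have
    "for_large (\<lambda>n. \<exists>l. module_length A (component_module S M (MG n)) = enat l \<and> int l = binomial_polynomial c n)"
    "for_large (\<lambda>n. \<exists>l. module_length A (component_module S M (MG n)) = enat l \<and> int l = binomial_polynomial c' n)"
    unfolding hilbert_coefficients_def for_large_def by simp_all
  from for_large_conj[OF this] show "for_large (\<lambda>n. binomial_polynomial c n = binomial_polynomial c' n)"
    by (rule for_large_mono) auto
qed (use assms in \<open>simp_all add: hilbert_coefficients_def\<close>)

lemma mixed_coefficient_eqI:
  "hilbert_coefficients A S M MG c \<Longrightarrow> mixed_coefficient A S M MG = c"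
  unfolding mixed_coefficient_def by (rule the_equality) (auto intro: hilbert_coefficients_unique)

lemma linear_maps_iff:
  "f \<in> linear_maps R M N \<longleftrightarrow> (\<forall>x\<in>carrier M. f x \<in> carrier N) \<and>
     (\<forall>x\<in>carrier M. \<forall>y\<in>carrier M. f (x \<oplus>\<^bsub>M\<^esub> y) = f x \<oplus>\<^bsub>N\<^esub> f y) \<and>
     (\<forall>r\<in>carrier R. \<forall>x\<in>carrier M. f (r \<odot>\<^bsub>M\<^esub> x) = r \<odot>\<^bsub>N\<^esub> f x)"
  by (auto simp: linear_maps_def hom_def)

text \<open>
  In degree \<open>n\<close> the kernel of \<open>g\<close> is the image of \<open>M'\<^sub>n\<close> and \<open>g\<close> maps onto \<open>M''\<^sub>n\<close>, because taking
  components commutes with \<open>f\<close> and \<open>g\<close>; then length is additive along \<open>0 \<subseteq> ker \<subseteq> M\<^sub>n\<close>.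
\<close>

lemma module_length_short_exact:
  assumes "finite_graded_module A S SG M' MG'" "finite_graded_module A S SG M MG"
    "finite_graded_module A S SG M'' MG''" "graded_short_exact S M' MG' M MG M'' MG'' f g"
  shows "module_length A (component_module S M (MG n))
    = module_length A (component_module S M' (MG' n)) + module_length A (component_module S M'' (MG'' n))"
proof -
  interpret M': finite_graded_module A S SG M' MG' by fact
  interpret M: finite_graded_module A S SG M MG by fact
  interpret M'': finite_graded_module A S SG M'' MG'' by fact
  from assms(4) have f: "f \<in> linear_maps S M' M" "\<And>n. f ` MG' n \<subseteq> MG n"
    and g: "g \<in> linear_maps S M M''" "\<And>n. g ` MG n \<subseteq> MG'' n"
    and inj: "inj_on f (carrier M')" and ker: "f ` carrier M' = a_kernel M M'' g"
    and surj: "g ` carrier M = carrier M''"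
    by (auto simp: graded_short_exact_def)
  note f_lin = f(1)[unfolded linear_maps_iff] and g_lin = g(1)[unfolded linear_maps_iff]
  let ?T = "structure_map S ` carrier A"
  have kernel: "m \<in> f ` carrier M' \<longleftrightarrow> m \<in> carrier M \<and> g m = \<zero>\<^bsub>M''\<^esub>" for m
    unfolding ker by (simp add: a_kernel_def kernel_def)
  have comp_f: "component M MG n (f x) = f (component M' MG' n x)" if "x \<in> carrier M'" for x
    by (rule component_hom(1)[where \<sigma> = "\<lambda>n. n", OF M'.graded_group_axioms M.graded_group_axioms])
      (use f_lin f(2) that in auto)
  have comp_g: "component M'' MG'' n (g x) = g (component M MG n x)" if "x \<in> carrier M" for x
    by (rule component_hom(1)[where \<sigma> = "\<lambda>n. n", OF M.graded_group_axioms M''.graded_group_axioms])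
      (use g_lin g(2) that in auto)
  have im_f: "f ` MG' n = {m \<in> MG n. g m = \<zero>\<^bsub>M''\<^esub>}"
  proof (rule subset_antisym; rule subsetI)
    fix m assume "m \<in> f ` MG' n"
    then show "m \<in> {m \<in> MG n. g m = \<zero>\<^bsub>M''\<^esub>}"
      using f(2) kernel[of m] M'.part_subset by blast
  next
    fix m assume m: "m \<in> {m \<in> MG n. g m = \<zero>\<^bsub>M''\<^esub>}"
    then have "m \<in> f ` carrier M'" using kernel M.part_subset by blast
    then obtain x where x: "x \<in> carrier M'" "m = f x" by blast
    have "m = component M MG n m" using m M.component_homogeneous[of m n n] by simp
    also have "\<dots> = f (component M' MG' n x)" using comp_f x by simp
    finally show "m \<in> f ` MG' n" using M'.component_part[OF x(1)] by blast
  qed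
  have im_g: "g ` MG n = MG'' n"
  proof (rule subset_antisym[OF g(2)]; rule subsetI)
    fix y assume y: "y \<in> MG'' n"
    then have "y \<in> g ` carrier M" using surj M''.part_subset by blast
    then obtain x where x: "x \<in> carrier M" "y = g x" by blast
    have "y = component M'' MG'' n y" using y M''.component_homogeneous[of y n n] by simp
    also have "\<dots> = g (component M MG n x)" using comp_g x by simp
    finally show "y \<in> g ` MG n" using M.component_part[OF x(1)] by blast
  qed
  note tr' = M'.stable_trivial[OF M'.scalars] and tr = M.stable_trivial[OF M.scalars]
    and tr'' = M''.stable_trivial[OF M''.scalars]
  have f_hom: "\<And>x. x \<in> carrier M' \<Longrightarrow> f x \<in> carrier M"
    "\<And>x y. x \<in> carrier M' \<Longrightarrow> y \<in> carrier M' \<Longrightarrow> f (x \<oplus>\<^bsub>M'\<^esub> y) = f x \<oplus>\<^bsub>M\<^esub> f y"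
    "\<And>t x. t \<in> ?T \<Longrightarrow> x \<in> carrier M' \<Longrightarrow> f (t \<odot>\<^bsub>M'\<^esub> x) = t \<odot>\<^bsub>M\<^esub> f x"
    using f_lin M.scalars by blast+
  have g_hom: "\<And>x. x \<in> carrier M \<Longrightarrow> g x \<in> carrier M''"
    "\<And>x y. x \<in> carrier M \<Longrightarrow> y \<in> carrier M \<Longrightarrow> g (x \<oplus>\<^bsub>M\<^esub> y) = g x \<oplus>\<^bsub>M''\<^esub> g y"
    "\<And>t x. t \<in> ?T \<Longrightarrow> x \<in> carrier M \<Longrightarrow> g (t \<odot>\<^bsub>M\<^esub> x) = t \<odot>\<^bsub>M''\<^esub> g x"
    using g_lin M.scalars by blast+
  note hom_f = length_hom_image[where \<tau> = id and \<phi> = f, unfolded image_id id_apply, OF M'.operator_group_axioms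
        M.operator_group_axioms M'.scalars M'.scalars M'.stable_part tr f_hom]
  have hf: "M'.len ?T {m \<in> MG' n. f m \<in> {\<zero>\<^bsub>M\<^esub>}} (MG' n) = M.len ?T {\<zero>\<^bsub>M\<^esub>} (f ` MG' n <+>\<^bsub>M\<^esub> {\<zero>\<^bsub>M\<^esub>})"
    by (rule hom_f(1))
  have st_f: "M.stable ?T (f ` MG' n)" by (rule hom_f(3))
  have hg: "M.len ?T {m \<in> MG n. g m \<in> {\<zero>\<^bsub>M''\<^esub>}} (MG n)
      = M''.len ?T {\<zero>\<^bsub>M''\<^esub>} (g ` MG n <+>\<^bsub>M''\<^esub> {\<zero>\<^bsub>M''\<^esub>})"
    by (rule length_hom_image(1)[where \<tau> = id and \<phi> = g, unfolded image_id id_apply, OF M.operator_group_axioms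
        M''.operator_group_axioms M.scalars M.scalars M.stable_part tr'' g_hom])
  have add_f: "f ` MG' n <+>\<^bsub>M\<^esub> {\<zero>\<^bsub>M\<^esub>} = f ` MG' n"
    using M.sum_upper1[OF st_f tr] M.sum_least[OF st_f order_refl] M.stable_zero[OF st_f] by blast
  have add_g: "MG'' n <+>\<^bsub>M''\<^esub> {\<zero>\<^bsub>M''\<^esub>} = MG'' n"
    using M''.sum_upper1[OF M''.stable_part tr''] M''.sum_least[OF M''.stable_part order_refl]
      M''.stable_zero[OF M''.stable_part] by blast
  have f0: "f \<zero>\<^bsub>M'\<^esub> = \<zero>\<^bsub>M\<^esub>"
    by (rule additive_map_zero[OF M'.abelian_group M.abelian_group f_hom(1,2)])
  have ker_f: "{m \<in> MG' n. f m \<in> {\<zero>\<^bsub>M\<^esub>}} = {\<zero>\<^bsub>M'\<^esub>}"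
  proof -
    have "m = \<zero>\<^bsub>M'\<^esub>" if "m \<in> MG' n" "f m = \<zero>\<^bsub>M\<^esub>" for m
      by (rule inj_onD[OF inj]) (use that f0 M'.part_subset[of n] M'.part_zero[of n] in \<open>simp_all add: subsetD\<close>)
    then show ?thesis using f0 by auto
  qed
  let ?K = "{m \<in> MG n. g m = \<zero>\<^bsub>M''\<^esub>}"
  have "M.len ?T {\<zero>\<^bsub>M\<^esub>} (MG n) = M.len ?T {\<zero>\<^bsub>M\<^esub>} ?K + M.len ?T ?K (MG n)"
  proof (rule M.length_add[OF M.scalars tr _ M.stable_part])
    show K: "M.stable ?T ?K" using st_f by (simp only: im_f)
    show "{\<zero>\<^bsub>M\<^esub>} \<subseteq> ?K" using M.stable_zero[OF K] by simp
  qed blast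
  moreover have "M.len ?T {\<zero>\<^bsub>M\<^esub>} ?K = M'.len ?T {\<zero>\<^bsub>M'\<^esub>} (MG' n)"
    using hf by (simp only: add_f ker_f flip: im_f)
  moreover have "M.len ?T ?K (MG n) = M''.len ?T {\<zero>\<^bsub>M''\<^esub>} (MG'' n)"
    using hg unfolding im_g add_g by simp
  ultimately show ?thesis
    by (simp add: M'.module_length_part M.module_length_part M''.module_length_part)
qed

theorem corollary2p17:
  fixes A :: "'a ring" and \<mm> :: "'a set"
    and S :: "('a, 's) module" and SG :: "('d::finite \<Rightarrow> nat) \<Rightarrow> 's set"
    and M' :: "('s, 'm1) module" and MG' :: "('d \<Rightarrow> nat) \<Rightarrow> 'm1 set"
    and M :: "('s, 'm) module" and MG :: "('d \<Rightarrow> nat) \<Rightarrow> 'm set"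
    and M'' :: "('s, 'm2) module" and MG'' :: "('d \<Rightarrow> nat) \<Rightarrow> 'm2 set"
    and f :: "'m1 \<Rightarrow> 'm" and g :: "'m \<Rightarrow> 'm2"
    and k :: "'d \<Rightarrow> nat"
  assumes "local_ring A \<mm>" and "artinian_ring A"
    and "infinite (carrier (A Quot \<mm>))"
    and "standard_graded_algebra A S SG"
    and "graded_module S SG M' MG'" and "finitely_generated_module S M'"
    and "graded_module S SG M MG" and "finitely_generated_module S M"
    and "graded_module S SG M'' MG''" and "finitely_generated_module S M''"
    and "graded_short_exact S M' MG' M MG M'' MG'' f g"
  shows "(mixed_multiplicity_defined A S M MG k \<longleftrightarrow>
            mixed_multiplicity_defined A S M' MG' k \<and> mixed_multiplicity_defined A S M'' MG'' k)
       \<and> (mixed_multiplicity_defined A S M MG k \<longrightarrow>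
            mixed_coefficient A S M MG k =
            mixed_coefficient A S M' MG' k + mixed_coefficient A S M'' MG'' k)"
proof -
  have A: "cring A" using assms(1) by (simp add: local_ring_def)
  have mods: "finite_graded_module A S SG M' MG'" "finite_graded_module A S SG M MG"
    "finite_graded_module A S SG M'' MG''"
    using assms A by (auto intro: finite_graded_module.intro)
  obtain c' where c': "hilbert_coefficients A S M' MG' c'" "nonneg_top c'"
    by (rule finite_graded_module.nonneg_hilbert_coefficients[OF mods(1)])
  obtain c'' where c'': "hilbert_coefficients A S M'' MG'' c''" "nonneg_top c''"
    by (rule finite_graded_module.nonneg_hilbert_coefficients[OF mods(3)])
  have fin: "finite {k. c' k \<noteq> 0}" "finite {k. c'' k \<noteq> 0}"
    using c' c'' by (simp_all add: hilbert_coefficients_def)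
  have c: "hilbert_coefficients A S M MG (\<lambda>k. c' k + c'' k)"
  proof -
    from c'(1) c''(1) have
      "for_large (\<lambda>n. \<exists>l. module_length A (component_module S M' (MG' n)) = enat l \<and> int l = binomial_polynomial c' n)"
      "for_large (\<lambda>n. \<exists>l. module_length A (component_module S M'' (MG'' n)) = enat l \<and> int l = binomial_polynomial c'' n)"
      unfolding hilbert_coefficients_def for_large_def by simp_all
    from for_large_conj[OF this] have "for_large (\<lambda>n. \<exists>l. module_length A (component_module S M (MG n)) = enat l \<and>
        int l = binomial_polynomial (\<lambda>k. c' k + c'' k) n)"
      by (rule for_large_mono)
        (auto simp: module_length_short_exact[OF mods assms(11)] binomial_polynomial_add[OF fin])
    moreover have "finite {k. c' k + c'' k \<noteq> 0}"
      by (rule finite_subset[of _ "{k. c' k \<noteq> 0} \<union> {k. c'' k \<noteq> 0}"]) (use fin in auto)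
    ultimately show ?thesis by (simp add: hilbert_coefficients_def for_large_def)
  qed
  have "(\<forall>h>k. c' h + c'' h = 0) \<longleftrightarrow> (\<forall>h>k. c' h = 0) \<and> (\<forall>h>k. c'' h = 0)"
  proof
    assume "\<forall>h>k. c' h + c'' h = 0"
    from nonneg_top_summands_vanish[OF fin c'(2) c''(2) this]
    show "(\<forall>h>k. c' h = 0) \<and> (\<forall>h>k. c'' h = 0)" by simp
  qed simp
  then show ?thesis
    unfolding mixed_multiplicity_defined_def mixed_coefficient_eqI[OF c]
      mixed_coefficient_eqI[OF c'(1)] mixed_coefficient_eqI[OF c''(1)] by simp
qed

end
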